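(* Let $K\in C^{0,\alpha}(\mathbb{R}^2)$ satisfy $K(x)\le K(y)$ whenever $|x|\ge|y|$. If $K$ is unbounded below, assume in addition one of: (1) there exists $C>0$ such that $|K(x)|\le C\inf_{y\in B_1(x)}|K(y)|$ for all sufficiently large $|x|$; or (2) there exist $P\ge1$, $C>0$ with $|K(x)|\le C|\ln|x||^P$ for all sufficiently large $|x|$. Let $u\in C^2(\mathbb{R}^2)$ solve $\Delta u+Ke^{2u}=0$, with $\int_{\mathbb{R}^2}|K|e^{2u}\,dx<\infty$, $\sup_{y}\int_{B_R(y)}u^+\,dx<\infty$ for every $R>0$, and $$\int_{\mathbb{R}^2}K(x)e^{2u(x)}\,dx=\kappa_*(K):=\pi\inf\Big\{q>0:\int_{\mathbb{R}^2}|K(x)|(1+|x|)^{-q}\,dx<\infty\Big\}.$$ If moreover $\int_{\mathbb{R}^2}|\ln|x||^2\,|K(x)|e^{2u(x)}\,dx<\infty$, then there exists $x^*\in\mathbb{R}^2$ such that $u(x)\le u(y)$ whenever $|x-x^*|\ge|y-x^*|$ (so $u$ is radially symmetric about and decreasing away from $x^*$). If $K\not\equiv0$ then $x^*=0$ (if $K\equiv 0$, $x^*$ is not restricted).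
   Context: $B_R(y)$ is the open disk of radius $R$ centered at $y$; $u^+=\max\{u,0\}$. *)

theory Defs
  imports "HOL-Analysis.Analysis"
begin

definition holder_loc :: "real \<Rightarrow> (real^2 \<Rightarrow> real) \<Rightarrow> bool" where
  "holder_loc \<alpha> K \<longleftrightarrow>
     (\<forall>S. compact S \<longrightarrow> (\<exists>M. \<forall>x\<in>S. \<forall>y\<in>S. \<bar>K x - K y\<bar> \<le> M * dist x y powr \<alpha>))"

definition C2 :: "(real^2 \<Rightarrow> real) \<Rightarrow> bool" where
  "C2 u \<longleftrightarrow> (\<exists>(u1 :: real^2 \<Rightarrow> ((real^2) \<Rightarrow>\<^sub>L real)) (u2 :: real^2 \<Rightarrow> ((real^2) \<Rightarrow>\<^sub>L ((real^2) \<Rightarrow>\<^sub>L real))).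
      (\<forall>x. (u has_derivative blinfun_apply (u1 x)) (at x)) \<and>
      (\<forall>x. (u1 has_derivative blinfun_apply (u2 x)) (at x)) \<and>
      continuous_on UNIV u2)"

definition laplacian :: "(real^2 \<Rightarrow> real) \<Rightarrow> real^2 \<Rightarrow> real" where
  "laplacian u x = (\<Sum>i\<in>UNIV. (deriv ^^ 2) (\<lambda>t. u (x + t *\<^sub>R axis i 1)) 0)"

text \<open>kappa_*(K) = pi * inf {q > 0. int |K| (1+|x|)^(-q) < infinity}, valued in ereal
  (the infimum of the empty set being +infinity).\<close>
definition kappa_star :: "(real^2 \<Rightarrow> real) \<Rightarrow> ereal" where
  "kappa_star K = ereal pi *
     (INF q \<in> {q::real. q > 0 \<and> integrable lborel (\<lambda>x. \<bar>K x\<bar> * (1 + norm x) powr (-q))}. ereal q)"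

end

theory Submission
  imports Defs
begin

text \<open>
Averaging \<open>u\<close> over large discs and comparing the averages around two centres (this is where the bound on
\<open>u\<^sup>+\<close> enters) shows that \<open>u\<close> equals, up to a constant, the logarithmic potential of \<open>K exp (2 u)\<close>.
Together with the definition of \<open>\<kappa>\<^sub>*\<close> and the logarithmic moment this gives \<open>u x = - a ln (1 + norm x) + O(1)\<close>
with \<open>2 pi a = \<kappa>\<^sub>*\<close>. If \<open>K\<close> is negative somewhere, the definition of \<open>\<kappa>\<^sub>*\<close> alone controls the growth of \<open>\<bar>K\<bar>\<close>;
if \<open>K\<close> is nonnegative, a rescaling argument first bounds \<open>u\<close> from above. A nonzero constant \<open>K\<close>
is impossible: \<open>\<kappa>\<^sub>* = 2 pi\<close> would force \<open>exp (2 u)\<close> to decay like the nonintegrable \<open>norm x powr (-2)\<close>.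

The moving plane method then compares \<open>u\<close> with its reflections. The squared logarithm in the moment
condition makes \<open>K exp (2 u)\<close> small against \<open>1 / (norm x * ln (norm x))\<^sup>2\<close> wherever \<open>K > 0\<close>, which is exactly what the
supersolution \<open>sqrt (ln (norm x))\<close> tolerates, so the planes can be moved up to the origin from every direction.
\<close>

section \<open>Integration in the plane\<close>

text \<open>A positive superharmonic function on an exterior domain of the plane cannot tend to 0,
  so a radial barrier cannot decay; the one used grows. With \<open>t = norm x ^ 2 + 3\<close>,
  minus the Laplacian of \<open>sqrt (ln t)\<close> is \<open>1 / (t * ln t * sqrt (ln t))\<close>
  to leading order. Divided by the barrier itself this has order
  \<open>1 / (norm x * ln (norm x)) ^ 2\<close>, the origin of the squared logarithm. Since the
  barrier is unbounded, a lower bound for the difference of \<open>u\<close> and its reflection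
  replaces decay at infinity. Next to the mirror line, where this difference vanishes, a steep
  parabola does the work usually given to boundary derivatives: planes can then be obstructed only
  on compact sets at positive distance from the line. All means are over discs, not circles: they
  obey a differential identity that follows from translation and scaling of Lebesgue measure, and it
  yields both the representation of \<open>u\<close> and the strong maximum principle. The centre is
  the origin because a reflection across \<open>x \<bullet> e = \<tau>\<close> with
  \<open>\<tau> > 0\<close> moves the side of the origin outward, where \<open>K\<close> is not
  larger.\<close>

lemma has_real_derivative_integral:
  fixes f f' :: "real \<Rightarrow> 'a \<Rightarrow> real"
  assumes t0: "t0 \<in> {a<..<b}"
    and der: "\<And>t y. t \<in> {a<..<b} \<Longrightarrow> ((\<lambda>t. f t y) has_real_derivative f' t y) (at t)"
    and bd: "\<And>t y. t \<in> {a<..<b} \<Longrightarrow> \<bar>f' t y\<bar> \<le> D y"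
    and D: "integrable M D"
    and f: "\<And>t. t \<in> {a<..<b} \<Longrightarrow> integrable M (f t)"
  shows "((\<lambda>t. \<integral>y. f t y \<partial>M) has_real_derivative (\<integral>y. f' t0 y \<partial>M)) (at t0)"
proof -
  \<comment> \<open>By the mean value theorem \<open>D\<close> dominates every difference quotient,
    so dominated convergence along sequences applies.\<close>
  have lip: "\<bar>f s y - f t0 y\<bar> \<le> D y * \<bar>s - t0\<bar>" if s: "s \<in> {a<..<b}" for s y
  proof -
    have "norm (f s y - f t0 y) \<le> D y * norm (s - t0)"
    proof (rule field_differentiable_bound[of "{a<..<b}" _ "\<lambda>t. f' t y"])
      show "convex {a<..<b}" by simp
      show "((\<lambda>t. f t y) has_field_derivative f' z y) (at z within {a<..<b})" if "z \<in> {a<..<b}" for z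
        using der[OF that] has_field_derivative_at_within by blast
    qed (use bd s t0 in auto)
    then show ?thesis by simp
  qed
  show ?thesis
    unfolding has_field_derivative_iff tendsto_at_iff_sequentially comp_def
  proof (intro allI impI)
    fix X assume X: "\<forall>i. X i \<in> UNIV - {t0}" "X \<longlonglongrightarrow> t0"
    obtain N where N: "\<And>n. n \<ge> N \<Longrightarrow> X n \<in> {a<..<b}"
      using topological_tendstoD[OF X(2), of "{a<..<b}"] t0
      by (auto simp: eventually_sequentially)
    define s where "s n y = (f (X (n+N)) y - f t0 y) / (X (n+N) - t0)" for n y
    have s_int: "integrable M (s n)" for n
      unfolding s_def using f[OF N[of "n+N"]] f[OF t0] by auto
    have lim: "(\<lambda>n. s n y) \<longlonglongrightarrow> f' t0 y" for y
    proof -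
      have "(\<lambda>n. X (n+N)) \<longlonglongrightarrow> t0" using X(2) LIMSEQ_ignore_initial_segment by blast
      moreover have "\<forall>n. X (n+N) \<in> UNIV - {t0}" using X(1) by blast
      ultimately show ?thesis
        using der[OF t0, of y, unfolded has_field_derivative_iff tendsto_at_iff_sequentially comp_def]
        unfolding s_def by (auto dest!: spec[of _ "\<lambda>n. X (n+N)"])
    qed
    have [measurable]: "s n \<in> borel_measurable M" for n
      using s_int by (rule borel_measurable_integrable)
    have [measurable]: "f' t0 \<in> borel_measurable M"
      using lim by (rule borel_measurable_LIMSEQ_real) simp
    have "(\<lambda>n. integral\<^sup>L M (s n)) \<longlonglongrightarrow> integral\<^sup>L M (f' t0)"
    proof (rule integral_dominated_convergence[OF _ _ D])
      show "AE y in M. norm (s n y) \<le> D y" for n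
      proof (rule AE_I2)
        fix y
        have "\<bar>f (X (n+N)) y - f t0 y\<bar> \<le> D y * \<bar>X (n+N) - t0\<bar>" by (intro lip N) simp
        moreover have "X (n+N) \<noteq> t0" using X(1) by blast
        ultimately show "norm (s n y) \<le> D y" by (simp add: s_def field_simps)
      qed
    qed (use lim in auto)
    moreover have "integral\<^sup>L M (s n) = (integral\<^sup>L M (f (X (n+N))) - integral\<^sup>L M (f t0)) / (X (n+N) - t0)" for n
      unfolding s_def using f[OF N[of "n+N"]] f[OF t0] by simp
    ultimately have "(\<lambda>n. (integral\<^sup>L M (f (X (n+N))) - integral\<^sup>L M (f t0)) / (X (n+N) - t0)) \<longlonglongrightarrow> integral\<^sup>L M (f' t0)"
      by simp
    then show "(\<lambda>n. (integral\<^sup>L M (f (X n)) - integral\<^sup>L M (f t0)) / (X n - t0)) \<longlonglongrightarrow> integral\<^sup>L M (f' t0)"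
      by (rule LIMSEQ_offset)
  qed
qed

lemma lborel_integral_scale:
  fixes f :: "'a::euclidean_space \<Rightarrow> real"
  assumes c: "c \<noteq> 0" and f [measurable]: "f \<in> borel_measurable borel"
  shows "(\<integral>x. f x \<partial>lborel) = \<bar>c\<bar> ^ DIM('a) * (\<integral>x. f (t + c *\<^sub>R x) \<partial>lborel)"
  by (subst lborel_affine[OF c, of t], subst integral_density) (auto simp: integral_distr)

lemma lborel_integrable_scale:
  fixes f :: "'a::euclidean_space \<Rightarrow> real"
  assumes c: "c \<noteq> 0" and f: "integrable lborel f"
  shows "integrable lborel (\<lambda>x. f (t + c *\<^sub>R x))"
proof -
  have [measurable]: "f \<in> borel_measurable borel" using f by auto
  from f have "integrable (density (distr lborel borel (\<lambda>x. t + c *\<^sub>R x)) (\<lambda>_. \<bar>c\<bar>^DIM('a))) f"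
    by (subst (asm) lborel_affine[OF c, of t])
  then show ?thesis using c by (subst (asm) integrable_density) (auto simp: integrable_distr_eq)
qed

text \<open>Translation invariance makes the integral of every difference quotient vanish.\<close>
lemma integral_directional_derivative_eq_0:
  fixes G G' :: "'a::euclidean_space \<Rightarrow> real" and e :: 'a
  assumes G: "integrable lborel G" and D: "integrable lborel D"
    and bd: "\<And>h y. 0 < h \<Longrightarrow> h < 1 \<Longrightarrow> \<bar>G (y + h *\<^sub>R e) - G y\<bar> \<le> h * D y"
    and der: "AE y in lborel. ((\<lambda>h. G (y + h *\<^sub>R e)) has_real_derivative G' y) (at 0)"
    and m: "G' \<in> borel_measurable borel"
  shows "(\<integral>y. G' y \<partial>lborel) = 0"
proof -
  define X :: "nat \<Rightarrow> real" where "X n = inverse (real (Suc (Suc n)))" for n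
  have X: "0 < X n" "X n < 1" for n by (auto simp: X_def field_simps)
  have X0: "X \<longlonglongrightarrow> 0" unfolding X_def
    by (rule LIMSEQ_Suc[OF LIMSEQ_inverse_real_of_nat])
  define s where "s n y = (G (y + X n *\<^sub>R e) - G y) / X n" for n y
  have Gs: "integrable lborel (\<lambda>y. G (y + X n *\<^sub>R e))" for n
    using lborel_integrable_scale[of 1 G "X n *\<^sub>R e", OF _ G] by (simp add: add.commute)
  have "integral\<^sup>L lborel (s n) = 0" for n
  proof -
    have "(\<integral>y. G (y + X n *\<^sub>R e) \<partial>lborel) = (\<integral>y. G y \<partial>lborel)"
      using lborel_integral_scale[of 1 G "X n *\<^sub>R e"] G by (simp add: add.commute)
    then show ?thesis unfolding s_def using Gs G by simp
  qed
  moreover have "(\<lambda>n. integral\<^sup>L lborel (s n)) \<longlonglongrightarrow> integral\<^sup>L lborel G'"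
  proof (rule integral_dominated_convergence[OF _ _ D])
    show "AE y in lborel. norm (s n y) \<le> D y" for n
      using bd[OF X] X[of n] by (auto simp: s_def field_simps)
    show "s n \<in> borel_measurable lborel" for n
      unfolding s_def using Gs[of n] G by auto
    show "AE y in lborel. (\<lambda>n. s n y) \<longlonglongrightarrow> G' y"
      using der
    proof eventually_elim
      case (elim y)
      have "\<forall>n. X n \<in> UNIV - {0}" using X by (metis DiffI UNIV_I insert_iff empty_iff less_irrefl)
      then show ?case
        using elim[unfolded has_field_derivative_iff tendsto_at_iff_sequentially comp_def] X0
        by (auto simp: s_def dest!: spec[of _ X])
    qed
  qed (use m in auto)
  ultimately show ?thesis by (simp add: LIMSEQ_const_iff)
qed

lemma measure_ball_plane: "r \<ge> 0 \<Longrightarrow> measure lborel (ball (c::real^2) r) = pi * r\<^sup>2"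
  by (simp add: content_ball unit_ball_vol_2)

lemma emeasure_ball_plane: "r \<ge> 0 \<Longrightarrow> emeasure lborel (ball (c::real^2) r) = ennreal (pi * r\<^sup>2)"
  by (simp add: emeasure_ball unit_ball_vol_2)

text \<open>Takes the place of polar coordinates: a step majorant on concentric discs turns the
  integral into a numerical series. Shrinking radii treat a singularity at 0, growing radii a tail;
  the point 0 itself is a null set.\<close>

lemma integrable_dyadic_majorant:
  fixes f :: "real^2 \<Rightarrow> real"
  assumes le: "\<And>y. y \<noteq> 0 \<Longrightarrow> ennreal (f y) \<le> (\<Sum>k. ennreal (c k) * indicator (ball 0 (r k)) y)"
    and r: "\<And>k. r k \<ge> 0" and c: "\<And>k. c k \<ge> 0" and s: "summable (\<lambda>k. c k * (r k)\<^sup>2)"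
    and [measurable]: "f \<in> borel_measurable borel" and f0: "\<And>y. f y \<ge> 0"
  shows "integrable lborel f"
proof -
  have "(\<integral>\<^sup>+y. ennreal (f y) \<partial>lborel) \<le> (\<integral>\<^sup>+y. (\<Sum>k. ennreal (c k) * indicator (ball 0 (r k)) (y::real^2)) \<partial>lborel)"
  proof (rule nn_integral_mono_AE)
    have "AE y in lborel. y \<noteq> (0::real^2)" by (rule AE_lborel_singleton)
    then show "AE y in lborel. ennreal (f y) \<le> (\<Sum>k. ennreal (c k) * indicator (ball 0 (r k)) y)"
      by eventually_elim (rule le)
  qed
  also have "\<dots> = (\<Sum>k. \<integral>\<^sup>+y. ennreal (c k) * indicator (ball 0 (r k)) (y::real^2) \<partial>lborel)"
    by (rule nn_integral_suminf) (intro borel_measurable_times_ennreal borel_measurable_const borel_measurable_indicator; simp)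
  also have "\<dots> = (\<Sum>k. ennreal (pi * (c k * (r k)\<^sup>2)))"
    using r c by (simp add: nn_integral_cmult_indicator emeasure_ball_plane ennreal_mult[symmetric] ac_simps)
  also have "\<dots> < \<infinity>"
    using s r c by (subst suminf_ennreal2) (auto intro: summable_mult)
  finally show ?thesis using f0 by (intro integrableI_nonneg) auto
qed

text \<open>The negative part of the logarithm, that is, the singular part of the potential kernel.
  Because \<open>ln 0 = 0\<close>, its value at the origin is 0.\<close>

definition ln_inv :: "real^2 \<Rightarrow> real" where
  "ln_inv y = (if norm y < 1 then - ln (norm y) else 0)"

lemma ln_inv_nonneg [simp]: "ln_inv y \<ge> 0"
  by (cases "y = 0") (auto simp: ln_inv_def)

lemma ln_inv_measurable [measurable]: "ln_inv \<in> borel_measurable borel"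
  unfolding ln_inv_def[abs_def] by measurable

text \<open>If \<open>n\<close> is least with \<open>(1/2)^n \<le> norm y\<close>, then
  \<open>- ln (norm y) \<le> n * ln 2\<close>, and \<open>y\<close> lies in exactly the
  \<open>n\<close> discs of radius \<open>(1/2)^k\<close> with \<open>k < n\<close>. The resulting
  series is geometric with ratio 1/4.\<close>

lemma integrable_ln_inv: "integrable lborel ln_inv"
proof (rule integrable_dyadic_majorant[where c = "\<lambda>_. ln 2" and r = "\<lambda>k. (1/2)^k"])
  fix y :: "real^2" assume y: "y \<noteq> 0"
  show "ennreal (ln_inv y) \<le> (\<Sum>k. ennreal (ln 2) * indicator (ball 0 ((1/2)^k)) y)"
  proof (cases "norm y < 1")
    case True
    have "\<exists>n. (1/2::real)^n \<le> norm y"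
      using real_arch_pow_inv[of "norm y" "1/2"] y by (auto intro: less_imp_le)
    then obtain n where n: "(1/2::real)^n \<le> norm y" "\<forall>m<n. \<not> (1/2::real)^m \<le> norm y"
      using exists_least_iff[of "\<lambda>n. (1/2::real)^n \<le> norm y"] by blast
    have "ln ((1/2::real)^n) \<le> ln (norm y)" using n(1) by (subst ln_le_cancel_iff) (use y in auto)
    then have "ln_inv y \<le> real n * ln 2" using True by (simp add: ln_inv_def ln_realpow ln_div)
    then have "ennreal (ln_inv y) \<le> ennreal (real n * ln 2)" by (rule ennreal_leI)
    also have "\<dots> = (\<Sum>k<n. ennreal (ln 2) * indicator (ball 0 ((1/2)^k)) y)"
      using n(2) by (simp add: dist_norm not_le ennreal_mult ennreal_of_nat_eq_real_of_nat)
    also have "\<dots> \<le> (\<Sum>k. ennreal (ln 2) * indicator (ball 0 ((1/2)^k)) y)"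
      by (rule sum_le_suminf) auto
    finally show ?thesis .
  qed (simp add: ln_inv_def)
next
  have "summable (\<lambda>k. ln 2 * (1/4::real)^k)" by (intro summable_mult summable_geometric) auto
  moreover have "(\<lambda>k. ln 2 * (1/4::real)^k) = (\<lambda>k. ln 2 * (((1/2)^k)\<^sup>2))"
    by (simp add: fun_eq_iff power2_eq_square flip: power_mult_distrib)
  ultimately show "summable (\<lambda>k. ln 2 * (((1/2::real)^k)\<^sup>2))" by simp
qed auto

definition ln_mass :: real where "ln_mass = (\<integral>y. ln_inv y \<partial>lborel)"

lemma ln_mass_nonneg: "ln_mass \<ge> 0" by (simp add: ln_mass_def)

lemma integrable_ln_inv_affine: "c \<noteq> 0 \<Longrightarrow> integrable lborel (\<lambda>y. ln_inv (x + c *\<^sub>R y))"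
  by (rule lborel_integrable_scale[OF _ integrable_ln_inv])

lemma integrable_ln_inv_shift [simp]: "integrable lborel (\<lambda>y. ln_inv (x - y))"
  using integrable_ln_inv_affine[of "-1" x] by simp

lemma integral_ln_inv_shift: "(\<integral>y. ln_inv (x - y) \<partial>lborel) = ln_mass"
  using lborel_integral_scale[of "-1" ln_inv x] by (simp add: ln_mass_def)

lemma integrable_ln_inv_scale: "\<rho> > 0 \<Longrightarrow> integrable lborel (\<lambda>y. ln_inv ((x - y) /\<^sub>R \<rho>))"
  using integrable_ln_inv_affine[of "- inverse \<rho>" "x /\<^sub>R \<rho>"] by (simp add: algebra_simps)

lemma integral_ln_inv_scale:
  assumes "\<rho> > 0" shows "(\<integral>y. ln_inv ((x - y) /\<^sub>R \<rho>) \<partial>lborel) = \<rho>\<^sup>2 * ln_mass"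
proof -
  have eq: "x /\<^sub>R \<rho> + (- inverse \<rho>) *\<^sub>R y = (x - y) /\<^sub>R \<rho>" for y by (simp add: scaleR_diff_right)
  have "ln_mass = (inverse \<rho>)\<^sup>2 * (\<integral>y. ln_inv ((x - y) /\<^sub>R \<rho>) \<partial>lborel)"
    using lborel_integral_scale[of "- inverse \<rho>" ln_inv "x /\<^sub>R \<rho>"] assms unfolding eq ln_mass_def
    by (simp add: abs_if split: if_splits)
  then show ?thesis using assms by (simp add: power_inverse field_simps)
qed

section \<open>Twice continuously differentiable functions and solid means\<close>

text \<open>Riesz form of \<open>C2\<close>: the first derivative is a vector field and the second a
  field of linear maps, continuous in each fixed direction. Directional derivatives become inner
  products, and the Laplacian a trace.\<close>

definition has_grad_hess :: "(real^2 \<Rightarrow> real) \<Rightarrow> (real^2 \<Rightarrow> real^2) \<Rightarrow> (real^2 \<Rightarrow> real^2 \<Rightarrow> real^2) \<Rightarrow> bool" where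
  "has_grad_hess u g H \<longleftrightarrow> (\<forall>x. (u has_derivative (\<lambda>v. g x \<bullet> v)) (at x)) \<and>
     (\<forall>x. (g has_derivative H x) (at x)) \<and> (\<forall>v. continuous_on UNIV (\<lambda>x. H x v))"

definition trace_hess :: "(real^2 \<Rightarrow> real^2 \<Rightarrow> real^2) \<Rightarrow> real^2 \<Rightarrow> real" where
  "trace_hess H x = (\<Sum>i\<in>UNIV. H x (axis i 1) \<bullet> axis i 1)"

lemma C2_imp_has_grad_hess:
  assumes "C2 u" shows "\<exists>g H. has_grad_hess u g H"
proof -
  obtain u1 u2 where u1: "\<And>x. (u has_derivative blinfun_apply (u1 x)) (at x)"
    and u2: "\<And>x. (u1 has_derivative blinfun_apply (u2 x)) (at x)" and c: "continuous_on UNIV u2"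
    using assms unfolding C2_def by blast
  \<comment> \<open>The Riesz isomorphism in coordinates; as a bounded linear map it carries
    derivatives and continuity over.\<close>
  define \<Lambda> :: "((real^2) \<Rightarrow>\<^sub>L real) \<Rightarrow> real^2" where "\<Lambda> L = (\<Sum>b\<in>Basis. blinfun_apply L b *\<^sub>R b)" for L
  have \<Lambda>: "bounded_linear \<Lambda>" unfolding \<Lambda>_def[abs_def]
    by (intro bounded_linear_sum bounded_linear_compose[OF bounded_linear_scaleR_left] blinfun.bounded_linear_left)
  have \<Lambda>_inner: "\<Lambda> L \<bullet> v = blinfun_apply L v" for L v
  proof -
    have "blinfun_apply L v = blinfun_apply L (\<Sum>b\<in>Basis. (v \<bullet> b) *\<^sub>R b)" by (simp add: euclidean_representation)
    also have "\<dots> = (\<Sum>b\<in>Basis. (v \<bullet> b) * blinfun_apply L b)" by (simp only: blinfun.sum_right blinfun.scaleR_right real_scaleR_def)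
    finally show ?thesis by (simp add: \<Lambda>_def inner_sum_left inner_commute[of v] mult.commute)
  qed
  have "has_grad_hess u (\<lambda>x. \<Lambda> (u1 x)) (\<lambda>x v. \<Lambda> (u2 x v))"
    unfolding has_grad_hess_def \<Lambda>_inner
    using u1 u2 c
    by (auto intro!: bounded_linear.has_derivative[OF \<Lambda>] bounded_linear.continuous_on[OF \<Lambda>] continuous_intros)
  then show ?thesis by blast
qed

context
  fixes u g H assumes gh: "has_grad_hess u g H"
begin

lemma grad: "(u has_derivative (\<lambda>v. g x \<bullet> v)) (at x)"
  and hess: "(g has_derivative H x) (at x)"
  and hess_continuous: "continuous_on S (\<lambda>x. H x v)"
  using gh unfolding has_grad_hess_def by (auto intro: continuous_on_subset)

lemma has_grad_hess_continuous: "continuous_on S u"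
  by (meson grad has_derivative_continuous continuous_at_imp_continuous_on)

lemma grad_continuous: "continuous_on S g"
  by (meson hess has_derivative_continuous continuous_at_imp_continuous_on)

lemma trace_continuous: "continuous_on S (trace_hess H)"
  unfolding trace_hess_def[abs_def] by (intro continuous_intros hess_continuous)

lemma hess_linear: "linear (H x)"
  using hess has_derivative_linear by blast

lemma deriv_along_line: "((\<lambda>t. u (x + t *\<^sub>R e)) has_real_derivative g (x + t *\<^sub>R e) \<bullet> e) (at t)"
proof -
  have "((\<lambda>t. u (x + t *\<^sub>R e)) has_derivative (\<lambda>s. g (x + t *\<^sub>R e) \<bullet> (s *\<^sub>R e))) (at t)"
    by (rule has_derivative_compose[OF _ grad, of "\<lambda>t. x + t *\<^sub>R e"]) (auto intro!: derivative_eq_intros)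
  then show ?thesis by (simp add: has_field_derivative_def mult_commute_abs mult.commute)
qed

lemma deriv2_along_line: "((\<lambda>t. g (x + t *\<^sub>R e) \<bullet> v) has_real_derivative H (x + t *\<^sub>R e) e \<bullet> v) (at t)"
proof -
  have "((\<lambda>t. g (x + t *\<^sub>R e)) has_derivative (\<lambda>s. H (x + t *\<^sub>R e) (s *\<^sub>R e))) (at t)"
    by (rule has_derivative_compose[OF _ hess, of "\<lambda>t. x + t *\<^sub>R e"]) (auto intro!: derivative_eq_intros)
  then have "((\<lambda>t. g (x + t *\<^sub>R e) \<bullet> v) has_derivative (\<lambda>s. H (x + t *\<^sub>R e) (s *\<^sub>R e) \<bullet> v)) (at t)"
    by (rule has_derivative_inner_left)
  then show ?thesis by (simp add: has_field_derivative_def linear_scale[OF hess_linear] mult_commute_abs mult.commute)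
qed

lemma laplacian_eq_trace: "laplacian u x = trace_hess H x"
proof -
  have "(deriv ^^ 2) (\<lambda>t. u (x + t *\<^sub>R axis i 1)) 0 = H x (axis i 1) \<bullet> axis i 1" for i
  proof -
    have "deriv (\<lambda>t. u (x + t *\<^sub>R axis i 1)) = (\<lambda>t. g (x + t *\<^sub>R axis i 1) \<bullet> axis i 1)"
      by (rule ext, rule DERIV_imp_deriv, rule deriv_along_line)
    then show ?thesis using deriv2_along_line[of x "axis i 1" _ 0]
      by (auto simp: numeral_2_eq_2 intro: DERIV_imp_deriv)
  qed
  then show ?thesis by (simp add: laplacian_def trace_hess_def)
qed

end

lemma bounded_on_cball:
  fixes f :: "real^2 \<Rightarrow> 'b::real_normed_vector"
  assumes "continuous_on UNIV f" obtains M where "M > 0" "\<And>y. y \<in> cball x r \<Longrightarrow> norm (f y) \<le> M"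
proof -
  have "bounded (f ` cball x r)"
    by (intro compact_imp_bounded compact_continuous_image continuous_on_subset[OF assms]) auto
  then show thesis using that unfolding bounded_pos by auto
qed

lemma integrable_indicator_ball:
  fixes f :: "real^2 \<Rightarrow> real"
  assumes "continuous_on UNIV f" shows "integrable lborel (\<lambda>y. indicator (ball x r) y * f y)"
proof -
  have [measurable]: "f \<in> borel_measurable borel" using assms by (rule borel_measurable_continuous_onI)
  have "integrable lborel (\<lambda>y. indicator (cball x r) y *\<^sub>R f y)"
    by (rule borel_integrable_compact) (auto intro: continuous_on_subset[OF assms])
  then show ?thesis
    by (rule Bochner_Integration.integrable_bound) (auto simp: indicator_def)
qed

lemma AE_not_sphere: "AE y in lborel. y \<notin> sphere (c::real^2) r"
  by (rule AE_not_in, rule iffD2[OF null_sets_completion_iff[symmetric]])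
     (use negligible_sphere[of c r] in \<open>auto simp: negligible_iff_null_sets\<close>)

text \<open>Integration by parts against the weight \<open>(1 - (norm y)^2) / 2\<close>: its
  gradient is \<open>- y\<close> and it vanishes on the unit circle, so no boundary term appears.
  The argument treats one coordinate direction at a time and sums.\<close>

lemma integral_trace_hess:
  fixes x :: "real^2" and t :: real
  assumes gh: "has_grad_hess u g H"
  shows "(\<integral>y. indicator (ball 0 1) y * (g (x + t *\<^sub>R y) \<bullet> y) \<partial>lborel) =
    t * (\<integral>y. indicator (ball 0 1) y * ((1 - (norm y)\<^sup>2) / 2 * trace_hess H (x + t *\<^sub>R y)) \<partial>lborel)"
proof -
  define I where "I = (indicator (ball 0 1) :: real^2 \<Rightarrow> real)"
  have cg: "continuous_on UNIV (\<lambda>y. g (x + t *\<^sub>R y) \<bullet> v)" for v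
    by (intro continuous_intros continuous_on_compose2[OF grad_continuous[OF gh, of UNIV]]) auto
  have cH: "continuous_on UNIV (\<lambda>y. H (x + t *\<^sub>R y) w \<bullet> v)" for v w
    by (intro continuous_intros continuous_on_compose2[OF hess_continuous[OF gh, of UNIV]]) auto
  have i1: "integrable lborel (\<lambda>y. I y * ((g (x + t *\<^sub>R y) \<bullet> v) * (y \<bullet> v)))" for v
    unfolding I_def by (intro integrable_indicator_ball continuous_intros cg)
  have i2: "integrable lborel (\<lambda>y. I y * ((1 - (norm y)\<^sup>2) / 2 * (H (x + t *\<^sub>R y) v \<bullet> v)))" for v
    unfolding I_def by (intro integrable_indicator_ball continuous_intros cH) auto
  have main: "(\<integral>y. I y * ((g (x + t *\<^sub>R y) \<bullet> e) * (y \<bullet> e)) \<partial>lborel) =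
     t * (\<integral>y. I y * ((1 - (norm y)\<^sup>2) / 2 * (H (x + t *\<^sub>R y) e \<bullet> e)) \<partial>lborel)" if e: "norm e = 1" for e
  proof -
    \<comment> \<open>Continued by zero, the weight is Lipschitz on bounded sets and fails to be
      differentiable only on the unit circle, a null set. Integrating the derivative of the product
      \<open>G\<close> along \<open>e\<close> then gives the formula.\<close>
    define p where "p y = max 0 ((1 - (norm y)\<^sup>2) / 2)" for y :: "real^2"
    define v where "v y = g (x + t *\<^sub>R y) \<bullet> e" for y
    define G where "G y = p y * v y" for y
    define G' where "G' y = I y * (t * ((1 - (norm y)\<^sup>2) / 2 * (H (x + t *\<^sub>R y) e \<bullet> e)) - (v y * (y \<bullet> e)))" for y
    have cv: "continuous_on UNIV v" unfolding v_def by (rule cg)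
    obtain M where M: "M > 0" "\<And>y. y \<in> cball 0 2 \<Longrightarrow> \<bar>v y\<bar> \<le> M"
      using bounded_on_cball[OF cv, of 0 2] by auto
    obtain L where L: "L > 0" "\<And>y. y \<in> cball 0 2 \<Longrightarrow> \<bar>H (x + t *\<^sub>R y) e \<bullet> e\<bar> \<le> L"
      using bounded_on_cball[OF cH[of e e], of 0 2] by auto
    have dv: "((\<lambda>h. v (y + h *\<^sub>R e)) has_real_derivative t * (H (x + t *\<^sub>R (y + h *\<^sub>R e)) e \<bullet> e)) (at h)" for y h
    proof -
      have "((\<lambda>h. v (y + h *\<^sub>R e)) has_derivative (\<lambda>s. H (x + t *\<^sub>R (y + h *\<^sub>R e)) (t *\<^sub>R s *\<^sub>R e) \<bullet> e)) (at h)"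
        unfolding v_def
        by (rule has_derivative_inner_left)
           (rule has_derivative_compose[OF _ hess[OF gh], of "\<lambda>h. x + t *\<^sub>R (y + h *\<^sub>R e)"], auto intro!: derivative_eq_intros)
      then show ?thesis
        by (simp add: has_field_derivative_def linear_scale[OF hess_linear[OF gh]] mult_commute_abs ac_simps)
    qed
    have "(\<integral>y. G' y \<partial>lborel) = 0"
    \<comment> \<open>For \<open>0 < h < 1\<close> the difference vanishes unless one of the two
      points is in the unit disc, and then both lie in \<open>cball 0 2\<close>. There
      \<open>\<bar>t\<bar> * L\<close> bounds the slope of \<open>v\<close>, \<open>M\<close> bounds
      \<open>v\<close>, and the weight changes by at most \<open>2 * h\<close>.\<close>
    proof (rule integral_directional_derivative_eq_0[of G "\<lambda>y. (\<bar>t\<bar> * L + 2 * M) * indicator (cball 0 2) y" e])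
      have "G y = indicator (ball 0 2) y * G y" for y :: "real^2"
      proof (cases "norm y < 2")
        case False
        then have "2\<^sup>2 \<le> (norm y)\<^sup>2" by (intro power_mono) auto
        then show ?thesis by (simp add: G_def p_def max_def indicator_def)
      qed (simp add: indicator_def)
      moreover have "integrable lborel (\<lambda>y. indicator (ball 0 2) y * G y)"
        unfolding G_def p_def by (intro integrable_indicator_ball continuous_intros cv) auto
      ultimately show "integrable lborel G" by presburger
      show "integrable lborel (\<lambda>y. (\<bar>t\<bar> * L + 2 * M) * indicator (cball (0::real^2) 2) y)"
        by (intro integrable_mult_right integrable_real_indicator) (auto intro!: emeasure_bounded_finite[unfolded infinity_ennreal_def])
      show "G' \<in> borel_measurable borel"
      proof -
        have "integrable lborel G'" unfolding G'_def
          unfolding I_def v_def by (intro integrable_indicator_ball continuous_intros cg cH) auto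
        then show ?thesis by auto
      qed
      show "\<bar>G (y + h *\<^sub>R e) - G y\<bar> \<le> h * ((\<bar>t\<bar> * L + 2 * M) * indicator (cball 0 2) y)" if h: "0 < h" "h < 1" for h y
      proof (cases "norm y < 1 \<or> norm (y + h *\<^sub>R e) < 1")
        case True
        have n: "norm (y + h *\<^sub>R e) \<le> norm y + h" "norm y \<le> norm (y + h *\<^sub>R e) + h"
          using norm_triangle_ineq[of y "h *\<^sub>R e"] norm_triangle_ineq4[of "y + h *\<^sub>R e" "h *\<^sub>R e"] e h by auto
        have in2: "y \<in> cball 0 2" "y + h *\<^sub>R e \<in> cball 0 2" using n True h by auto
        have seg: "y + s *\<^sub>R e \<in> cball 0 2" if "s \<in> {0..h}" for s
        proof -
          have "y + s *\<^sub>R e = (1 - s/h) *\<^sub>R y + (s/h) *\<^sub>R (y + h *\<^sub>R e)" using h by (simp add: algebra_simps)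
          then show ?thesis using convexD[OF convex_cball in2, of "1 - s/h" "s/h"] that h by simp
        qed
        have "norm (v (y + h *\<^sub>R e) - v (y + 0 *\<^sub>R e)) \<le> (\<bar>t\<bar> * L) * norm (h - 0)"
        proof (rule field_differentiable_bound[of "{0..h}" "\<lambda>h. v (y + h *\<^sub>R e)"])
          show "((\<lambda>h. v (y + h *\<^sub>R e)) has_field_derivative t * (H (x + t *\<^sub>R (y + z *\<^sub>R e)) e \<bullet> e)) (at z within {0..h})" for z
            by (rule has_field_derivative_at_within[OF dv])
          show "norm (t * (H (x + t *\<^sub>R (y + z *\<^sub>R e)) e \<bullet> e)) \<le> \<bar>t\<bar> * L" if "z \<in> {0..h}" for z
            using L(2)[OF seg[OF that]] by (simp add: abs_mult mult_left_mono)
        qed (use h in auto)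
        then have A: "\<bar>v (y + h *\<^sub>R e) - v y\<bar> \<le> \<bar>t\<bar> * L * h" using h by simp
        have "\<bar>p (y + h *\<^sub>R e) - p y\<bar> \<le> \<bar>(norm (y + h *\<^sub>R e))\<^sup>2 - (norm y)\<^sup>2\<bar> / 2"
        proof -
          have "\<bar>max 0 ((1 - X) / 2) - max 0 ((1 - Y) / 2)\<bar> \<le> \<bar>X - Y\<bar> / 2" for X Y :: real
            by (simp add: max_def abs_if field_simps) 
          then show ?thesis unfolding p_def .
        qed
        also have "\<dots> = \<bar>norm (y + h *\<^sub>R e) - norm y\<bar> * (norm (y + h *\<^sub>R e) + norm y) / 2"
          by (simp only: power2_eq_square square_diff_square_factored abs_mult mult.commute) simp
        also have "\<dots> \<le> h * 4 / 2"
          using n in2 h by (intro divide_right_mono mult_mono) auto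
        finally have B: "\<bar>p (y + h *\<^sub>R e) - p y\<bar> \<le> 2 * h" by simp
        have C: "\<bar>p z\<bar> \<le> 1" for z
          by (auto simp: p_def max_def intro: order_trans[OF _ zero_le_power2])
        have "G (y + h *\<^sub>R e) - G y = p (y + h *\<^sub>R e) * (v (y + h *\<^sub>R e) - v y) + (p (y + h *\<^sub>R e) - p y) * v y"
          by (simp add: G_def algebra_simps)
        then have "\<bar>G (y + h *\<^sub>R e) - G y\<bar> \<le> \<bar>p (y + h *\<^sub>R e)\<bar> * \<bar>v (y + h *\<^sub>R e) - v y\<bar> + \<bar>p (y + h *\<^sub>R e) - p y\<bar> * \<bar>v y\<bar>"
          by (metis abs_mult abs_triangle_ineq)
        also have "\<dots> \<le> 1 * (\<bar>t\<bar> * L * h) + (2 * h) * M"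
          using A B C M(2)[OF in2(1)] h L by (intro add_mono mult_mono) auto
        also have "\<dots> = h * ((\<bar>t\<bar> * L + 2 * M) * indicator (cball 0 2) y)" using in2 by (simp add: algebra_simps)
        finally show ?thesis .
      next
        case False
        then have "1\<^sup>2 \<le> (norm y)\<^sup>2" "1\<^sup>2 \<le> (norm (y + h *\<^sub>R e))\<^sup>2" by (auto simp del: one_power2 intro!: power_mono)
        then show ?thesis using h M(1) L(1) by (auto simp: G_def p_def max_def)
      qed
      show "AE y in lborel. ((\<lambda>h. G (y + h *\<^sub>R e)) has_real_derivative G' y) (at 0)"
        using AE_not_sphere[of 0 1]
      proof eventually_elim
        case (elim y)
        show ?case
        proof (cases "norm y < 1")
          case True
          define q where "q h = (1 - (y + h *\<^sub>R e) \<bullet> (y + h *\<^sub>R e)) / 2" for h :: real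
          have "(q has_real_derivative - (y \<bullet> e)) (at 0)"
            unfolding q_def by (auto intro!: derivative_eq_intros simp: inner_simps inner_commute algebra_simps)
          then have "((\<lambda>h. q h * v (y + h *\<^sub>R e)) has_real_derivative G' y) (at 0)"
            using DERIV_mult[OF _ dv[of y 0], of q "- (y \<bullet> e)"] True
            by (simp add: G'_def I_def q_def power2_norm_eq_inner algebra_simps)
          moreover have "\<forall>\<^sub>F h in nhds 0. q h * v (y + h *\<^sub>R e) = G (y + h *\<^sub>R e)"
          proof -
            have "((\<lambda>h. norm (y + h *\<^sub>R e)) \<longlongrightarrow> norm (y + 0 *\<^sub>R e)) (nhds 0)"
              by (intro tendsto_intros filterlim_ident)
            then have "\<forall>\<^sub>F h in nhds 0. norm (y + h *\<^sub>R e) < 1" using True by (intro order_tendstoD) auto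
            then show ?thesis
            proof eventually_elim
              case (elim h)
              then have "(norm (y + h *\<^sub>R e))\<^sup>2 < 1" by (simp add: power_less_one_iff)
              then show ?case by (simp add: q_def G_def p_def power2_norm_eq_inner)
            qed
          qed
          ultimately show ?thesis by (rule DERIV_cong_ev[OF refl _ refl, THEN iffD1, rotated])
        next
          case False
          with elim have y: "norm y > 1" by auto
          have "((\<lambda>h. norm (y + h *\<^sub>R e)) \<longlongrightarrow> norm (y + 0 *\<^sub>R e)) (nhds 0)"
            by (intro tendsto_intros filterlim_ident)
          then have "\<forall>\<^sub>F h in nhds 0. norm (y + h *\<^sub>R e) > 1" using y by (intro order_tendstoD) auto
          then have "\<forall>\<^sub>F h in nhds 0. G (y + h *\<^sub>R e) = 0"
          proof eventually_elim
            case (elim h)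
            then have "(norm (y + h *\<^sub>R e))\<^sup>2 > 1" by (simp add: one_less_power)
            then show ?case by (simp add: G_def p_def)
          qed
          from DERIV_cong_ev[OF refl this refl] show ?thesis using y by (simp add: G'_def I_def)
        qed
      qed
    qed
    moreover have "(\<integral>y. G' y \<partial>lborel) = t * (\<integral>y. I y * ((1 - (norm y)\<^sup>2) / 2 * (H (x + t *\<^sub>R y) e \<bullet> e)) \<partial>lborel)
        - (\<integral>y. I y * ((g (x + t *\<^sub>R y) \<bullet> e) * (y \<bullet> e)) \<partial>lborel)"
    proof -
      have "G' y = t * (I y * ((1 - (norm y)\<^sup>2) / 2 * (H (x + t *\<^sub>R y) e \<bullet> e))) - I y * ((g (x + t *\<^sub>R y) \<bullet> e) * (y \<bullet> e))" for y
        by (simp add: G'_def v_def algebra_simps)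
      then show ?thesis using i1[of e] i2[of e]
        by (simp only: Bochner_Integration.integral_diff integrable_mult_right integral_mult_right_zero)
    qed
    ultimately show ?thesis by simp
  qed
  have inner_axes: "a \<bullet> b = (\<Sum>i\<in>UNIV. (a \<bullet> axis i 1) * (b \<bullet> axis i 1))" for a b :: "real^2"
    by (subst inner_vec_def) (simp add: inner_axis)
  have "I y * (g (x + t *\<^sub>R y) \<bullet> y) = (\<Sum>i\<in>UNIV. I y * ((g (x + t *\<^sub>R y) \<bullet> axis i 1) * (y \<bullet> axis i 1)))" for y
    using inner_axes[of "g (x + t *\<^sub>R y)" y] by (simp only: sum_distrib_left)
  then have "(\<integral>y. I y * (g (x + t *\<^sub>R y) \<bullet> y) \<partial>lborel)
      = (\<integral>y. (\<Sum>i\<in>UNIV. I y * ((g (x + t *\<^sub>R y) \<bullet> axis i 1) * (y \<bullet> axis i 1))) \<partial>lborel)"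
    by (simp only:)
  also have "\<dots> = (\<Sum>i\<in>UNIV. t * (\<integral>y. I y * ((1 - (norm y)\<^sup>2) / 2 * (H (x + t *\<^sub>R y) (axis i 1) \<bullet> axis i 1)) \<partial>lborel))"
    by (simp only: Bochner_Integration.integral_sum[OF i1] main norm_axis_1)
  also have "\<dots> = t * (\<integral>y. (\<Sum>i\<in>UNIV. I y * ((1 - (norm y)\<^sup>2) / 2 * (H (x + t *\<^sub>R y) (axis i 1) \<bullet> axis i 1))) \<partial>lborel)"
    by (simp only: Bochner_Integration.integral_sum[OF i2] sum_distrib_left)
  finally show ?thesis
    by (simp add: I_def trace_hess_def sum_distrib_left)
qed

text \<open>For \<open>t > 0\<close> the integral is \<open>pi\<close> times the mean of
  \<open>u\<close> over the disc of radius \<open>t\<close>; its derivative is an integral of radial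
  derivatives, which integration by parts turns into a weighted Laplacian. The case
  \<open>t = 0\<close> is included and later gives the limit of small discs.\<close>

lemma solid_mean_deriv:
  assumes gh: "has_grad_hess u g H"
  shows "((\<lambda>t. \<integral>y. indicator (ball 0 1) y * u (x + t *\<^sub>R y) \<partial>lborel) has_real_derivative
    t * (\<integral>y. indicator (ball 0 1) y * ((1 - (norm y)\<^sup>2) / 2 * trace_hess H (x + t *\<^sub>R y)) \<partial>lborel)) (at t)"
proof -
  obtain M where M: "M > 0" "\<And>y. y \<in> cball x (\<bar>t\<bar> + 1) \<Longrightarrow> norm (g y) \<le> M"
    using bounded_on_cball[OF grad_continuous[OF gh]] by blast
  have "((\<lambda>t. \<integral>y. indicator (ball 0 1) y * u (x + t *\<^sub>R y) \<partial>lborel) has_real_derivative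
     (\<integral>y. indicator (ball 0 1) y * (g (x + t *\<^sub>R y) \<bullet> y) \<partial>lborel)) (at t)"
  proof (rule has_real_derivative_integral[of t "-(\<bar>t\<bar>+1)" "\<bar>t\<bar>+1" _ _ "\<lambda>y. indicator (ball 0 1) y * M"])
    fix s y assume s: "s \<in> {-(\<bar>t\<bar>+1)<..<\<bar>t\<bar>+1}"
    show "((\<lambda>t. indicator (ball 0 1) y * u (x + t *\<^sub>R y)) has_real_derivative indicator (ball 0 1) y * (g (x + s *\<^sub>R y) \<bullet> y)) (at s)"
      by (rule DERIV_cmult[OF deriv_along_line[OF gh]])
    show "\<bar>indicator (ball 0 1) y * (g (x + s *\<^sub>R y) \<bullet> y)\<bar> \<le> indicator (ball 0 1) y * M"
    proof (cases "norm y < 1")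
      case True
      have "\<bar>s\<bar> * norm y \<le> (\<bar>t\<bar> + 1) * 1" using s True by (intro mult_mono) auto
      then have "norm (g (x + s *\<^sub>R y)) \<le> M" by (intro M) (simp add: dist_norm)
      have "\<bar>g (x + s *\<^sub>R y) \<bullet> y\<bar> \<le> norm (g (x + s *\<^sub>R y)) * norm y" by (rule Cauchy_Schwarz_ineq2)
      also have "\<dots> \<le> M * 1" using \<open>norm (g _) \<le> M\<close> True M by (intro mult_mono) auto
      finally show ?thesis using True by simp
    qed simp
    show "integrable lborel (\<lambda>y. indicator (ball 0 1) y * u (x + s *\<^sub>R y))"
      by (intro integrable_indicator_ball continuous_intros continuous_on_compose2[OF has_grad_hess_continuous[OF gh, of UNIV]]) auto
  next
    show "integrable lborel (\<lambda>y. indicator (ball (0::real^2) 1) y * M)"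
      by (rule integrable_indicator_ball) simp
  qed auto
  then show ?thesis using integral_trace_hess[OF gh] by simp
qed

section \<open>The Green representation on discs\<close>

text \<open>Up to the factor \<open>1 / (2 * pi)\<close>, this is the Green function of the disc of radius \<open>R\<close> with pole at
  the centre minus the mean over all poles in the disc, so that it reproduces \<open>u x\<close> from the solid mean and the Laplacian.\<close>
definition Gk :: "real \<Rightarrow> real \<Rightarrow> real" where
  "Gk R s = (if 0 < s \<and> s < R then ln (R / s) - (1 - s\<^sup>2 / R\<^sup>2) / 2 else 0)"

definition Gk' :: "real \<Rightarrow> real \<Rightarrow> real" where
  "Gk' R s = (if 0 < s \<and> s < R then (1 - s\<^sup>2 / R\<^sup>2) / R else 0)"

text \<open>At \<open>R = s\<close> the logarithmic expression vanishes together with its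
  \<open>R\<close>-derivative \<open>(1 - s^2 / R^2) / R\<close>. Cutting it off there therefore
  leaves a function of \<open>R\<close> with equal one-sided derivatives.\<close>

lemma Gk_deriv:
  assumes R: "R > 0"
  shows "((\<lambda>R. Gk R s) has_real_derivative Gk' R s) (at R)"
proof -
  define q where "q R = ln (R / s) - (1 - s\<^sup>2 / R\<^sup>2) / 2" for R
  have q: "(q has_real_derivative (1 - s\<^sup>2 / R\<^sup>2) / R) (at R)" if "s > 0"
    unfolding q_def using R that by (auto intro!: derivative_eq_intros simp: field_simps power2_eq_square)
  consider "s \<le> 0" | "s > 0" "R < s" | "s > 0" "R = s" | "s > 0" "s < R" by linarith
  then show ?thesis
  proof cases
    case 1
    then show ?thesis by (simp add: Gk_def Gk'_def)
  next
    case 2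
    have "\<forall>\<^sub>F R in nhds R. R < s" using 2 eventually_nhds_in_open[of "{..<s}" R] by auto
    then have "\<forall>\<^sub>F R in nhds R. Gk R s = 0" by eventually_elim (simp add: Gk_def)
    from DERIV_cong_ev[OF refl this refl] show ?thesis using 2 by (simp add: Gk'_def)
  next
    case 4
    have "\<forall>\<^sub>F R in nhds R. s < R" using 4 eventually_nhds_in_open[of "{s<..}" R] by auto
    then have "\<forall>\<^sub>F R in nhds R. Gk R s = q R" by eventually_elim (use 4 in \<open>simp add: Gk_def q_def\<close>)
    from DERIV_cong_ev[OF refl this refl] show ?thesis using 4 q by (simp add: Gk'_def)
  next
    case 3
    have "((\<lambda>R. Gk R s) has_real_derivative 0) (at R within {R..})"
    proof (rule has_field_derivative_transform_within[of q 0 R "{R..}" 1])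
      show "(q has_real_derivative 0) (at R within {R..})"
        using has_field_derivative_at_within[OF q[OF 3(1)]] 3 by simp
    qed (use 3 in \<open>auto simp: Gk_def q_def\<close>)
    moreover have "((\<lambda>R. Gk R s) has_real_derivative 0) (at R within {..R})"
      by (rule has_field_derivative_transform_within[of "\<lambda>_. 0" 0 R "{..R}" 1]) (use 3 in \<open>auto simp: Gk_def\<close>)
    ultimately have "((\<lambda>R. Gk R s) has_real_derivative 0) (at R within {R..} \<union> {..R})"
      unfolding has_field_derivative_iff by (simp add: Lim_within_Un)
    moreover have "{R..} \<union> {..R} = UNIV" by auto
    ultimately show ?thesis using 3 by (simp add: Gk'_def)
  qed
qed

text \<open>Nonnegativity is \<open>ln t \<le> t - 1\<close> at \<open>t = (s / R)^2\<close>;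
  dropping the subtracted term gives the integrable majorant.\<close>

lemma Gk_bounds:
  assumes "R > 0" shows "0 \<le> Gk R (norm z)" "Gk R (norm z) \<le> ln_inv (z /\<^sub>R R)"
proof -
  have *: "0 \<le> ln (R / s) - (1 - s\<^sup>2 / R\<^sup>2) / 2 \<and> ln (R / s) = - ln (s / R) \<and> s\<^sup>2 / R\<^sup>2 \<le> 1" if "0 < s" "s < R" for s
  proof -
    have "ln ((s / R)\<^sup>2) \<le> (s / R)\<^sup>2 - 1" using that by (intro ln_le_minus_one) auto
    then have "2 * ln (s / R) \<le> (s / R)\<^sup>2 - 1" using that by (subst (asm) ln_realpow) auto
    moreover have "s\<^sup>2 / R\<^sup>2 \<le> 1" using that by (simp add: divide_le_eq power_mono)
    ultimately show ?thesis using that by (simp add: ln_div power_divide)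
  qed
  show "0 \<le> Gk R (norm z)" using *[THEN conjunct1] by (auto simp: Gk_def)
  show "Gk R (norm z) \<le> ln_inv (z /\<^sub>R R)"
  proof (cases "0 < norm z \<and> norm z < R")
    case True
    then have pos: "0 < norm z" "norm z < R" by auto
    then have "norm (z /\<^sub>R R) = norm z / R" using assms by (simp add: divide_inverse mult.commute)
    then have "ln_inv (z /\<^sub>R R) = ln (R / norm z)" using True *[of "norm z"] assms by (simp add: ln_inv_def)
    moreover have "(1 - (norm z)\<^sup>2 / R\<^sup>2) / 2 \<ge> 0" using *[OF pos, THEN conjunct2, THEN conjunct2]
      by (intro divide_nonneg_nonneg) (simp_all only: diff_ge_0_iff_ge zero_le_numeral)
    ultimately show ?thesis unfolding Gk_def by (simp only: True simp_thms if_True diff_le_eq le_add_same_cancel1)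
  qed (auto simp: Gk_def)
qed

lemma Gk_measurable [measurable]: "(\<lambda>z. Gk R (norm (z - x))) \<in> borel_measurable (borel :: (real^2) measure)"
  unfolding Gk_def by measurable

text \<open>The majorant in the second claim is the same for all radii up to \<open>R\<close>, which
  permits letting the radius tend to 0.\<close>

lemma integrable_Gk:
  fixes m :: "real^2 \<Rightarrow> real"
  assumes R: "R > 0" and m: "continuous_on UNIV m"
  shows "integrable lborel (\<lambda>z. Gk R (norm (z - x)) * m z)"
    and "\<exists>M. \<forall>S z. 0 < S \<longrightarrow> S \<le> R \<longrightarrow> \<bar>Gk S (norm (z - x)) * m z\<bar> \<le> M * ln_inv ((x - z) /\<^sub>R R)"
proof -
  have [measurable]: "m \<in> borel_measurable borel" using m by (rule borel_measurable_continuous_onI)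
  obtain M where M: "M > 0" "\<And>y. y \<in> cball x R \<Longrightarrow> norm (m y) \<le> M" using bounded_on_cball[OF m] by blast
  have b: "\<bar>Gk S (norm (z - x)) * m z\<bar> \<le> M * ln_inv ((x - z) /\<^sub>R R)" if S: "0 < S" "S \<le> R" for S z
  proof (cases "z \<noteq> x \<and> norm (z - x) < S")
    case True
    have "\<bar>m z\<bar> \<le> M" using M(2)[of z] True S by (auto simp: dist_norm norm_minus_commute)
    moreover have "Gk S (norm (z - x)) \<le> ln_inv ((z - x) /\<^sub>R S)" by (rule Gk_bounds) fact
    moreover have "ln_inv ((z - x) /\<^sub>R S) \<le> ln_inv ((x - z) /\<^sub>R R)"
    proof -
      have "norm (z - x) / R \<le> norm (z - x) / S" using S by (intro divide_left_mono) auto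
      moreover have "norm (z - x) / S < 1" using True S by simp
      ultimately have "norm (z - x) / R < 1" by linarith
      with \<open>norm (z - x) / R \<le> _\<close> \<open>norm (z - x) / S < 1\<close> show ?thesis using True S
        by (auto simp: ln_inv_def norm_minus_commute[of x z] divide_inverse mult.commute)
    qed
    ultimately show ?thesis using Gk_bounds(1)[OF S(1), of "z - x"]
      by (simp add: abs_mult mult.commute[of M]) (intro mult_mono; linarith?; simp)
  qed (use M(1) in \<open>auto simp: Gk_def\<close>)
  show "\<exists>M. \<forall>S z. 0 < S \<longrightarrow> S \<le> R \<longrightarrow> \<bar>Gk S (norm (z - x)) * m z\<bar> \<le> M * ln_inv ((x - z) /\<^sub>R R)"
    using b by blast
  have "integrable lborel (\<lambda>z. M * ln_inv ((x - z) /\<^sub>R R))" using integrable_ln_inv_scale[OF R] by simp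
  then show "integrable lborel (\<lambda>z. Gk R (norm (z - x)) * m z)"
    by (rule Bochner_Integration.integrable_bound) (use b[of R] R in \<open>auto intro: order_trans[OF _ abs_ge_self]\<close>)
qed

text \<open>After the substitution \<open>z = x + t *\<^sub>R y\<close> this is minus twice the
  derivative in \<open>solid_mean_deriv\<close> when \<open>trace_hess H = - m\<close>.\<close>

lemma Gk_integral_deriv:
  fixes m :: "real^2 \<Rightarrow> real"
  assumes t: "t > 0" and m: "continuous_on UNIV m"
  shows "((\<lambda>R. \<integral>z. Gk R (norm (z - x)) * m z \<partial>lborel) has_real_derivative
     2 * t * (\<integral>y. indicator (ball 0 1) y * ((1 - (norm y)\<^sup>2) / 2 * m (x + t *\<^sub>R y)) \<partial>lborel)) (at t)"
proof -
  have [measurable]: "m \<in> borel_measurable borel" using m by (rule borel_measurable_continuous_onI)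
  have "((\<lambda>R. \<integral>z. Gk R (norm (z - x)) * m z \<partial>lborel) has_real_derivative
     (\<integral>z. Gk' t (norm (z - x)) * m z \<partial>lborel)) (at t)"
  \<comment> \<open>On this window \<open>1 / s < 2 / t\<close>, and all kernels are supported in
    \<open>ball x (2*t)\<close>.\<close>
  proof (rule has_real_derivative_integral[of t "t/2" "2*t" _ _ "\<lambda>z. indicator (ball x (2*t)) z * (2 / t * \<bar>m z\<bar>)"])
    fix s :: real and z assume s: "s \<in> {t/2<..<2*t}"
    then have s0: "s > 0" using t by simp
    show "((\<lambda>R. Gk R (norm (z - x)) * m z) has_real_derivative Gk' s (norm (z - x)) * m z) (at s)"
      by (rule DERIV_cmult_right[OF Gk_deriv[OF s0]])
    show "integrable lborel (\<lambda>z. Gk s (norm (z - x)) * m z)" by (rule integrable_Gk[OF s0 m])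
    show "\<bar>Gk' s (norm (z - x)) * m z\<bar> \<le> indicator (ball x (2*t)) z * (2 / t * \<bar>m z\<bar>)"
    proof (cases "norm (z - x) < s")
      case True
      have "(norm (z - x))\<^sup>2 / s\<^sup>2 \<le> 1" using True s0 by (simp add: divide_le_eq power_mono)
      then have "\<bar>(1 - (norm (z - x))\<^sup>2 / s\<^sup>2) / s\<bar> \<le> 1 / s"
        using s0 by (simp add: divide_le_cancel)
      also have "\<dots> \<le> 2 / t" using s t by (simp add: field_simps)
      finally have "\<bar>Gk' s (norm (z - x))\<bar> \<le> 2 / t" using t by (simp add: Gk'_def)
      moreover have "z \<in> ball x (2*t)" using True s by (simp add: dist_norm norm_minus_commute)
      ultimately show ?thesis using mult_right_mono[of _ "2 / t" "\<bar>m z\<bar>"] by (simp add: abs_mult)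
    qed (use t in \<open>auto simp: Gk'_def\<close>)
  next
    show "integrable lborel (\<lambda>z. indicator (ball x (2*t)) z * (2 / t * \<bar>m z\<bar>))"
      by (intro integrable_indicator_ball continuous_intros m)
  qed (use t in auto)
  moreover have "(\<integral>z. Gk' t (norm (z - x)) * m z \<partial>lborel) =
      2 * t * (\<integral>y. indicator (ball 0 1) y * ((1 - (norm y)\<^sup>2) / 2 * m (x + t *\<^sub>R y)) \<partial>lborel)"
  proof -
    have [measurable]: "(\<lambda>z. Gk' t (norm (z - x))) \<in> borel_measurable (borel :: (real^2) measure)"
      unfolding Gk'_def by measurable
    have "(\<integral>z. Gk' t (norm (z - x)) * m z \<partial>lborel) =
       t\<^sup>2 * (\<integral>y. Gk' t (norm (t *\<^sub>R y)) * m (x + t *\<^sub>R y) \<partial>lborel)"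
      using lborel_integral_scale[of t "\<lambda>z. Gk' t (norm (z - x)) * m z" x] t by simp
    also have "(\<integral>y. Gk' t (norm (t *\<^sub>R y)) * m (x + t *\<^sub>R y) \<partial>lborel) =
       (\<integral>y. 2 / t * (indicator (ball 0 1) y * ((1 - (norm y)\<^sup>2) / 2 * m (x + t *\<^sub>R y))) \<partial>lborel)"
    proof (rule integral_cong_AE)
      have [measurable]: "(\<lambda>y. m (x + t *\<^sub>R y)) \<in> borel_measurable borel" by measurable
      have [measurable]: "(\<lambda>y. Gk' t (norm (t *\<^sub>R y))) \<in> borel_measurable (borel :: (real^2) measure)"
        unfolding Gk'_def by measurable
      show "(\<lambda>y. Gk' t (norm (t *\<^sub>R y)) * m (x + t *\<^sub>R y)) \<in> borel_measurable lborel" by measurable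
      have "integrable lborel (\<lambda>y. 2 / t * (indicator (ball 0 1) y * ((1 - (norm y)\<^sup>2) / 2 * m (x + t *\<^sub>R y))))"
        by (intro integrable_mult_right integrable_indicator_ball continuous_intros continuous_on_compose2[OF m]) auto
      then show "(\<lambda>y. 2 / t * (indicator (ball 0 1) y * ((1 - (norm y)\<^sup>2) / 2 * m (x + t *\<^sub>R y)))) \<in> borel_measurable lborel"
        by (rule borel_measurable_integrable)
      have "AE y in lborel. y \<noteq> (0::real^2)" by (rule AE_lborel_singleton)
      then show "AE y in lborel. Gk' t (norm (t *\<^sub>R y)) * m (x + t *\<^sub>R y) =
          2 / t * (indicator (ball 0 1) y * ((1 - (norm y)\<^sup>2) / 2 * m (x + t *\<^sub>R y)))"
        by eventually_elim (use t in \<open>auto simp: Gk'_def indicator_def power_mult_distrib\<close>)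
    qed
    finally show ?thesis using t by (simp add: power2_eq_square)
  qed
  ultimately show ?thesis by simp
qed

text \<open>The right-hand side has zero derivative in the radius. As the radius tends to 0 the mean
  term tends to \<open>pi * u x\<close> and the kernel term to 0.\<close>

lemma representation_disc:
  assumes gh: "has_grad_hess u g H" and m: "continuous_on UNIV m" and eq: "\<And>x. trace_hess H x = - m x" and R: "R > 0"
  shows "pi * u x = (\<integral>y. indicator (ball 0 1) y * u (x + R *\<^sub>R y) \<partial>lborel) +
      (\<integral>z. Gk R (norm (z - x)) * m z \<partial>lborel) / 2"
proof -
  have [measurable]: "m \<in> borel_measurable borel" using m by (rule borel_measurable_continuous_onI)
  define F where "F t = (\<integral>y. indicator (ball 0 1) y * u (x + t *\<^sub>R y) \<partial>lborel)" for t
  define J where "J t = (\<integral>z. Gk t (norm (z - x)) * m z \<partial>lborel)" for t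
  have F': "(F has_real_derivative - t * (\<integral>y. indicator (ball 0 1) y * ((1 - (norm y)\<^sup>2) / 2 * m (x + t *\<^sub>R y)) \<partial>lborel)) (at t)" for t
    using solid_mean_deriv[OF gh, of x t] by (simp add: eq F_def[abs_def])
  have "\<exists>c. \<forall>t\<in>{0<..}. F t + J t / 2 = c"
  proof (rule has_field_derivative_zero_constant)
    fix t :: real assume t: "t \<in> {0<..}"
    have "((\<lambda>t. F t + J t / 2) has_real_derivative 0) (at t)"
      using DERIV_add[OF F' DERIV_cdivide[OF Gk_integral_deriv[of t m x, folded J_def], of 2]] t m by simp
    then show "((\<lambda>t. F t + J t / 2) has_real_derivative 0) (at t within {0<..})"
      by (rule has_field_derivative_at_within)
  qed simp
  then obtain c where c: "\<And>t. t > 0 \<Longrightarrow> F t + J t / 2 = c" by auto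
  define S where "S n = R * inverse (real (Suc n))" for n
  have S: "S n > 0" "S n \<le> R" for n using R by (auto simp: S_def field_simps)
  have S0: "S \<longlonglongrightarrow> 0" unfolding S_def by (rule tendsto_mult_right_zero[OF LIMSEQ_inverse_real_of_nat])
  have "isCont F 0" using F' DERIV_isCont by blast
  then have 1: "(\<lambda>n. F (S n)) \<longlonglongrightarrow> F 0" using S0 by (rule isCont_tendsto_compose)
  obtain M where M: "\<And>S z. 0 < S \<Longrightarrow> S \<le> R \<Longrightarrow> \<bar>Gk S (norm (z - x)) * m z\<bar> \<le> M * ln_inv ((x - z) /\<^sub>R R)"
    using integrable_Gk(2)[OF R m] by blast
  have "(\<lambda>n. J (S n)) \<longlonglongrightarrow> (\<integral>z. 0 \<partial>(lborel :: (real^2) measure))"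
    unfolding J_def
  proof (rule integral_dominated_convergence[where w="\<lambda>z. M * ln_inv ((x - z) /\<^sub>R R)"])
    show "integrable lborel (\<lambda>z. M * ln_inv ((x - z) /\<^sub>R R))" using integrable_ln_inv_scale[OF R] by simp
    have "(\<lambda>n. Gk (S n) (norm (z - x)) * m z) \<longlonglongrightarrow> 0" for z
    proof (cases "z = x")
      case False
      then have "\<forall>\<^sub>F n in sequentially. S n < norm (z - x)" by (intro order_tendstoD(2)[OF S0]) simp
      then have "\<forall>\<^sub>F n in sequentially. Gk (S n) (norm (z - x)) * m z = 0" by eventually_elim (simp add: Gk_def)
      then show ?thesis by (rule tendsto_eventually)
    qed (simp add: Gk_def)
    then show "AE z in lborel. (\<lambda>n. Gk (S n) (norm (z - x)) * m z) \<longlonglongrightarrow> 0" by simp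
  qed (use M S in auto)
  then have "(\<lambda>n. J (S n)) \<longlonglongrightarrow> 0" by simp
  from tendsto_add[OF 1 tendsto_divide_zero[OF this, of 2]]
  have "(\<lambda>n. c) \<longlonglongrightarrow> F 0" using c[OF S(1)] by simp
  then have "F 0 = c" by (simp add: LIMSEQ_const_iff)
  moreover have "F 0 = pi * u x" by (simp add: F_def measure_ball_plane)
  ultimately show ?thesis using c[OF R] by (simp add: F_def J_def)
qed

section \<open>Representation by the logarithmic potential\<close>

text \<open>Tonelli for the kernel \<open>f z\<close> restricted to \<open>z \<in> A\<close> and
  \<open>dist z y < 1\<close>: integrating over \<open>y\<close> first produces the factor
  \<open>pi\<close>, integrating over \<open>z\<close> first gives at most \<open>C\<close>, and
  only for \<open>y \<in> A'\<close>. A bound on unit discs thus becomes a bound by area.\<close>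

lemma integral_le_of_unit_ball_integrals:
  fixes f :: "real^2 \<Rightarrow> real"
  assumes f: "continuous_on UNIV f" "\<And>z. f z \<ge> 0"
    and C: "\<And>y. (\<integral>z. indicator (ball y 1) z * f z \<partial>lborel) \<le> C"
    and A [measurable]: "A \<in> sets borel" and A': "A' \<in> sets borel" "\<And>z. z \<in> A \<Longrightarrow> ball z 1 \<subseteq> A'"
    and fin: "emeasure lborel A' < \<infinity>" and int: "integrable lborel (\<lambda>z. indicator A z * f z)"
  shows "pi * (\<integral>z. indicator A z * f z \<partial>lborel) \<le> C * measure lborel A'"
proof -
  note A'(1)[measurable]
  have [measurable]: "f \<in> borel_measurable borel" using f(1) by (rule borel_measurable_continuous_onI)
  have "0 \<le> (\<integral>z. indicator (ball 0 1) z * f z \<partial>lborel)" by (rule Bochner_Integration.integral_nonneg) (simp add: f(2))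
  then have C0: "C \<ge> 0" using C[of 0] by linarith
  define k :: "real^2 \<Rightarrow> real^2 \<Rightarrow> ennreal" where "k z y = ennreal (indicator A z * f z) * (if dist z y < 1 then 1 else 0)" for z y
  have k [measurable]: "case_prod k \<in> borel_measurable (lborel \<Otimes>\<^sub>M lborel)"
    unfolding k_def by measurable
  have inner: "(\<integral>\<^sup>+z. k z y \<partial>lborel) \<le> ennreal C * indicator A' y" for y
  proof (cases "y \<in> A'")
    case False
    have "k z y = 0" for z
      using A'(2)[of z] False by (auto simp: k_def indicator_def subset_eq)
    then show ?thesis using False by simp
  next
    case True
    have "(\<integral>\<^sup>+z. k z y \<partial>lborel) \<le> (\<integral>\<^sup>+z. ennreal (indicator (ball y 1) z * f z) \<partial>lborel)"
      using f(2) by (intro nn_integral_mono) (auto simp: k_def indicator_def dist_commute)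
    also have "\<dots> = ennreal (\<integral>z. indicator (ball y 1) z * f z \<partial>lborel)"
      by (rule nn_integral_eq_integral) (use f integrable_indicator_ball in auto)
    also have "\<dots> \<le> ennreal C" using C by (rule ennreal_leI)
    finally show ?thesis using True by simp
  qed
  have "ennreal (pi * (\<integral>z. indicator A z * f z \<partial>lborel)) = ennreal pi * (\<integral>\<^sup>+z. ennreal (indicator A z * f z) \<partial>lborel)"
    using int f(2) by (subst nn_integral_eq_integral) (auto simp: ennreal_mult' intro!: integral_nonneg_AE)
  also have "\<dots> = (\<integral>\<^sup>+z. ennreal (indicator A z * f z) * ennreal pi \<partial>lborel)"
    by (subst nn_integral_multc) (auto simp: mult.commute)
  also have "\<dots> = (\<integral>\<^sup>+z. (\<integral>\<^sup>+y. k z y \<partial>lborel) \<partial>lborel)"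
  proof (rule nn_integral_cong)
    fix z :: "real^2"
    have "(\<integral>\<^sup>+y. k z y \<partial>lborel) = (\<integral>\<^sup>+y. ennreal (indicator A z * f z) * indicator (ball z 1) y \<partial>lborel)"
      by (intro nn_integral_cong) (auto simp: k_def indicator_def)
    then show "ennreal (indicator A z * f z) * ennreal pi = (\<integral>\<^sup>+y. k z y \<partial>lborel)"
      using emeasure_ball_plane[of 1 z] by (simp add: nn_integral_cmult_indicator)
  qed
  also have "\<dots> = (\<integral>\<^sup>+y. (\<integral>\<^sup>+z. k z y \<partial>lborel) \<partial>lborel)"
    by (rule pair_sigma_finite.Fubini'[symmetric, OF _ k])
       (simp add: pair_sigma_finite_def sigma_finite_lborel)
  also have "\<dots> \<le> (\<integral>\<^sup>+y. ennreal C * indicator A' y \<partial>lborel)"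
    by (intro nn_integral_mono inner)
  also have "\<dots> = ennreal (C * measure lborel A')"
    using fin C0 by (simp add: nn_integral_cmult_indicator ennreal_mult emeasure_eq_ennreal_measure)
  finally show ?thesis using C0 by (subst (asm) ennreal_le_iff) auto
qed

section \<open>Disc averages and the logarithmic potential\<close>

locale plane_solution =
  fixes u g H m C
  assumes gh: "has_grad_hess u g H" and m: "continuous_on UNIV m"
    and eq: "\<And>x. trace_hess H x = - m x"
    and int_m: "integrable lborel m"
    and int_ln: "integrable lborel (\<lambda>y. ln (2 + norm y) * \<bar>m y\<bar>)"
    and uplus: "\<And>y. (\<integral>z. indicator (ball y 1) z * max (u z) 0 \<partial>lborel) \<le> C"
begin

definition "\<kappa> = (\<integral>y. m y \<partial>lborel)"
definition "p x = (\<integral>y. ln (norm (x - y)) * m y \<partial>lborel)"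
definition "A x R = (\<integral>y. indicator (ball 0 1) y * u (x + R *\<^sub>R y) \<partial>lborel)"
text \<open>This is \<open>pi\<close> times the harmonic function \<open>u + p / (2 * pi)\<close>;
  the aim is to show that it is constant.\<close>

definition "h x = pi * u x + p x / 2"

lemma m_measurable [measurable]: "m \<in> borel_measurable borel"
  using m by (rule borel_measurable_continuous_onI)

lemma integrable_ln_inv_m: "integrable lborel (\<lambda>y. ln_inv (x - y) * m y)"
proof -
  obtain M where M: "M > 0" "\<And>y. y \<in> cball x 1 \<Longrightarrow> norm (m y) \<le> M" using bounded_on_cball[OF m] by blast
  have "integrable lborel (\<lambda>y. M * ln_inv (x - y))" by simp
  then show ?thesis
  proof (rule Bochner_Integration.integrable_bound)
    show "AE y in lborel. norm (ln_inv (x - y) * m y) \<le> norm (M * ln_inv (x - y))"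
    proof (rule AE_I2)
      fix y show "norm (ln_inv (x - y) * m y) \<le> norm (M * ln_inv (x - y))"
      proof (cases "norm (x - y) < 1")
        case True
        then have "\<bar>m y\<bar> \<le> M" using M(2)[of y] by (simp add: dist_norm)
        then have "ln_inv (x - y) * \<bar>m y\<bar> \<le> ln_inv (x - y) * M" by (intro mult_left_mono) auto
        then show ?thesis using M(1) by (simp add: abs_mult mult.commute)
      qed (simp add: ln_inv_def)
    qed
  qed auto
qed

lemma abs_ln_le: "\<bar>ln (norm (x - y))\<bar> \<le> ln (1 + norm x) + ln (2 + norm y) + ln_inv (x - y)"
proof (cases "norm (x - y) < 1")
  case True
  have "ln (norm (x - y)) \<le> 0" using True by (cases "x = y") auto
  moreover have "ln (1 + norm x) \<ge> 0" "ln (2 + norm y) \<ge> 0" by (simp_all add: ln_ge_zero)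
  ultimately show ?thesis using True by (simp add: ln_inv_def)
next
  case False
  have "norm (x - y) \<le> norm x + norm y" by (rule norm_triangle_ineq4)
  also have "\<dots> \<le> (1 + norm x) * (2 + norm y)" by (simp add: algebra_simps)
  finally have "ln (norm (x - y)) \<le> ln ((1 + norm x) * (2 + norm y))" using False by (subst ln_le_cancel_iff) (auto intro: order_less_le_trans[of _ 1])
  also have "\<dots> = ln (1 + norm x) + ln (2 + norm y)" by (rule ln_mult_pos) (auto intro: add_pos_nonneg)
  finally show ?thesis using False by (simp add: ln_inv_def)
qed

lemma integrable_p: "integrable lborel (\<lambda>y. ln (norm (x - y)) * m y)"
proof -
  have i: "integrable lborel (\<lambda>y. ln (1 + norm x) * \<bar>m y\<bar> + ln (2 + norm y) * \<bar>m y\<bar> + \<bar>ln_inv (x - y) * m y\<bar>)"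
    using int_m int_ln integrable_ln_inv_m by (intro Bochner_Integration.integrable_add integrable_mult_right integrable_abs)
  show ?thesis
  proof (rule Bochner_Integration.integrable_bound[OF i])
    have "norm (ln (norm (x - y)) * m y) \<le> norm (ln (1 + norm x) * \<bar>m y\<bar> + ln (2 + norm y) * \<bar>m y\<bar> + \<bar>ln_inv (x - y) * m y\<bar>)" for y
    proof -
      have "\<bar>ln (norm (x - y))\<bar> * \<bar>m y\<bar> \<le> (ln (1 + norm x) + ln (2 + norm y) + ln_inv (x - y)) * \<bar>m y\<bar>"
        by (intro mult_right_mono abs_ln_le) auto
      then show ?thesis by (simp add: abs_mult algebra_simps)
    qed
    then show "AE y in lborel. norm (ln (norm (x - y)) * m y) \<le> norm (ln (1 + norm x) * \<bar>m y\<bar> + ln (2 + norm y) * \<bar>m y\<bar> + \<bar>ln_inv (x - y) * m y\<bar>)"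
      by simp
  qed auto
qed

text \<open>For \<open>s < R\<close> the kernel differs from \<open>ln R - ln s - 1/2\<close> by
  \<open>s^2 / (2 * R^2)\<close>, which tends to 0. For \<open>s \<ge> R\<close> the kernel is 0 and
  the discrepancy is at most \<open>\<bar>ln s\<bar> + 1/2\<close>, integrable against
  \<open>m\<close> thanks to the logarithmic moment.\<close>

lemma Gk_asymp:
  "((\<lambda>R. (\<integral>z. Gk R (norm (z - x)) * m z \<partial>lborel) - \<kappa> * ln R + p x + \<kappa> / 2) \<longlongrightarrow> 0) at_top"
proof -
  define q where "q R s = Gk R s - ln R + ln s + 1 / 2" for R s
  have q_lt: "q R s = s\<^sup>2 / R\<^sup>2 / 2" if "0 < s" "s < R" for R s
    using that by (simp add: q_def Gk_def ln_div field_simps)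
  have "((\<lambda>R. \<integral>z. q R (norm (x - z)) * m z \<partial>lborel) \<longlongrightarrow> (\<integral>z. 0 \<partial>(lborel :: (real^2) measure))) at_top"
  proof (rule integral_dominated_convergence_at_top[where w="\<lambda>z. \<bar>ln (norm (x - z)) * m z\<bar> + 1/2 * \<bar>m z\<bar>"])
    show "integrable lborel (\<lambda>z. \<bar>ln (norm (x - z)) * m z\<bar> + 1/2 * \<bar>m z\<bar>)"
      using integrable_p int_m by (intro Bochner_Integration.integrable_add integrable_mult_right integrable_abs)
    have nz: "AE z in lborel. z \<noteq> x" by (rule AE_lborel_singleton)
    show "(\<lambda>z. q R (norm (x - z)) * m z) \<in> borel_measurable lborel" for R
      unfolding q_def Gk_def by measurable
    show "AE z in lborel. ((\<lambda>R. q R (norm (x - z)) * m z) \<longlongrightarrow> 0) at_top"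
      using nz
    proof eventually_elim
      case (elim z)
      define s where "s = norm (x - z)"
      have s: "s > 0" using elim by (simp add: s_def)
      have "((\<lambda>R::real. s\<^sup>2 / R\<^sup>2 / 2) \<longlongrightarrow> 0) at_top"
        by (intro tendsto_divide_zero tendsto_divide_0[OF tendsto_const] filterlim_at_top_imp_at_infinity
            filterlim_pow_at_top filterlim_ident) auto
      moreover have "\<forall>\<^sub>F R in at_top. s\<^sup>2 / R\<^sup>2 / 2 = q R s"
        using eventually_gt_at_top[of s] by eventually_elim (simp add: q_lt[OF s])
      ultimately have "((\<lambda>R. q R s) \<longlongrightarrow> 0) at_top" by (rule Lim_transform_eventually)
      then show ?case unfolding s_def by (rule tendsto_mult_left_zero)
    qed
    show "\<forall>\<^sub>F R in at_top. AE z in lborel. norm (q R (norm (x - z)) * m z) \<le> \<bar>ln (norm (x - z)) * m z\<bar> + 1/2 * \<bar>m z\<bar>"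
      using eventually_ge_at_top[of 1]
    proof eventually_elim
      case (elim R)
      show ?case using nz
      proof eventually_elim
        case (elim z)
        define s where "s = norm (x - z)"
        have s: "s > 0" using elim by (simp add: s_def)
        have "\<bar>q R s\<bar> \<le> \<bar>ln s\<bar> + 1/2"
        proof (cases "s < R")
          case True
          then have "s\<^sup>2 / R\<^sup>2 \<le> 1" using s by (simp add: divide_le_eq power_mono)
          then show ?thesis using q_lt[OF s True] by simp
        next
          case False
          then have "ln R \<le> ln s" using \<open>1 \<le> R\<close> by simp
          then show ?thesis using False \<open>1 \<le> R\<close> by (simp add: q_def Gk_def)
        qed
        then have "\<bar>q R s\<bar> * \<bar>m z\<bar> \<le> (\<bar>ln s\<bar> + 1/2) * \<bar>m z\<bar>" by (rule mult_right_mono) simp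
        then show ?case by (simp add: s_def abs_mult algebra_simps)
      qed
    qed
  qed auto
  moreover {
  have "(\<integral>z. q R (norm (x - z)) * m z \<partial>lborel) =
    (\<integral>z. Gk R (norm (z - x)) * m z \<partial>lborel) - \<kappa> * ln R + p x + \<kappa> / 2" if "R > 0" for R
  proof -
    have "q R (norm (x - z)) * m z = Gk R (norm (z - x)) * m z - ln R * m z + ln (norm (x - z)) * m z + 1/2 * m z" for z
      by (simp add: q_def norm_minus_commute algebra_simps)
    then show ?thesis using integrable_Gk(1)[OF that m, of x] integrable_p[of x] int_m
      by (simp add: p_def \<kappa>_def)
  qed
  then have "\<forall>\<^sub>F R in at_top. (\<integral>z. q R (norm (x - z)) * m z \<partial>lborel) =
    (\<integral>z. Gk R (norm (z - x)) * m z \<partial>lborel) - \<kappa> * ln R + p x + \<kappa> / 2"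
    by (rule eventually_mono[OF eventually_gt_at_top[of 0]]) }
  ultimately show ?thesis by (auto elim: Lim_transform_eventually)
qed

text \<open>Up to a summand independent of \<open>x\<close> the limit is \<open>h x\<close>, so
  comparing disc averages around two centres compares values of \<open>h\<close>.\<close>

lemma solid_mean_asymp: "((\<lambda>R. A x R + \<kappa> / 2 * ln R) \<longlongrightarrow> h x + \<kappa> / 4) at_top"
proof -
  have "((\<lambda>R. h x + \<kappa> / 4 - ((\<integral>z. Gk R (norm (z - x)) * m z \<partial>lborel) - \<kappa> * ln R + p x + \<kappa> / 2) / 2) \<longlongrightarrow> h x + \<kappa> / 4 - 0 / 2) at_top"
    by (intro tendsto_intros Gk_asymp) auto
  moreover have "\<forall>\<^sub>F R in at_top. h x + \<kappa> / 4 - ((\<integral>z. Gk R (norm (z - x)) * m z \<partial>lborel) - \<kappa> * ln R + p x + \<kappa> / 2) / 2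
     = A x R + \<kappa> / 2 * ln R"
    using eventually_gt_at_top[of 0]
  proof eventually_elim
    case (elim R)
    then show ?case using representation_disc[OF gh m eq, of R x] by (simp add: h_def A_def field_simps)
  qed
  ultimately show ?thesis by (auto elim: Lim_transform_eventually)
qed

lemma A_ball: "R > 0 \<Longrightarrow> R\<^sup>2 * A x R = (\<integral>z. indicator (ball x R) z * u z \<partial>lborel)"
proof -
  assume R: "R > 0"
  have [measurable]: "u \<in> borel_measurable borel"
    using has_grad_hess_continuous[OF gh] by (rule borel_measurable_continuous_onI)
  have "indicator (ball x R) (x + R *\<^sub>R y) = (indicator (ball 0 1) y :: real)" for y
    using R by (simp add: indicator_def dist_norm)
  moreover have "(\<lambda>z. indicator (ball x R) z * u z) \<in> borel_measurable borel"
    using borel_measurable_integrable[OF integrable_indicator_ball[OF has_grad_hess_continuous[OF gh], of x R]] by simp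
  ultimately show ?thesis
    using lborel_integral_scale[of R "\<lambda>z. indicator (ball x R) z * u z" x] R unfolding A_def by simp
qed

text \<open>The disc around \<open>x'\<close> lies in the enlarged disc around \<open>x\<close>, and
  on the difference \<open>u\<close> is at most its positive part. Unit discs centred there stay in
  the annulus \<open>an'\<close> of area \<open>4 * pi * (d + 1) * R\<close>, so the error is only
  linear in \<open>R\<close>.\<close>

lemma ball_comparison:
  assumes d: "dist x x' \<le> d" and R: "R > d + 1"
  shows "(R + d)\<^sup>2 * A x (R + d) \<le> R\<^sup>2 * A x' R + 4 * C * (d + 1) * R"
proof -
  have d0: "d \<ge> 0" using d by (meson order_trans zero_le_dist)
  have cu: "continuous_on UNIV u" by (rule has_grad_hess_continuous[OF gh])
  define an where "an = ball x (R + d) - ball x' R"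
  define an' where "an' = ball x (R + d + 1) - ball x (R - d - 1)"
  have sub: "ball x' R \<subseteq> ball x (R + d)"
  proof
    fix z assume "z \<in> ball x' R" then show "z \<in> ball x (R + d)"
      using dist_triangle[of x z x'] d by simp
  qed
  have ind: "indicator (ball x (R + d)) z = indicator (ball x' R) z + (indicator an z :: real)" for z
    using sub by (auto simp: an_def indicator_def)
  have i1: "integrable lborel (\<lambda>z. indicator an z * f z)" if "continuous_on UNIV f" for f :: "real^2 \<Rightarrow> real"
  proof -
    have "indicator an z * f z = indicator (ball x (R + d)) z * f z - indicator (ball x' R) z * f z" for z
      by (simp add: ind algebra_simps)
    then show ?thesis using integrable_indicator_ball[OF that] by simp
  qed
  have cm: "continuous_on UNIV (\<lambda>z. max (u z) 0)" by (intro continuous_intros cu)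
  
  have "(\<integral>z. indicator (ball x (R + d)) z * u z \<partial>lborel) =
      (\<integral>z. indicator (ball x' R) z * u z \<partial>lborel) + (\<integral>z. indicator an z * u z \<partial>lborel)"
    unfolding ind using i1[OF cu] integrable_indicator_ball[OF cu, of x' R]
    by (simp add: distrib_right)
  moreover have "(\<integral>z. indicator an z * u z \<partial>lborel) \<le> (\<integral>z. indicator an z * max (u z) 0 \<partial>lborel)"
    using i1[OF cu] i1[OF cm] by (rule integral_mono) (auto simp: indicator_def)
  moreover have "pi * (\<integral>z. indicator an z * max (u z) 0 \<partial>lborel) \<le> C * measure lborel an'"
  proof (rule integral_le_of_unit_ball_integrals[OF cm _ uplus])
    show "ball z 1 \<subseteq> an'" if "z \<in> an" for z
    proof
      fix w assume w: "w \<in> ball z 1"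
      have "dist x w \<le> dist x z + dist z w" "dist x' z \<le> dist x' x + dist x w + dist w z"
        using dist_triangle[of x w z] dist_triangle[of x' z x] dist_triangle[of x z w] by linarith+
      then show "w \<in> an'" using that w d by (auto simp: an_def an'_def dist_commute)
    qed
    show "emeasure lborel an' < \<infinity>"
      unfolding an'_def by (rule emeasure_bounded_finite) (auto intro: bounded_diff)
    show "integrable lborel (\<lambda>z. indicator an z * max (u z) 0)" by (rule i1[OF cm])
  qed (auto simp: an_def an'_def)
  moreover have "measure lborel an' = pi * (4 * (d + 1) * R)"
  proof -
    have "measure lborel an' = measure lborel (ball x (R + d + 1)) - measure lborel (ball x (R - d - 1))"
      unfolding an'_def using d0 by (intro measure_Diff) (auto intro!: less_imp_neq emeasure_bounded_finite[unfolded infinity_ennreal_def] simp: subset_ball)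
    then show ?thesis using d0 R by (simp add: measure_ball_plane power2_eq_square algebra_simps)
  qed
  moreover have "I1 - I2 \<le> 4 * C * (d + 1) * R"
    if I: "I1 = I2 + Ia" "Ia \<le> Ib" "pi * Ib \<le> C * ms" "ms = pi * (4 * (d + 1) * R)" for I1 I2 Ia Ib ms :: real
  proof -
    have "pi * (I1 - I2) \<le> pi * Ib" using I(1,2) by (intro mult_left_mono) auto
    also have "\<dots> \<le> pi * (4 * C * (d + 1) * R)" using I(3) unfolding I(4) by (simp only: mult.left_commute[of C] mult.assoc)
    finally show ?thesis by (subst (asm) mult_le_cancel_left_pos) auto
  qed
  ultimately have "(\<integral>z. indicator (ball x (R + d)) z * u z \<partial>lborel) - (\<integral>z. indicator (ball x' R) z * u z \<partial>lborel) \<le> 4 * C * (d + 1) * R"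
    by blast
  then show ?thesis using A_ball[of R x'] A_ball[of "R + d" x] R d0 by simp
qed

text \<open>After division by \<open>R^2\<close> the error in \<open>ball_comparison\<close> is of
  order \<open>1 / R\<close>. The inequality holds for every ordered pair of points, so exchanging
  them yields equality.\<close>

lemma h_le: "h x \<le> h x'"
proof -
  define d where "d = dist x x'"
  have d0: "d \<ge> 0" by (simp add: d_def)
  define a where "a x R = A x R + \<kappa> / 2 * ln R" for x R
  have a: "(a x \<longlongrightarrow> h x + \<kappa> / 4) at_top" for x
    unfolding a_def using solid_mean_asymp .
  have shift: "filterlim (\<lambda>R. R + d) at_top at_top"
    by (rule filterlim_tendsto_add_at_top[OF tendsto_const filterlim_ident, of d, simplified add.commute])
  have inv0: "((\<lambda>R::real. c / R) \<longlongrightarrow> 0) at_top" for c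
    by (intro tendsto_divide_0[OF tendsto_const] filterlim_at_top_imp_at_infinity filterlim_ident)
  have sq: "((\<lambda>R. (1 + d / R)\<^sup>2) \<longlongrightarrow> 1) at_top"
    using tendsto_power[OF tendsto_add[OF tendsto_const inv0[of d]], of 1 2] by simp
  have l0: "((\<lambda>R. ln (R + d) / R) \<longlongrightarrow> 0) at_top"
  proof -
    have "((\<lambda>R. ln (R + d) / (R + d) * (1 + d / R)) \<longlongrightarrow> 0 * (1 + 0)) at_top"
      by (intro tendsto_mult tendsto_add tendsto_const inv0 filterlim_compose[OF ln_x_over_x_tendsto_0 shift])
    moreover have "\<forall>\<^sub>F R in at_top. ln (R + d) / (R + d) * (1 + d / R) = ln (R + d) / R"
      using eventually_gt_at_top[of 0] 
    proof eventually_elim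
      case (elim R)
      have "1 + d / R = (R + d) / R" using elim by (simp add: field_simps)
      then show ?case using elim d0 by simp
    qed
    ultimately show ?thesis by (auto elim: Lim_transform_eventually)
  qed
  \<comment> \<open>The two discs have different radii, so their logarithmic corrections cancel only
    in the limit.\<close>
  have l1: "((\<lambda>R. ln R - (1 + d / R)\<^sup>2 * ln (R + d)) \<longlongrightarrow> 0) at_top"
  proof -
    have "((\<lambda>R. - ln (1 + d / R) - (2 * d + d * (d / R)) * (ln (R + d) / R)) \<longlongrightarrow> - ln (1 + 0) - (2 * d + d * 0) * 0) at_top"
      by (intro tendsto_intros inv0 l0) auto
    moreover have "\<forall>\<^sub>F R in at_top. - ln (1 + d / R) - (2 * d + d * (d / R)) * (ln (R + d) / R) = ln R - (1 + d / R)\<^sup>2 * ln (R + d)"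
      using eventually_gt_at_top[of 0]
    proof eventually_elim
      case (elim R)
      have "1 + d / R = (R + d) / R" using elim by (simp add: field_simps)
      then have "ln R = ln (R + d) - ln (1 + d / R)" using elim d0 by (simp add: ln_div)
      moreover have "- L - (2 * d + d * (d / R)) * (M / R) = (M - L) - (1 + d / R)\<^sup>2 * M" for L M
        using elim by (simp add: power2_eq_square field_simps)
      ultimately show ?case by metis
    qed
    ultimately show ?thesis by (auto elim: Lim_transform_eventually)
  qed
  have L: "((\<lambda>R. (1 + d / R)\<^sup>2 * a x (R + d) - a x' R + \<kappa> / 2 * (ln R - (1 + d / R)\<^sup>2 * ln (R + d))) \<longlongrightarrow>
     1 * (h x + \<kappa> / 4) - (h x' + \<kappa> / 4) + \<kappa> / 2 * 0) at_top"
    by (intro tendsto_intros sq a l1 filterlim_compose[OF a shift])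
  have "1 * (h x + \<kappa> / 4) - (h x' + \<kappa> / 4) + \<kappa> / 2 * 0 \<le> 0"
  proof (rule tendsto_le[OF _ inv0[of "4 * C * (d + 1)"] L])
    show "\<forall>\<^sub>F R in at_top. (1 + d / R)\<^sup>2 * a x (R + d) - a x' R + \<kappa> / 2 * (ln R - (1 + d / R)\<^sup>2 * ln (R + d)) \<le> 4 * C * (d + 1) / R"
      using eventually_gt_at_top[of "d + 1"]
    proof eventually_elim
      case (elim R)
      then have R: "R > 0" using d0 by simp
      have "(R + d)\<^sup>2 * A x (R + d) / R\<^sup>2 \<le> (R\<^sup>2 * A x' R + 4 * C * (d + 1) * R) / R\<^sup>2"
        using ball_comparison[of x x' d R] elim by (intro divide_right_mono) (auto simp: d_def)
      moreover have "(R + d)\<^sup>2 * A x (R + d) / R\<^sup>2 = (1 + d / R)\<^sup>2 * A x (R + d)"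
        using R by (simp add: power2_eq_square field_simps)
      moreover have "(R\<^sup>2 * A x' R + 4 * C * (d + 1) * R) / R\<^sup>2 = A x' R + 4 * C * (d + 1) / R"
        using R by (simp add: power2_eq_square field_simps)
      ultimately have "(1 + d / R)\<^sup>2 * A x (R + d) - A x' R \<le> 4 * C * (d + 1) / R" by linarith
      moreover have "(1 + d / R)\<^sup>2 * a x (R + d) - a x' R + \<kappa> / 2 * (ln R - (1 + d / R)\<^sup>2 * ln (R + d)) = (1 + d / R)\<^sup>2 * A x (R + d) - A x' R"
        by (simp add: a_def algebra_simps)
      ultimately show ?case by simp
    qed
  qed simp
  then show ?thesis by simp
qed

lemma representation: "\<exists>c. \<forall>x. u x = c - p x / (2 * pi)"
proof (intro exI allI)
  fix x
  have "h x = h 0" using h_le by (simp add: antisym)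
  then have "pi * u x = h 0 - p x / 2" by (simp add: h_def)
  then have "u x = (h 0 - p x / 2) / pi" by (metis nonzero_mult_div_cancel_left pi_neq_zero)
  then show "u x = h 0 / pi - p x / (2 * pi)" by (simp add: diff_divide_distrib)
qed

end

section \<open>Bounds for the logarithmic potential\<close>

lemma integral_ball_ge:
  fixes f :: "real^2 \<Rightarrow> real"
  assumes f: "integrable lborel f" "\<And>z. f z \<ge> 0" and v: "\<And>z. z \<in> ball c r \<Longrightarrow> v \<le> f z" and r: "r \<ge> 0"
  shows "v * (pi * r\<^sup>2) \<le> (\<integral>z. indicator (ball c r) z * f z \<partial>lborel)"
proof -
  have i: "integrable lborel (\<lambda>z. indicator (ball c r) z * f z)"
    using integrable_mult_indicator[of "ball c r" lborel f] f(1) by simp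
  have "v * (pi * r\<^sup>2) = (\<integral>z. v * indicator (ball c r) z \<partial>lborel)"
    using r by (simp add: measure_ball_plane)
  also have "\<dots> \<le> (\<integral>z. indicator (ball c r) z * f z \<partial>lborel)"
  proof (rule integral_mono[OF _ i])
    show "integrable lborel (\<lambda>z. v * indicator (ball c r) z)"
      using integrable_indicator_ball[of "\<lambda>_. v" c r] by (simp add: mult.commute)
  qed (use v in \<open>auto simp: indicator_def\<close>)
  finally show ?thesis .
qed

lemma integral_indicator_le:
  fixes f :: "real^2 \<Rightarrow> real"
  assumes f: "integrable lborel f" "\<And>z. f z \<ge> 0" and A: "A \<in> sets borel"
  shows "(\<integral>z. indicator A z * f z \<partial>lborel) \<le> (\<integral>z. f z \<partial>lborel)"
  using integrable_mult_indicator[of A lborel f] assms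
  by (intro integral_mono) (auto simp: indicator_def)

lemma integral_tail_small:
  fixes f :: "real^2 \<Rightarrow> real"
  assumes f: "integrable lborel f" "\<And>z. f z \<ge> 0" and e: "e > 0"
  shows "\<exists>R>0. \<forall>A\<in>sets borel. (\<forall>z\<in>A. norm z \<ge> R) \<longrightarrow> (\<integral>z. indicator A z * f z \<partial>lborel) \<le> e"
proof -
  define T where "T n = {z::real^2. norm z \<ge> real n}" for n
  have T [measurable]: "T n \<in> sets borel" for n unfolding T_def by measurable
  have [measurable]: "f \<in> borel_measurable borel" using f(1) by auto
  have Tint: "integrable lborel (\<lambda>z. indicator (T n) z * f z)" for n
    using integrable_mult_indicator[of "T n" lborel f] f(1) by simp
  have "(\<lambda>n. \<integral>z. indicator (T n) z * f z \<partial>lborel) \<longlonglongrightarrow> (\<integral>z. 0 \<partial>(lborel :: (real^2) measure))"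
  proof (rule integral_dominated_convergence[OF _ _ f(1)])
    show "AE z in lborel. (\<lambda>n. indicator (T n) z * f z) \<longlonglongrightarrow> 0"
    proof (rule AE_I2)
      fix z :: "real^2"
      have "\<forall>\<^sub>F n in sequentially. real n > norm z"
        using filterlim_real_sequentially by (simp add: filterlim_at_top_dense)
      then have "\<forall>\<^sub>F n in sequentially. indicator (T n) z * f z = 0"
        by eventually_elim (simp add: T_def)
      then show "(\<lambda>n. indicator (T n) z * f z) \<longlonglongrightarrow> 0" by (rule tendsto_eventually)
    qed
    show "AE z in lborel. norm (indicator (T n) z * f z) \<le> f z" for n
      using f(2) by (auto simp: indicator_def)
  qed (use Tint in auto)
  then have "\<forall>\<^sub>F n in sequentially. (\<integral>z. indicator (T n) z * f z \<partial>lborel) < e"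
    using e by (intro order_tendstoD) auto
  then obtain n where n: "(\<integral>z. indicator (T n) z * f z \<partial>lborel) < e"
    by (auto simp: eventually_sequentially)
  show ?thesis
  proof (intro exI[of _ "real n + 1"] conjI ballI impI)
    fix A :: "(real^2) set" assume A: "A \<in> sets borel" "\<forall>z\<in>A. norm z \<ge> real n + 1"
    have "(\<integral>z. indicator A z * f z \<partial>lborel) \<le> (\<integral>z. indicator (T n) z * f z \<partial>lborel)"
      using integrable_mult_indicator[of A lborel f] A f Tint[of n]
      by (intro integral_mono) (force simp: indicator_def T_def)+
    then show "(\<integral>z. indicator A z * f z \<partial>lborel) \<le> e" using n by simp
  qed simp
qed

lemma integrable_one_plus_norm_powr:
  assumes q: "q > 2" shows "integrable lborel (\<lambda>y::real^2. (1 + norm y) powr (-q))"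
\<comment> \<open>With \<open>n\<close> least such that \<open>norm y < 2^n\<close>, one has
  \<open>1 + norm y \<ge> 2^(n-1)\<close> for \<open>n > 0\<close>; the factor
  \<open>2 powr q\<close> pays for this shift and covers \<open>n = 0\<close>. The series has ratio
  \<open>2 powr (2 - q) < 1\<close>.\<close>
proof (rule integrable_dyadic_majorant[where c = "\<lambda>k. 2 powr q * (2 powr (-q)) ^ k" and r = "\<lambda>k. 2^k"])
  fix y :: "real^2"
  have "\<exists>n. norm y < 2^n" by (rule real_arch_pow) simp
  then obtain n where n: "norm y < 2^n" "\<forall>m<n. \<not> norm y < 2^m"
    using exists_least_iff[of "\<lambda>n. norm y < 2^n"] by blast
  have "(1 + norm y) powr (-q) \<le> 2 powr q * (2 powr (-q)) ^ n"
  proof (cases n)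
    case 0
    have "(1 + norm y) powr (-q) \<le> 1 powr (-q)" using q by (intro powr_mono2') auto
    moreover have "1 \<le> 2 powr q" using q by (intro ge_one_powr_ge_zero) auto
    ultimately show ?thesis using 0 by simp
  next
    case (Suc k)
    have "(1 + norm y) powr (-q) \<le> (2^k) powr (-q)"
      using n(2) Suc q by (intro powr_mono2') (auto simp: not_less intro: order_trans[of _ "norm y"])
    also have "\<dots> = 2 powr q * (2 powr (-q)) ^ n"
      using Suc by (simp add: powr_realpow[symmetric] powr_powr powr_add[symmetric] powr_power algebra_simps)
    finally show ?thesis .
  qed
  then have "ennreal ((1 + norm y) powr (-q)) \<le> ennreal (2 powr q * (2 powr (-q)) ^ n)" by (rule ennreal_leI)
  also have "\<dots> = ennreal (2 powr q * (2 powr (-q)) ^ n) * indicator (ball 0 (2^n)) y" using n by simp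
  also have "\<dots> \<le> (\<Sum>k. ennreal (2 powr q * (2 powr (-q)) ^ k) * indicator (ball 0 (2^k)) y)"
  proof -
    have "sum f {n} \<le> suminf f" for f :: "nat \<Rightarrow> ennreal" by (rule sum_le_suminf) auto
    then show ?thesis by (metis (no_types, lifting) sum.insert sum.empty finite.emptyI empty_iff add.right_neutral)
  qed
  finally show "ennreal ((1 + norm y) powr (-q)) \<le> (\<Sum>k. ennreal (2 powr q * (2 powr (-q)) ^ k) * indicator (ball 0 (2^k)) y)" .
next
  have "2 powr (-q) * 4 = 2 powr (2 - q)" by (simp add: powr_diff powr_minus divide_inverse)
  also have "\<dots> < 2 powr 0" using q by (intro powr_less_mono) auto
  finally have "summable (\<lambda>k. 2 powr q * (2 powr (-q) * 4) ^ k)"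
    by (intro summable_mult summable_geometric) simp
  moreover have "2 powr q * (2 powr (-q) * 4) ^ k = 2 powr q * (2 powr (-q)) ^ k * (2 ^ k)\<^sup>2" for k :: nat
  proof -
    have "(4::real) ^ k = (2 ^ k)\<^sup>2" by (simp add: power2_eq_square flip: power_mult_distrib)
    then show ?thesis by (simp add: power_mult_distrib)
  qed
  ultimately show "summable (\<lambda>k. 2 powr q * (2 powr (-q)) ^ k * (2 ^ k)\<^sup>2)" by (simp only:)
qed auto

section \<open>Reduction of the asymptotics to the local part of the potential\<close>

context plane_solution
begin

text \<open>The contribution of the singularity at \<open>x\<close> to \<open>- p x\<close>, the
  only part that the logarithmic moment does not control uniformly.\<close>

definition "N x = (\<integral>y. ln_inv (x - y) * m y \<partial>lborel)"

text \<open>Adding \<open>ln_inv\<close> removes the singularity. Away from it,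
  \<open>norm (x - y) \<le> (1 + norm x) * (2 + norm y)\<close> and, when
  \<open>norm (x - y) \<ge> 1\<close>, also
  \<open>1 + norm x \<le> norm (x - y) * (2 + norm y)\<close>.\<close>

lemma ln_compare: "\<bar>ln (norm (x - y)) - ln (1 + norm x) + ln_inv (x - y)\<bar> \<le> ln (2 + norm y)"
proof (cases "norm (x - y) < 1")
  case True
  have "norm x \<le> norm (x - y) + norm y" using norm_triangle_ineq[of "x - y" y] by simp
  then have "ln (1 + norm x) \<le> ln (2 + norm y)" using True by (subst ln_le_cancel_iff) (auto intro: add_pos_nonneg)
  moreover have "ln (1 + norm x) \<ge> 0" by simp
  ultimately show ?thesis using True by (simp add: ln_inv_def)
next
  case False
  have pos: "0 < norm (x - y)" "0 < 1 + norm x" "0 < 2 + norm y" using False by (auto intro: add_pos_nonneg)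
  have "norm (x - y) \<le> norm x + norm y" by (rule norm_triangle_ineq4)
  also have "\<dots> \<le> (1 + norm x) * (2 + norm y)" by (simp add: algebra_simps)
  finally have "ln (norm (x - y)) \<le> ln ((1 + norm x) * (2 + norm y))" using pos by (subst ln_le_cancel_iff) auto
  then have 1: "ln (norm (x - y)) \<le> ln (1 + norm x) + ln (2 + norm y)" using pos by (simp add: ln_mult_pos)
  have "norm x \<le> norm (x - y) + norm y" using norm_triangle_ineq[of "x - y" y] by simp
  then have "1 + norm x \<le> norm (x - y) + (1 + norm y) * 1" by simp
  also have "\<dots> \<le> norm (x - y) + (1 + norm y) * norm (x - y)" using False by (intro add_left_mono mult_left_mono) auto
  also have "\<dots> = norm (x - y) * (2 + norm y)" by (simp add: algebra_simps)
  finally have "ln (1 + norm x) \<le> ln (norm (x - y) * (2 + norm y))" using pos by (subst ln_le_cancel_iff) auto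
  then have 2: "ln (1 + norm x) \<le> ln (norm (x - y)) + ln (2 + norm y)" using pos by (simp add: ln_mult_pos)
  show ?thesis using 1 2 False by (simp add: ln_inv_def)
qed

text \<open>Integrating \<open>ln_compare\<close> against \<open>m\<close> leaves an error bounded
  by the logarithmic moment, so sharp asymptotics of \<open>u\<close> follow from any bound on
  \<open>N\<close>.\<close>

lemma u_asymp: "\<exists>B. \<forall>x. \<bar>u x + \<kappa> / (2 * pi) * ln (1 + norm x) - N x / (2 * pi)\<bar> \<le> B"
proof -
  obtain c where c: "\<And>x. u x = c - p x / (2 * pi)" using representation by blast
  define D where "D = (\<integral>y. ln (2 + norm y) * \<bar>m y\<bar> \<partial>lborel)"
  have D: "\<bar>p x - \<kappa> * ln (1 + norm x) + N x\<bar> \<le> D" for x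
  proof -
    have i: "integrable lborel (\<lambda>y. (ln (norm (x - y)) - ln (1 + norm x) + ln_inv (x - y)) * m y)"
      using integrable_p[of x] int_m integrable_ln_inv_m[of x] by (simp add: algebra_simps)
    have "p x - \<kappa> * ln (1 + norm x) + N x = (\<integral>y. (ln (norm (x - y)) - ln (1 + norm x) + ln_inv (x - y)) * m y \<partial>lborel)"
      using integrable_p[of x] int_m integrable_ln_inv_m[of x] by (simp add: p_def \<kappa>_def N_def algebra_simps)
    also have "\<bar>\<dots>\<bar> \<le> (\<integral>y. \<bar>(ln (norm (x - y)) - ln (1 + norm x) + ln_inv (x - y)) * m y\<bar> \<partial>lborel)"
      by (rule integral_abs_bound)
    also have "\<dots> \<le> D" unfolding D_def
      by (rule integral_mono[OF integrable_abs[OF i] int_ln]) (simp add: abs_mult mult_right_mono ln_compare)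
    finally show ?thesis .
  qed
  have "\<bar>u x + \<kappa> / (2 * pi) * ln (1 + norm x) - N x / (2 * pi)\<bar> \<le> \<bar>c\<bar> + D / (2 * pi)" for x
  proof -
    have "u x + \<kappa> / (2 * pi) * ln (1 + norm x) - N x / (2 * pi) = c - (p x - \<kappa> * ln (1 + norm x) + N x) / (2 * pi)"
      by (simp add: c add_divide_distrib diff_divide_distrib)
    moreover have "\<bar>(p x - \<kappa> * ln (1 + norm x) + N x) / (2 * pi)\<bar> \<le> D / (2 * pi)"
      using D[of x] by (simp add: divide_right_mono)
    ultimately show ?thesis by linarith
  qed
  then show ?thesis by blast
qed

lemma N_le:
  assumes "\<And>y. y \<in> ball x 1 \<Longrightarrow> m y \<le> M" shows "N x \<le> M * ln_mass"
proof -
  have "N x \<le> (\<integral>y. M * ln_inv (x - y) \<partial>lborel)" unfolding N_def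
  proof (rule integral_mono[OF integrable_ln_inv_m])
    fix y show "ln_inv (x - y) * m y \<le> M * ln_inv (x - y)"
    proof (cases "norm (x - y) < 1")
      case True
      then have "ln_inv (x - y) * m y \<le> ln_inv (x - y) * M" using assms[of y] by (intro mult_left_mono) (auto simp: dist_norm)
      then show ?thesis by (simp add: mult.commute)
    qed (simp add: ln_inv_def)
  qed simp
  then show ?thesis by (simp add: integral_ln_inv_shift)
qed

lemma N_ge:
  assumes "\<And>y. y \<in> ball x 1 \<Longrightarrow> M \<le> m y" shows "M * ln_mass \<le> N x"
proof -
  have "(\<integral>y. M * ln_inv (x - y) \<partial>lborel) \<le> N x" unfolding N_def
  proof (rule integral_mono[OF _ integrable_ln_inv_m])
    fix y show "M * ln_inv (x - y) \<le> ln_inv (x - y) * m y"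
    proof (cases "norm (x - y) < 1")
      case True
      then have "ln_inv (x - y) * M \<le> ln_inv (x - y) * m y" using assms[of y] by (intro mult_left_mono) (auto simp: dist_norm)
      then show ?thesis by (simp add: mult.commute)
    qed (simp add: ln_inv_def)
  qed simp
  then show ?thesis by (simp add: integral_ln_inv_shift)
qed

text \<open>The maximum point \<open>y\<close> of \<open>(2 - dist x y) * exp (u y)\<close> over \<open>cball x 2\<close> has a disc of radius
  \<open>\<rho> = exp (- u y)\<close> on which \<open>exp u \<le> 2 / \<rho>\<close>. On that disc the singular part of \<open>N y\<close> is bounded by
  scaling, and the rest costs at most the mass of \<open>m\<close> near \<open>y\<close> times \<open>u y\<close>, which is
  absorbed once that mass is below \<open>pi\<close>.\<close>
lemma u_bounded_above:
  assumes K0: "K0 \<ge> 0" and mle: "\<And>y. m y \<le> K0 * exp (2 * u y)" and m0: "\<And>y. m y \<ge> 0"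
  shows "\<exists>B. \<forall>x. u x \<le> B"
proof -
  obtain B where B: "\<And>x. \<bar>u x + \<kappa> / (2 * pi) * ln (1 + norm x) - N x / (2 * pi)\<bar> \<le> B" using u_asymp by blast
  have k0: "\<kappa> \<ge> 0" unfolding \<kappa>_def using m0 by simp
  have uB: "u x \<le> B + N x / (2 * pi)" for x
  proof -
    have "\<kappa> / (2 * pi) * ln (1 + norm x) \<ge> 0" using k0 by simp
    then show ?thesis using B[of x] by linarith
  qed
  \<comment> \<open>The threshold \<open>pi\<close> makes the mass term contribute
    \<open>u y * pi / (2 * pi) = u y / 2\<close>, half of what is being estimated.\<close>
  obtain R where R: "R > 0" "\<And>A. A \<in> sets borel \<Longrightarrow> (\<forall>z\<in>A. norm z \<ge> R) \<Longrightarrow> (\<integral>z. indicator A z * m z \<partial>lborel) \<le> pi"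
    using integral_tail_small[OF int_m m0, of pi] by auto
  \<comment> \<open>Solves \<open>u y \<le> B + u y / 2 + 2 * K0 * ln_mass / pi\<close> for
    \<open>u y\<close>.\<close>
  define B2 where "B2 = 2 * B + 4 * K0 * ln_mass / pi"
  \<comment> \<open>The margin 3 is 2 for the disc in which \<open>y\<close> is sought plus 1 for
    the unit disc around \<open>y\<close>.\<close>
  have far: "u x \<le> max 0 B2" if x: "norm x \<ge> R + 3" for x
  proof -
    have "continuous_on (cball x 2) (\<lambda>y. (2 - dist x y) * exp (u y))"
      by (intro continuous_intros has_grad_hess_continuous[OF gh])
    then obtain y where y: "y \<in> cball x 2" and ymax: "\<And>z. z \<in> cball x 2 \<Longrightarrow> (2 - dist x z) * exp (u z) \<le> (2 - dist x y) * exp (u y)"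
      using continuous_attains_sup[of "cball x 2" "\<lambda>y. (2 - dist x y) * exp (u y)"] by auto
    define d where "d = 2 - dist x y"
    have x2: "2 * exp (u x) \<le> d * exp (u y)" using ymax[of x] by (simp add: d_def)
    then have d: "d > 0" by (smt (verit) exp_gt_zero zero_less_mult_pos2 mult_pos_pos)
    have d2: "d \<le> 2" by (simp add: d_def)
    show ?thesis
    proof (cases "d * exp (u y) \<le> 2")
      case True
      then have "exp (u x) \<le> 1" using x2 by linarith
      then show ?thesis by simp
    next
      case False
      define \<rho> where "\<rho> = exp (- u y)"
      have \<rho>: "\<rho> > 0" "\<rho> < d / 2" "\<rho> < 1"
      proof -
        show "\<rho> > 0" by (simp add: \<rho>_def)
        show "\<rho> < d / 2" using False by (simp add: \<rho>_def exp_minus field_simps)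
        then show "\<rho> < 1" using d2 by simp
      qed
      have ln\<rho>: "- ln \<rho> = u y" by (simp add: \<rho>_def)
      have uy: "u y > 0" using \<rho> ln\<rho> by (metis ln_less_zero neg_0_less_iff_less)
      have near: "m z \<le> 4 * K0 / \<rho>\<^sup>2" if z: "z \<in> ball y \<rho>" for z
      proof -
        have dz: "dist x z \<le> dist x y + \<rho>" using dist_triangle[of x z y] z by simp
        then have zin: "d / 2 \<le> 2 - dist x z" using \<rho> by (simp add: d_def)
        then have "(d / 2) * exp (u z) \<le> (2 - dist x z) * exp (u z)" by (intro mult_right_mono) auto
        also have "\<dots> \<le> d * exp (u y)" unfolding d_def using zin d by (intro ymax) (simp add: d_def)
        finally have "exp (u z) \<le> 2 * exp (u y)" using d by (simp add: field_simps)
        then have "(exp (u z))\<^sup>2 \<le> (2 * exp (u y))\<^sup>2" by (intro power_mono) auto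
        moreover have "4 / \<rho>\<^sup>2 = (2 * exp (u y))\<^sup>2" by (simp add: \<rho>_def power_mult_distrib exp_minus power_inverse divide_inverse)
        moreover have "exp (2 * u z) = (exp (u z))\<^sup>2" by (rule exp_double)
        ultimately have "exp (2 * u z) \<le> 4 / \<rho>\<^sup>2" by simp
        then have "K0 * exp (2 * u z) \<le> K0 * (4 / \<rho>\<^sup>2)" using K0 by (rule mult_left_mono)
        then show ?thesis using mle[of z] by (simp add: mult.commute)
      qed
      \<comment> \<open>Inside radius \<open>\<rho>\<close> the kernel is
        \<open>u y = - ln \<rho>\<close> plus its rescaled copy, and the bound on \<open>m\<close>
        is used only with the copy. Between \<open>\<rho>\<close> and 1 the kernel is at most
        \<open>u y\<close>.\<close>
      have split: "ln_inv (y - z) * m z \<le> u y * (indicator (ball y 1) z * m z) + 4 * K0 / \<rho>\<^sup>2 * ln_inv ((y - z) /\<^sub>R \<rho>)" for z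
      proof -
        have n\<rho>: "norm ((y - z) /\<^sub>R \<rho>) = norm (y - z) / \<rho>" 
          using norm_scaleR[of "inverse \<rho>" "y - z"] \<rho>(1) by (simp only: abs_inverse abs_of_pos divide_inverse_commute)
        consider "y = z" | "y \<noteq> z" "norm (y - z) < \<rho>" | "\<rho> \<le> norm (y - z)" "norm (y - z) < 1" | "norm (y - z) \<ge> 1" by linarith
        then show ?thesis
        proof cases
          case 1 then show ?thesis using uy m0 by (simp add: ln_inv_def)
        next
          case 2
          then have "norm (y - z) / \<rho> < 1" using \<rho> by simp
          then have L: "ln_inv ((y - z) /\<^sub>R \<rho>) = - ln (norm (y - z)) + ln \<rho>"
            using 2 \<rho> unfolding ln_inv_def n\<rho> by (simp add: ln_div)
          then have "ln_inv (y - z) = u y + ln_inv ((y - z) /\<^sub>R \<rho>)"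
            using 2 \<rho> ln\<rho> by (simp add: ln_inv_def)
          moreover have "ln_inv ((y - z) /\<^sub>R \<rho>) * m z \<le> ln_inv ((y - z) /\<^sub>R \<rho>) * (4 * K0 / \<rho>\<^sup>2)"
            using near[of z] 2 by (intro mult_left_mono) (auto simp: dist_norm)
          ultimately show ?thesis using 2 \<rho> by (simp add: algebra_simps dist_norm)
        next
          case 3
          then have "ln \<rho> \<le> ln (norm (y - z))" using \<rho> by (subst ln_le_cancel_iff) auto
          then have "ln_inv (y - z) \<le> u y" using 3 ln\<rho> by (simp add: ln_inv_def)
          then have "ln_inv (y - z) * m z \<le> u y * m z" using m0 by (intro mult_right_mono) auto
          moreover have "0 \<le> 4 * K0 / \<rho>\<^sup>2 * ln_inv ((y - z) /\<^sub>R \<rho>)" using K0 by simp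
          ultimately show ?thesis using 3 by (simp add: dist_norm)
        next
          case 4
          then have "ln_inv (y - z) = 0" "z \<notin> ball y 1" by (auto simp: ln_inv_def dist_norm)
          moreover have "0 \<le> 4 * K0 / \<rho>\<^sup>2 * ln_inv ((y - z) /\<^sub>R \<rho>)" using K0 by simp
          ultimately show ?thesis by simp
        qed
      qed
      have ib: "integrable lborel (\<lambda>z. indicator (ball y 1) z * m z)" by (rule integrable_indicator_ball[OF m])
      have "N y \<le> (\<integral>z. u y * (indicator (ball y 1) z * m z) + 4 * K0 / \<rho>\<^sup>2 * ln_inv ((y - z) /\<^sub>R \<rho>) \<partial>lborel)"
        unfolding N_def using integrable_ln_inv_m[of y] split ib integrable_ln_inv_scale[OF \<rho>(1), of y]
        by (intro integral_mono Bochner_Integration.integrable_add integrable_mult_right) auto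
      also have "\<dots> = u y * (\<integral>z. indicator (ball y 1) z * m z \<partial>lborel) + 4 * K0 / \<rho>\<^sup>2 * (\<rho>\<^sup>2 * ln_mass)"
        using ib integrable_ln_inv_scale[OF \<rho>(1), of y] integral_ln_inv_scale[OF \<rho>(1), of y] by simp
      also have "(\<integral>z. indicator (ball y 1) z * m z \<partial>lborel) \<le> pi"
      proof (rule R(2))
        show "\<forall>z\<in>ball y 1. R \<le> norm z"
        proof
          fix z assume "z \<in> ball y 1"
          then have "norm x \<le> norm z + 3"
            using y norm_triangle_ineq2[of x y] norm_triangle_ineq2[of y z] by (simp add: dist_norm)
          then show "R \<le> norm z" using x by simp
        qed
      qed simp
      finally have "N y \<le> u y * pi + 4 * K0 * ln_mass"
        using \<rho>(1) uy by (simp add: mult.assoc)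
      then have "N y / (2 * pi) \<le> (u y * pi + 4 * K0 * ln_mass) / (2 * pi)" by (intro divide_right_mono) auto
      also have "\<dots> = u y / 2 + 2 * K0 * ln_mass / pi" by (simp add: add_divide_distrib)
      finally have "u y \<le> B2" using uB[of y] by (simp add: B2_def)
      then have "d * exp (u y) \<le> 2 * exp B2" using d2 d by (intro mult_mono) auto
      then have "exp (u x) \<le> exp B2" using x2 by linarith
      then have "u x \<le> B2" by simp
      then show ?thesis by simp
    qed
  qed
  obtain M where M: "\<And>y. y \<in> cball 0 (R + 3) \<Longrightarrow> norm (u y) \<le> M" using bounded_on_cball[OF has_grad_hess_continuous[OF gh], of 0 "R + 3"] by blast
  have "u x \<le> max M (max 0 B2)" for x
    using far[of x] M[of x] by (cases "norm x \<ge> R + 3") auto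
  then show ?thesis by blast
qed

end

section \<open>Asymptotics of the conformal factor\<close>

text \<open>Equality with a real number excludes the empty set of exponents. The two conclusions are
  the lower bound and approximation properties of the infimum.\<close>

lemma kappa_star_eq_realD:
  fixes K :: "real^2 \<Rightarrow> real"
  assumes "ereal \<kappa> = kappa_star K"
  defines "S \<equiv> {q::real. q > 0 \<and> integrable lborel (\<lambda>x. \<bar>K x\<bar> * (1 + norm x) powr (-q))}"
  shows "\<And>q. q \<in> S \<Longrightarrow> \<kappa> \<le> pi * q" and "\<And>t. \<kappa> < pi * t \<Longrightarrow> \<exists>q\<in>S. q < t"
proof -
  let ?I = "INF q\<in>S. ereal q"
  have I: "ereal \<kappa> = ereal pi * ?I" using assms by (simp add: kappa_star_def)
  have I0: "?I \<ge> 0" by (rule INF_greatest) (auto simp: S_def)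
  obtain i where i: "?I = ereal i"
    using I I0 pi_gt_zero by (cases ?I) auto
  have k: "\<kappa> = pi * i" using I by (simp add: i)
  show "\<kappa> \<le> pi * q" if "q \<in> S" for q
    using INF_lower[OF that, of ereal] by (simp add: i k)
  show "\<exists>q\<in>S. q < t" if "\<kappa> < pi * t" for t
  proof -
    have "?I < ereal t" using that by (simp add: i k)
    then show ?thesis by (auto simp: INF_less_iff)
  qed
qed

locale curvature_solution =
  fixes K u :: "real^2 \<Rightarrow> real" and g H C
  assumes K_cont: "continuous_on UNIV K"
    and K_mono: "\<And>x y. norm y \<le> norm x \<Longrightarrow> K x \<le> K y"
    and gh: "has_grad_hess u g H"
    and eq: "\<And>x. trace_hess H x = - (K x * exp (2 * u x))"
    and fin: "integrable lborel (\<lambda>x. \<bar>K x\<bar> * exp (2 * u x))"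
    and uplus: "\<And>y. (\<integral>z. indicator (ball y 1) z * max (u z) 0 \<partial>lborel) \<le> C"
    and total: "ereal (\<integral>x. K x * exp (2 * u x) \<partial>lborel) = kappa_star K"
    and logmom: "integrable lborel (\<lambda>x. \<bar>ln (norm x)\<bar>\<^sup>2 * \<bar>K x\<bar> * exp (2 * u x))"
begin

definition m where "m x = K x * exp (2 * u x)"

lemma u_cont: "continuous_on S u" by (rule has_grad_hess_continuous[OF gh])

lemma m_cont: "continuous_on UNIV m"
  unfolding m_def[abs_def] by (intro continuous_intros K_cont u_cont)

lemma abs_m: "\<bar>m y\<bar> = \<bar>K y\<bar> * exp (2 * u y)" by (simp add: m_def abs_mult)

sublocale plane_solution u g H m C
proof
  have [measurable]: "K \<in> borel_measurable borel" "u \<in> borel_measurable borel"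
    using K_cont u_cont by (auto intro: borel_measurable_continuous_onI)
  show "integrable lborel m"
    using m_cont by (intro Bochner_Integration.integrable_bound[OF fin]) (auto simp: abs_m intro: borel_measurable_continuous_onI)
  have i: "integrable lborel (\<lambda>x. 2 * (\<bar>K x\<bar> * exp (2 * u x)) + \<bar>ln (norm x)\<bar>\<^sup>2 * \<bar>K x\<bar> * exp (2 * u x))"
    using fin logmom by simp
  \<comment> \<open>The second logarithmic moment dominates the first, by
    \<open>2 * t \<le> 2 + t^2\<close>.\<close>
  have l: "ln (2 + norm y) \<le> 2 + \<bar>ln (norm y)\<bar>\<^sup>2" for y :: "real^2"
  proof (cases "norm y \<ge> 2")
    case True
    have "2 + norm y \<le> (norm y)\<^sup>2" using True mult_mono[of 2 "norm y" "norm y" "norm y"] by (simp add: power2_eq_square)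
    then have "ln (2 + norm y) \<le> ln ((norm y)\<^sup>2)" using True by (subst ln_le_cancel_iff) auto
    also have "\<dots> = 2 * ln (norm y)" using True by (subst ln_realpow) auto
    also have "\<dots> \<le> 2 + \<bar>ln (norm y)\<bar>\<^sup>2"
      using zero_le_power2[of "ln (norm y) - 1"] by (simp add: power2_diff)
    finally show ?thesis .
  next
    case False
    have "ln (2 + norm y) \<le> ln (2 * 2)" using False by (subst ln_le_cancel_iff) (auto intro: add_pos_nonneg)
    also have "ln (2 * 2 :: real) = ln 2 + ln 2" by (rule ln_mult_pos) auto
    also have "\<dots> \<le> 2" using ln_le_minus_one[of 2] by simp
    finally show ?thesis by (rule order_trans) simp
  qed
  show "integrable lborel (\<lambda>y. ln (2 + norm y) * \<bar>m y\<bar>)"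
  proof (rule Bochner_Integration.integrable_bound[OF i])
    have "norm (ln (2 + norm y) * \<bar>m y\<bar>) \<le> norm (2 * (\<bar>K y\<bar> * exp (2 * u y)) + \<bar>ln (norm y)\<bar>\<^sup>2 * \<bar>K y\<bar> * exp (2 * u y))" for y
      using mult_right_mono[OF l[of y], of "\<bar>m y\<bar>"] by (simp add: abs_m distrib_right mult.assoc)
    then show "AE y in lborel. norm (ln (2 + norm y) * \<bar>m y\<bar>) \<le> norm (2 * (\<bar>K y\<bar> * exp (2 * u y)) + \<bar>ln (norm y)\<bar>\<^sup>2 * \<bar>K y\<bar> * exp (2 * u y))"
      by simp
  qed (use m_cont in \<open>auto intro!: borel_measurable_times borel_measurable_abs intro: borel_measurable_continuous_onI\<close>)
qed (use gh eq m_cont uplus in \<open>auto simp: m_def\<close>)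

definition "a = \<kappa> / (2 * pi)"

lemma kappa: "\<kappa> = 2 * pi * a" by (simp add: a_def)

lemmas kappa_star_facts = kappa_star_eq_realD[OF total[folded m_def \<kappa>_def]]

lemma K_le_0: "K x \<le> K 0" by (rule K_mono) simp

text \<open>This disc lies outside the centred disc of radius \<open>norm y\<close>, at comparable
  distance from 0. There \<open>K \<le> K y\<close>, which bounds \<open>\<bar>K\<bar>\<close> from
  below when \<open>K y \<le> 0\<close>.\<close>

lemma ball_twice:
  fixes y z :: "real^2" assumes "z \<in> ball (2 *\<^sub>R y) (norm y)" shows "norm y \<le> norm z" "norm z \<le> 3 * norm y"
proof -
  have "norm (2 *\<^sub>R y - z) < norm y" using assms by (simp add: dist_norm)
  moreover have "norm (2 *\<^sub>R y) = 2 * norm y" by simp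
  ultimately show "norm y \<le> norm z" "norm z \<le> 3 * norm y"
    using norm_triangle_ineq2[of "2 *\<^sub>R y" z] norm_triangle_ineq3[of "2 *\<^sub>R y" z] by linarith+
qed

text \<open>The inner counterpart: on this disc \<open>K \<ge> K y\<close>, so a nonnegative value
  \<open>K y\<close> is controlled by the mass of a disc of comparable size.\<close>

lemma ball_two_thirds:
  fixes y z :: "real^2" assumes "z \<in> ball ((2/3) *\<^sub>R y) (norm y / 3)" shows "norm y / 3 \<le> norm z" "norm z \<le> norm y"
proof -
  have "norm ((2/3) *\<^sub>R y - z) < norm y / 3" using assms by (simp add: dist_norm)
  moreover have "norm ((2/3) *\<^sub>R y) = 2/3 * norm y" by simp
  ultimately show "norm y / 3 \<le> norm z" "norm z \<le> norm y"
    using norm_triangle_ineq2[of "(2/3) *\<^sub>R y" z] norm_triangle_ineq3[of "(2/3) *\<^sub>R y" z] by linarith+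
qed

lemma exists_norm: "r \<ge> 0 \<Longrightarrow> \<exists>y::real^2. norm y = r"
  using vector_choose_size by blast

text \<open>Testing integrability of \<open>\<bar>K\<bar> (1 + norm x) powr (-q)\<close> on the discs \<open>ball (2 y) (norm y)\<close>.\<close>
lemma K_growth:
  assumes q: "q > 0" "integrable lborel (\<lambda>x. \<bar>K x\<bar> * (1 + norm x) powr (-q))"
    and y: "norm y \<ge> 1" "K y \<le> 0"
  shows "\<bar>K y\<bar> \<le> (\<integral>x. \<bar>K x\<bar> * (1 + norm x) powr (-q) \<partial>lborel) / pi * 4 powr q * norm y powr (q - 2)"
proof -
  define I where "I = (\<integral>x. \<bar>K x\<bar> * (1 + norm x) powr (-q) \<partial>lborel)"
  define r where "r = norm y"
  have r: "r \<ge> 1" using y by (simp add: r_def)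
  have "\<bar>K y\<bar> * (4 * r) powr (-q) * (pi * r\<^sup>2) \<le> (\<integral>z. indicator (ball (2 *\<^sub>R y) r) z * (\<bar>K z\<bar> * (1 + norm z) powr (-q)) \<partial>lborel)"
  proof (rule integral_ball_ge[OF q(2)])
    fix z assume z: "z \<in> ball (2 *\<^sub>R y) r"
    have nz: "r \<le> norm z" "norm z \<le> 3 * r" using ball_twice[of z y] z by (auto simp: r_def)
    have "\<bar>K y\<bar> \<le> \<bar>K z\<bar>" using K_mono[of y z] nz y by (simp add: r_def)
    moreover have "(4 * r) powr (-q) \<le> (1 + norm z) powr (-q)" using nz r q by (intro powr_mono2') (auto intro: add_pos_nonneg)
    ultimately show "\<bar>K y\<bar> * (4 * r) powr (-q) \<le> \<bar>K z\<bar> * (1 + norm z) powr (-q)" by (intro mult_mono) auto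
  qed (use r in auto)
  also have "\<dots> \<le> I" unfolding I_def by (rule integral_indicator_le[OF q(2)]) auto
  finally have "\<bar>K y\<bar> * (4 * r) powr (-q) * (pi * r\<^sup>2) \<le> I" .
  moreover have "(4 * r) powr (-q) * r\<^sup>2 = 1 / (4 powr q * r powr (q - 2))"
    using r by (simp add: powr_mult powr_minus powr_diff powr_numeral field_simps)
  moreover have "\<bar>K y\<bar> * (4 * r) powr (-q) * (pi * r\<^sup>2) = \<bar>K y\<bar> * pi * ((4 * r) powr (-q) * r\<^sup>2)"
    by (simp only: mult_ac)
  ultimately have "\<bar>K y\<bar> * pi / (4 powr q * r powr (q - 2)) \<le> I" by simp
  then show ?thesis using r unfolding I_def[symmetric] r_def[symmetric] by (simp add: field_simps)
qed

lemma global_bound: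
  fixes f :: "real^2 \<Rightarrow> real"
  assumes "continuous_on UNIV f" "\<And>x. norm x \<ge> R \<Longrightarrow> f x \<le> B" shows "\<exists>B'\<ge>0. \<forall>x. f x \<le> B'"
proof -
  obtain M where M: "M > 0" "\<And>y. y \<in> cball 0 R \<Longrightarrow> norm (f y) \<le> M" using bounded_on_cball[OF assms(1)] by blast
  have "f x \<le> max M B" for x using M(2)[of x] assms(2)[of x] by (cases "norm x \<le> R") auto
  then show ?thesis using M(1) by (intro exI[of _ "max M B"]) auto
qed

lemma asymptotics_of_N_bounded:
  assumes "\<And>x. \<bar>N x\<bar> \<le> B" shows "\<exists>B. \<forall>x. \<bar>u x + a * ln (1 + norm x)\<bar> \<le> B"
proof -
  obtain B' where B': "\<And>x. \<bar>u x + a * ln (1 + norm x) - N x / (2 * pi)\<bar> \<le> B'" using u_asymp unfolding a_def by blast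
  have "\<bar>u x + a * ln (1 + norm x)\<bar> \<le> B' + B / (2 * pi)" for x
  proof -
    have "\<bar>N x / (2 * pi)\<bar> \<le> B / (2 * pi)" using assms[of x] by (simp add: divide_right_mono)
    then show ?thesis using B'[of x] by linarith
  qed
  then show ?thesis by blast
qed

lemma exp_2u_le: assumes "u y \<le> s - a * ln (1 + norm y)" shows "exp (2 * u y) \<le> exp (2 * s) * (1 + norm y) powr (- 2 * a)"
proof -
  have "exp (2 * s) * (1 + norm y) powr (- 2 * a) = exp (2 * (s - a * ln (1 + norm y)))"
    using add_pos_nonneg[OF zero_less_one norm_ge_zero[of y]] by (auto simp: powr_def exp_add[symmetric] algebra_simps)
  then show ?thesis using assms by simp
qed

lemma exp_2u_ge: assumes "s - a * ln (1 + norm y) \<le> u y" shows "exp (2 * s) * (1 + norm y) powr (- 2 * a) \<le> exp (2 * u y)"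
proof -
  have "exp (2 * s) * (1 + norm y) powr (- 2 * a) = exp (2 * (s - a * ln (1 + norm y)))"
    using add_pos_nonneg[OF zero_less_one norm_ge_zero[of y]] by (auto simp: powr_def exp_add[symmetric] algebra_simps)
  then show ?thesis using assms by simp
qed

section \<open>Asymptotics according to the sign of the curvature\<close>

lemma negative_case:
  assumes neg: "K x0 < 0"
  shows "0 < a \<and> (\<exists>B. \<forall>x. \<bar>u x + a * ln (1 + norm x)\<bar> \<le> B)"
proof -
  define \<rho> where "\<rho> = max 1 (norm x0)"
  have far: "K y \<le> K x0" if "norm y \<ge> \<rho>" for y using K_mono[of x0 y] that by (simp add: \<rho>_def)
  \<comment> \<open>Far out \<open>\<bar>K\<bar>\<close> is at least \<open>- K x0\<close>, but
    \<open>K_growth\<close> with \<open>q < 1\<close> would make it decay at least like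
    \<open>1 / norm y\<close>. The resulting \<open>q \<ge> 1\<close> already gives
    \<open>a > 0\<close>.\<close>
  have q1: "q \<ge> 1" if q: "q > 0" "integrable lborel (\<lambda>x. \<bar>K x\<bar> * (1 + norm x) powr (-q))" for q
  proof (rule ccontr)
    assume "\<not> q \<ge> 1" then have q1: "q < 1" by simp
    define I where "I = (\<integral>x. \<bar>K x\<bar> * (1 + norm x) powr (-q) \<partial>lborel)"
    define E where "E = I / pi * 4 powr q"
    have I0: "I \<ge> 0" unfolding I_def by (rule Bochner_Integration.integral_nonneg) simp
    then have E0: "E \<ge> 0" by (simp add: E_def)
    define r where "r = max \<rho> ((E + 1) / - K x0)"
    have r1: "r \<ge> 1" by (simp add: r_def \<rho>_def)
    then obtain y :: "real^2" where y: "norm y = r" using exists_norm[of r] by auto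
    have "- K x0 \<le> \<bar>K y\<bar>" using far[of y] neg y by (simp add: r_def)
    also have "\<bar>K y\<bar> \<le> E * r powr (q - 2)"
      using K_growth[OF q, of y] far[of y] neg y r1 by (simp add: E_def I_def r_def)
    also have "\<dots> \<le> E * r powr (-1)" using E0 q1 r1 by (intro mult_left_mono powr_mono) auto
    finally have "- K x0 * r \<le> E" using r1 by (simp add: powr_minus field_simps)
    moreover have "- K x0 * ((E + 1) / - K x0) \<le> - K x0 * r" using neg by (intro mult_left_mono) (auto simp: r_def)
    ultimately show False using neg by simp
  qed
  have "pi * (1/2) \<le> \<kappa>"
  proof (rule ccontr)
    assume "\<not> pi * (1/2) \<le> \<kappa>"
    then obtain q where "q > 0" "integrable lborel (\<lambda>x. \<bar>K x\<bar> * (1 + norm x) powr (-q))" "q < 1/2"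
      using kappa_star_facts(2)[of "1/2"] by auto
    then show False using q1[of q] by simp
  qed
  then have a0: "a > 0" using pi_gt_zero by (simp add: kappa)
  obtain B where B: "\<And>x. \<bar>u x + a * ln (1 + norm x) - N x / (2 * pi)\<bar> \<le> B" using u_asymp unfolding a_def by blast
  \<comment> \<open>Since \<open>\<kappa> = 2 * pi * a\<close>, the infimum of admissible exponents
    is \<open>2 * a\<close>. With \<open>q < 2 * a + 2\<close> the growth
    \<open>norm x powr (q - 2)\<close> of \<open>\<bar>K\<bar>\<close> stays below
    \<open>norm x powr (2 * a)\<close>, exactly what \<open>exp (2 * u)\<close> compensates.\<close>
  obtain q where q: "q > 0" "integrable lborel (\<lambda>x. \<bar>K x\<bar> * (1 + norm x) powr (-q))" "q < 2 * a + 2"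
    using kappa_star_facts(2)[of "2 * a + 2"] pi_gt_zero by (auto simp: kappa algebra_simps)
  \<comment> \<open>The upper bound on \<open>m\<close> comes first: \<open>m \<le> 0\<close> far
    out. It bounds \<open>u\<close> from above, which is what the lower bound on \<open>m\<close>
    requires.\<close>
  have "\<exists>M\<ge>0. \<forall>x. m x \<le> M"
  proof (rule global_bound[OF m_cont])
    show "m x \<le> 0" if "norm x \<ge> \<rho>" for x using far[OF that] neg by (simp add: m_def mult_nonpos_nonneg)
  qed
  then obtain M where M: "M \<ge> 0" "\<And>x. m x \<le> M" by blast
  have Nle: "N x \<le> M * ln_mass" for x using M by (intro N_le) auto
  have u_le: "u x \<le> B + M * ln_mass / (2 * pi) - a * ln (1 + norm x)" for x
    using B[of x] divide_right_mono[OF Nle[of x], of "2 * pi"] by simp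
  define s where "s = B + M * ln_mass / (2 * pi)"
  define E where "E = (\<integral>x. \<bar>K x\<bar> * (1 + norm x) powr (-q) \<partial>lborel) / pi * 4 powr q"
  have E0: "E \<ge> 0" unfolding E_def by (intro mult_nonneg_nonneg divide_nonneg_pos Bochner_Integration.integral_nonneg) auto
  have "\<exists>M\<ge>0. \<forall>x. - m x \<le> M"
  proof (rule global_bound[of _ \<rho> "E * exp (2 * s)"])
    show "continuous_on UNIV (\<lambda>x. - m x)" by (intro continuous_intros m_cont)
    fix x :: "real^2" assume x: "norm x \<ge> \<rho>"
    then have r1: "norm x \<ge> 1" by (simp add: \<rho>_def)
    have "\<bar>K x\<bar> \<le> E * norm x powr (q - 2)" unfolding E_def
      by (rule K_growth[OF q(1,2) r1]) (use far[OF x] neg in auto)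
    also have "\<dots> \<le> E * norm x powr (2 * a)" using E0 q r1 by (intro mult_left_mono powr_mono) auto
    also have "\<dots> \<le> E * (1 + norm x) powr (2 * a)" using E0 a0 r1 by (intro mult_left_mono powr_mono2) auto
    finally have "\<bar>K x\<bar> * exp (2 * u x) \<le> E * (1 + norm x) powr (2 * a) * (exp (2 * s) * (1 + norm x) powr (- 2 * a))"
      by (rule mult_mono[OF _ exp_2u_le]) (use u_le[of x] E0 in \<open>auto simp: s_def\<close>)
    also have "\<dots> = E * exp (2 * s)" using r1 by (simp add: powr_minus field_simps)
    finally show "- m x \<le> E * exp (2 * s)" using abs_m[of x] by linarith
  qed
  then obtain M' where M': "M' \<ge> 0" "\<And>x. - m x \<le> M'" by blast
  have "- M' * ln_mass \<le> N x" for x using M'(2) by (intro N_ge) (simp add: minus_le_iff)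
  then have "\<bar>N x\<bar> \<le> M * ln_mass + M' * ln_mass" for x
    using Nle[of x] M(1) M'(1) ln_mass_nonneg mult_nonneg_nonneg[of M ln_mass] mult_nonneg_nonneg[of M' ln_mass]
    by (smt (verit) minus_mult_left)
  then show ?thesis using asymptotics_of_N_bounded a0 by blast
qed

text \<open>Monotonicity gives \<open>K \<le> K 0\<close>, so \<open>u_bounded_above\<close> applies
  and makes \<open>m\<close>, hence \<open>N\<close>, bounded. Positivity of \<open>a\<close> is
  positivity of the total mass, visible near 0 because \<open>K 0 > 0\<close>.\<close>

lemma positive_case:
  assumes pos: "\<And>x. K x \<ge> 0" "K x1 > 0"
  shows "0 < a \<and> (\<exists>B. \<forall>x. \<bar>u x + a * ln (1 + norm x)\<bar> \<le> B)"
proof -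
  have K0: "K 0 > 0" using pos(2) K_le_0[of x1] by simp
  have m0: "m y \<ge> 0" for y using pos by (simp add: m_def)
  have "isCont m 0" using m_cont by (simp add: continuous_on_eq_continuous_at)
  then have "(m \<longlongrightarrow> m 0) (nhds 0)" unfolding isCont_def by (rule tendsto_at_iff_tendsto_nhds[of m 0, THEN iffD1])
  then have "\<forall>\<^sub>F y in nhds 0. m 0 / 2 < m y"
    by (rule order_tendstoD) (use K0 in \<open>simp add: m_def\<close>)
  then obtain \<delta> where \<delta>: "\<delta> > 0" "\<And>y. y \<in> ball 0 \<delta> \<Longrightarrow> m 0 / 2 \<le> m y"
    unfolding eventually_nhds_metric by (force simp: dist_commute)
  have "m 0 / 2 * (pi * \<delta>\<^sup>2) \<le> (\<integral>z. indicator (ball 0 \<delta>) z * m z \<partial>lborel)"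
    using \<delta> m0 by (intro integral_ball_ge[OF int_m]) auto
  also have "\<dots> \<le> \<kappa>" unfolding \<kappa>_def by (rule integral_indicator_le[OF int_m m0]) simp
  finally have "m 0 / 2 * (pi * \<delta>\<^sup>2) \<le> \<kappa>" .
  moreover have "m 0 / 2 * (pi * \<delta>\<^sup>2) > 0" using K0 \<delta>(1) by (simp add: m_def)
  ultimately have "\<kappa> > 0" by linarith
  then have a0: "a > 0" by (simp add: a_def)
  obtain B where B: "\<And>x. u x \<le> B"
    using u_bounded_above[of "K 0"] K0 K_le_0 m0 by (auto simp: m_def mult_right_mono)
  have "m y \<le> K 0 * exp (2 * B)" for y unfolding m_def using B[of y] pos K_le_0 K0 by (intro mult_mono) auto
  then have "N x \<le> K 0 * exp (2 * B) * ln_mass" for x by (intro N_le)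
  moreover have "0 * ln_mass \<le> N x" for x using m0 by (intro N_ge)
  ultimately have "\<bar>N x\<bar> \<le> K 0 * exp (2 * B) * ln_mass" for x by simp
  then show ?thesis using asymptotics_of_N_bounded a0 by blast
qed

lemma asymptotics:
  assumes "K x1 \<noteq> 0" shows "0 < a" "\<exists>B. \<forall>x. \<bar>u x + a * ln (1 + norm x)\<bar> \<le> B"
proof -
  have "0 < a \<and> (\<exists>B. \<forall>x. \<bar>u x + a * ln (1 + norm x)\<bar> \<le> B)"
  proof (cases "\<exists>x0. K x0 < 0")
    case True then show ?thesis using negative_case by blast
  next
    case False
    then have nn: "K x \<ge> 0" for x by (meson not_less)
    then have "K x1 > 0" using assms nn[of x1] by linarith
    with nn show ?thesis by (rule positive_case)
  qed
  then show "0 < a" "\<exists>B. \<forall>x. \<bar>u x + a * ln (1 + norm x)\<bar> \<le> B" by blast+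
qed

lemma K_nonconstant:
  assumes "K x1 \<noteq> 0" shows "\<exists>y. K y \<noteq> K 0"
proof (rule ccontr)
  assume "\<not> (\<exists>y. K y \<noteq> K 0)"
  then have K: "K y = K 0" for y by blast
  have a0: "a > 0" by (rule asymptotics) fact
  obtain B where B: "\<And>x. \<bar>u x + a * ln (1 + norm x)\<bar> \<le> B" using asymptotics[OF assms] by blast
  have "K 0 > 0"
  proof (rule ccontr)
    assume "\<not> K 0 > 0"
    then have "m y \<le> 0" for y using K[of y] by (simp add: m_def mult_nonpos_nonneg)
    then have "0 \<le> (\<integral>y. - m y \<partial>lborel)" by (intro Bochner_Integration.integral_nonneg) simp
    then have "\<kappa> \<le> 0" unfolding \<kappa>_def by simp
    then show False using a0 by (simp add: a_def zero_less_divide_iff)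
  qed
  have m0: "m y \<ge> 0" for y using K[of y] \<open>K 0 > 0\<close> by (simp add: m_def)
  \<comment> \<open>Half of the mass that, if \<open>a \<le> 1\<close>, each disc
    \<open>ball (2 *\<^sub>R y) r\<close> would carry at least; scale invariance of
    \<open>norm x powr (-2)\<close> makes it independent of \<open>r\<close>.\<close>
  define e where "e = K 0 * exp (- 2 * B) * pi / 16 / 2"
  have e: "e > 0" using \<open>K 0 > 0\<close> by (simp add: e_def)
  obtain R where R: "R > 0" "\<And>A. A \<in> sets borel \<Longrightarrow> (\<forall>z\<in>A. norm z \<ge> R) \<Longrightarrow> (\<integral>z. indicator A z * m z \<partial>lborel) \<le> e"
    using integral_tail_small[OF int_m m0 e] by blast
  have "a > 1"
  proof (rule ccontr)
    assume "\<not> a > 1"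
    define r where "r = max R 1"
    have r: "r \<ge> 1" "r \<ge> R" by (auto simp: r_def)
    obtain y :: "real^2" where y: "norm y = r" using exists_norm[of r] r by auto
    have "K 0 * (exp (- 2 * B) * (4 * r) powr (-2)) * (pi * r\<^sup>2) \<le> (\<integral>z. indicator (ball (2 *\<^sub>R y) r) z * m z \<partial>lborel)"
    proof (rule integral_ball_ge[OF int_m])
      fix z assume "z \<in> ball (2 *\<^sub>R y) r"
      then have z: "r \<le> norm z" "norm z \<le> 3 * r" using ball_twice[of z y] y by auto
      have "(4 * r) powr (-2) \<le> (1 + norm z) powr (-2)" using z r by (intro powr_mono2') auto
      also have "\<dots> \<le> (1 + norm z) powr (- 2 * a)" using \<open>\<not> a > 1\<close> by (intro powr_mono) auto
      finally have "exp (- 2 * B) * (4 * r) powr (-2) \<le> exp (2 * (- B)) * (1 + norm z) powr (- 2 * a)" by simp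
      also have "\<dots> \<le> exp (2 * u z)" using B[of z] by (intro exp_2u_ge) auto
      finally show "K 0 * (exp (- 2 * B) * (4 * r) powr (-2)) \<le> m z" using K[of z] \<open>K 0 > 0\<close> by (simp add: m_def)
    qed (use r m0 in auto)
    also have "\<dots> \<le> e"
    proof (rule R(2))
      show "\<forall>z\<in>ball (2 *\<^sub>R y) r. R \<le> norm z"
      proof
        fix z assume "z \<in> ball (2 *\<^sub>R y) r"
        then have "z \<in> ball (2 *\<^sub>R y) (norm y)" using y by simp
        from ball_twice(1)[OF this] show "R \<le> norm z" using y r by simp
      qed
    qed simp
    finally have "K 0 * (exp (- 2 * B) * (4 * r) powr (-2)) * (pi * r\<^sup>2) \<le> e" .
    moreover have "(4 * r) powr (-2) = 1 / (16 * r\<^sup>2)"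
    proof -
      have "(4 * r) powr (-2) = inverse ((4 * r) powr 2)" by (rule powr_minus)
      also have "(4 * r) powr 2 = (4 * r)\<^sup>2" using r by (intro powr_numeral) simp
      finally show ?thesis by (simp add: power_mult_distrib inverse_eq_divide)
    qed
    moreover have "K 0 * (exp (- 2 * B) * (1 / (16 * r\<^sup>2))) * (pi * r\<^sup>2) = 2 * e"
      using r by (simp add: e_def)
    ultimately have "2 * e \<le> e" by (simp only:)
    then show False using e by simp
  qed
  \<comment> \<open>The midpoint of 2 and \<open>2 * a\<close>: large enough for integrability, too
    small for the infimum \<open>2 * a\<close>.\<close>
  define q where "q = 1 + a"
  have "q > 2" using \<open>a > 1\<close> by (simp add: q_def)
  have "(\<lambda>x. \<bar>K x\<bar> * (1 + norm x) powr (-q)) = (\<lambda>x. \<bar>K 0\<bar> * (1 + norm x) powr (-q))"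
    by (intro ext) (metis K)
  then have "\<kappa> \<le> pi * q"
    using integrable_one_plus_norm_powr[OF \<open>q > 2\<close>] \<open>q > 2\<close> by (intro kappa_star_facts(1)) simp
  then show False using \<open>a > 1\<close> by (simp add: kappa q_def)
qed

text \<open>On the disc of \<open>ball_two_thirds\<close> both \<open>K\<close> and the power of
  \<open>1 + norm z\<close> are at least their values at \<open>y\<close>, and the area is
  comparable to \<open>(norm y)^2\<close>. The quantity is thus bounded by a tail of the squared
  logarithmic moment. If \<open>K\<close> is negative somewhere it is eventually
  nonpositive.\<close>

lemma decay:
  assumes "K x1 \<noteq> 0" and \<eta>: "\<eta> > 0"
  shows "\<exists>R. \<forall>x. norm x \<ge> R \<longrightarrow> K x * (1 + norm x) powr (- 2 * a) * (norm x)\<^sup>2 * (ln (norm x))\<^sup>2 \<le> \<eta>"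
proof (cases "\<exists>x0. K x0 < 0")
  case True
  then obtain x0 where x0: "K x0 < 0" by blast
  have "K x * (1 + norm x) powr (- 2 * a) * (norm x)\<^sup>2 * (ln (norm x))\<^sup>2 \<le> \<eta>" if "norm x \<ge> norm x0" for x
  proof -
    have "K x \<le> 0" using K_mono[OF that] x0 by simp
    then have "K x * (1 + norm x) powr (- 2 * a) * (norm x)\<^sup>2 * (ln (norm x))\<^sup>2 \<le> 0"
      by (intro mult_nonpos_nonneg) auto
    then show ?thesis using \<eta> by simp
  qed
  then show ?thesis by blast
next
  case False
  then have Kpos: "K x \<ge> 0" for x by (meson not_less)
  have a0: "a > 0" by (rule asymptotics) fact
  obtain B where B: "\<And>x. \<bar>u x + a * ln (1 + norm x)\<bar> \<le> B" using asymptotics[OF assms(1)] by blast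
  \<comment> \<open>The factor 36 is 4 from halving the logarithm times 9 from the radius
    \<open>r / 3\<close>.\<close>
  define e where "e = exp (- 2 * B) * pi / 36 * \<eta>"
  have e: "e > 0" using \<eta> by (simp add: e_def)
  define f where "f x = \<bar>ln (norm x)\<bar>\<^sup>2 * \<bar>K x\<bar> * exp (2 * u x)" for x
  have f: "integrable lborel f" "\<And>x. f x \<ge> 0" using logmom by (auto simp: f_def[abs_def])
  obtain R where R: "R > 0" "\<And>A. A \<in> sets borel \<Longrightarrow> (\<forall>z\<in>A. norm z \<ge> R) \<Longrightarrow> (\<integral>z. indicator A z * f z \<partial>lborel) \<le> e"
    using integral_tail_small[OF f e] by blast
  have "K y * (1 + norm y) powr (- 2 * a) * (norm y)\<^sup>2 * (ln (norm y))\<^sup>2 \<le> \<eta>" if y: "norm y \<ge> max 9 (3 * R)" for y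
  proof -
    define r where "r = norm y"
    have r: "r \<ge> 9" "r / 3 \<ge> R" using y by (auto simp: r_def)
    \<comment> \<open>This is where \<open>r \<ge> 9\<close> enters: it says
      \<open>ln 3 \<le> ln r / 2\<close>.\<close>
    have lnr: "ln r / 2 \<le> ln (r / 3)"
    proof -
      have "ln 9 \<le> ln r" using r by simp
      moreover have "ln (9::real) = 2 * ln 3" using ln_realpow[of 3 2] by simp
      ultimately show ?thesis using r by (simp add: ln_div)
    qed
    have "K y * (1 + r) powr (- 2 * a) * exp (- 2 * B) * (ln r)\<^sup>2 / 4 * (pi * (r / 3)\<^sup>2) \<le>
        (\<integral>z. indicator (ball ((2/3) *\<^sub>R y) (r / 3)) z * f z \<partial>lborel)"
    proof (rule integral_ball_ge[OF f])
      fix z assume "z \<in> ball ((2/3) *\<^sub>R y) (r / 3)"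
      then have z: "r / 3 \<le> norm z" "norm z \<le> r" using ball_two_thirds[of z y] by (auto simp: r_def)
      have "ln (r / 3) \<le> ln (norm z)" using z r by (subst ln_le_cancel_iff) auto
      then have "ln r / 2 \<le> \<bar>ln (norm z)\<bar>" using lnr by linarith
      then have 1: "(ln r / 2)\<^sup>2 \<le> \<bar>ln (norm z)\<bar>\<^sup>2" using r by (intro power_mono) auto
      have 2: "K y \<le> \<bar>K z\<bar>" using K_mono[of z y] z Kpos[of z] by (simp add: r_def)
      have "exp (- 2 * B) * (1 + r) powr (- 2 * a) \<le> exp (2 * (- B)) * (1 + norm z) powr (- 2 * a)"
        using z a0 by (intro mult_mono powr_mono2') (auto intro: add_pos_nonneg)
      also have "\<dots> \<le> exp (2 * u z)" using B[of z] by (intro exp_2u_ge) auto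
      finally have 3: "exp (- 2 * B) * (1 + r) powr (- 2 * a) \<le> exp (2 * u z)" .
      have "(ln r / 2)\<^sup>2 * K y * (exp (- 2 * B) * (1 + r) powr (- 2 * a)) \<le> f z"
        unfolding f_def using Kpos[of y] by (intro mult_mono 1 2 3) auto
      then show "K y * (1 + r) powr (- 2 * a) * exp (- 2 * B) * (ln r)\<^sup>2 / 4 \<le> f z"
        by (simp add: power_divide mult_ac)
    qed (use r in auto)
    also have "\<dots> \<le> e"
    proof (rule R(2))
      show "\<forall>z\<in>ball ((2/3) *\<^sub>R y) (r / 3). R \<le> norm z"
      proof
        fix z assume "z \<in> ball ((2/3) *\<^sub>R y) (r / 3)"
        then have "z \<in> ball ((2/3) *\<^sub>R y) (norm y / 3)" by (simp only: r_def)
        from ball_two_thirds(1)[OF this] show "R \<le> norm z" using r(2) unfolding r_def by simp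
      qed
    qed simp
    also have "K y * (1 + r) powr (- 2 * a) * exp (- 2 * B) * (ln r)\<^sup>2 / 4 * (pi * (r / 3)\<^sup>2) =
        exp (- 2 * B) * pi / 36 * (K y * (1 + r) powr (- 2 * a) * r\<^sup>2 * (ln r)\<^sup>2)"
    proof -
      have "k * p * x * l / 4 * (pi * (r / 3)\<^sup>2) = x * pi / 36 * (k * p * r\<^sup>2 * l)" for k p x l
        by (simp add: power_divide)
      then show ?thesis .
    qed
    finally have "exp (- 2 * B) * pi / 36 * (K y * (1 + r) powr (- 2 * a) * r\<^sup>2 * (ln r)\<^sup>2) \<le> exp (- 2 * B) * pi / 36 * \<eta>"
      by (simp only: e_def)
    then show ?thesis by (subst (asm) mult_le_cancel_left_pos) (auto simp: r_def)
  qed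
  then show ?thesis by blast
qed

text \<open>With \<open>m = 0\<close> the potential vanishes and the representation becomes a
  Liouville theorem.\<close>

lemma zero_curvature:
  assumes "\<And>x. K x = 0" shows "u x = u y"
proof -
  obtain c where c: "\<And>x. u x = c - p x / (2 * pi)" using representation by blast
  have "p x = 0" for x by (simp add: p_def m_def assms)
  then show ?thesis by (simp add: c)
qed

end

section \<open>Reflections and second order tests\<close>

definition reflect :: "real^2 \<Rightarrow> real \<Rightarrow> real^2 \<Rightarrow> real^2" where
  "reflect e \<tau> x = x - (2 * (x \<bullet> e - \<tau>)) *\<^sub>R e"

definition reflect0 :: "real^2 \<Rightarrow> real^2 \<Rightarrow> real^2" where
  "reflect0 e v = v - (2 * (v \<bullet> e)) *\<^sub>R e"

lemma reflect_boundary: "x \<bullet> e = \<tau> \<Longrightarrow> reflect e \<tau> x = x"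
  by (simp add: reflect_def)

lemma reflect_inner: "e \<bullet> e = 1 \<Longrightarrow> reflect e \<tau> x \<bullet> e = 2 * \<tau> - x \<bullet> e"
  by (simp add: reflect_def inner_diff_left)

lemma reflect_norm:
  assumes e: "e \<bullet> e = 1" shows "(norm (reflect e \<tau> x))\<^sup>2 = (norm x)\<^sup>2 + 4 * \<tau> * (\<tau> - x \<bullet> e)"
proof -
  have "(norm (reflect e \<tau> x))\<^sup>2 = x \<bullet> x - 2 * (2 * (x \<bullet> e - \<tau>)) * (x \<bullet> e) + (2 * (x \<bullet> e - \<tau>))\<^sup>2 * (e \<bullet> e)"
    unfolding power2_norm_eq_inner reflect_def
    by (simp add: inner_diff_left inner_diff_right inner_commute[of e x] power2_eq_square algebra_simps)
  then show ?thesis unfolding e power2_norm_eq_inner by (simp add: power2_eq_square algebra_simps)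
qed

text \<open>The mirror line leaves the origin on the side \<open>x \<bullet> e < \<tau>\<close>, so
  points of that side move away from 0. Through the monotonicity of \<open>K\<close> this gives the
  reflected curvature its sign in every comparison.\<close>

lemma norm_le_reflect:
  assumes "e \<bullet> e = 1" "\<tau> > 0" "x \<bullet> e \<le> \<tau>" shows "norm x \<le> norm (reflect e \<tau> x)"
proof (rule power2_le_imp_le)
  have "0 \<le> 4 * \<tau> * (\<tau> - x \<bullet> e)" using assms by simp
  then show "(norm x)\<^sup>2 \<le> (norm (reflect e \<tau> x))\<^sup>2" using reflect_norm[OF assms(1), of \<tau> x] by simp
qed simp

lemma linear_reflect0: "linear (reflect0 e)"
  by (rule linearI) (simp_all add: reflect0_def inner_add_left algebra_simps)

lemma bounded_linear_reflect0: "bounded_linear (reflect0 e)"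
  using linear_reflect0 by (rule linear_conv_bounded_linear[THEN iffD1])

lemma reflect0_inner: "reflect0 e v \<bullet> w = v \<bullet> reflect0 e w"
  by (simp add: reflect0_def inner_diff_left inner_diff_right inner_commute)

lemma has_derivative_reflect: "(reflect e \<tau> has_derivative reflect0 e) (at x)"
  unfolding reflect_def[abs_def] reflect0_def[abs_def] by (auto intro!: derivative_eq_intros)

lemma continuous_on_reflect [continuous_intros]: "continuous_on S f \<Longrightarrow> continuous_on S (\<lambda>x. reflect e \<tau> (f x))"
  unfolding reflect_def by (intro continuous_intros)

lemma has_grad_hess_reflect:
  assumes gh: "has_grad_hess u g H"
  shows "has_grad_hess (\<lambda>x. u (reflect e \<tau> x)) (\<lambda>x. reflect0 e (g (reflect e \<tau> x)))
     (\<lambda>x v. reflect0 e (H (reflect e \<tau> x) (reflect0 e v)))"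
  unfolding has_grad_hess_def
proof (intro conjI allI)
  fix x
  have "((\<lambda>x. u (reflect e \<tau> x)) has_derivative (\<lambda>v. g (reflect e \<tau> x) \<bullet> reflect0 e v)) (at x)"
    by (rule has_derivative_compose[OF has_derivative_reflect grad[OF gh]])
  then show "((\<lambda>x. u (reflect e \<tau> x)) has_derivative (\<lambda>v. reflect0 e (g (reflect e \<tau> x)) \<bullet> v)) (at x)"
    by (simp only: reflect0_inner)
  show "((\<lambda>x. reflect0 e (g (reflect e \<tau> x))) has_derivative (\<lambda>v. reflect0 e (H (reflect e \<tau> x) (reflect0 e v)))) (at x)"
    by (rule bounded_linear.has_derivative[OF bounded_linear_reflect0 has_derivative_compose[OF has_derivative_reflect hess[OF gh]]])
next
  fix v
  show "continuous_on UNIV (\<lambda>x. reflect0 e (H (reflect e \<tau> x) (reflect0 e v)))"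
    by (intro bounded_linear.continuous_on[OF bounded_linear_reflect0]
          continuous_on_compose2[OF hess_continuous[OF gh, of UNIV]] continuous_intros) auto
qed

text \<open>Conjugation by the reflection preserves the trace: the two cross terms contribute
  \<open>-2 * (L e \<bullet> e)\<close> each and cancel against
  \<open>4 * (L e \<bullet> e)\<close>.\<close>

lemma trace_reflect:
  assumes e: "e \<bullet> e = 1" and gh: "has_grad_hess u g H"
  shows "trace_hess (\<lambda>x v. reflect0 e (H (reflect e \<tau> x) (reflect0 e v))) x = trace_hess H (reflect e \<tau> x)"
proof -
  define L where "L = H (reflect e \<tau> x)"
  have L: "linear L" unfolding L_def by (rule hess_linear[OF gh])
  define b where "b i = (axis i 1 :: real^2)" for i :: 2
  have expand: "v = (\<Sum>i\<in>UNIV. (v \<bullet> b i) *\<^sub>R b i)" for v :: "real^2"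
    unfolding b_def by (simp add: inner_axis) (metis basis_expansion scalar_mult_eq_scaleR)
  have s1: "(\<Sum>i\<in>UNIV. (b i \<bullet> e) * (v \<bullet> b i)) = v \<bullet> e" for v
  proof -
    have "v \<bullet> e = (\<Sum>i\<in>UNIV. (v \<bullet> b i) *\<^sub>R b i) \<bullet> e" using expand[of v] by simp
    then show ?thesis by (simp add: inner_sum_left mult.commute)
  qed
  have s2: "(\<Sum>i\<in>UNIV. (b i \<bullet> e) * (L (b i) \<bullet> e)) = L e \<bullet> e"
  proof -
    have "L e = L (\<Sum>i\<in>UNIV. (e \<bullet> b i) *\<^sub>R b i)" using expand[of e] by simp
    also have "\<dots> = (\<Sum>i\<in>UNIV. (e \<bullet> b i) *\<^sub>R L (b i))"
      by (simp add: linear_sum[OF L] linear_scale[OF L])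
    finally show ?thesis by (simp add: inner_sum_left inner_commute[of e])
  qed
  have s3: "(\<Sum>i\<in>UNIV. (b i \<bullet> e) * (b i \<bullet> e)) = 1" using s1[of e] e by (simp add: inner_commute)
  have "L (reflect0 e (b i)) \<bullet> reflect0 e (b i) =
      L (b i) \<bullet> b i - 2 * ((b i \<bullet> e) * (L e \<bullet> b i)) - 2 * ((b i \<bullet> e) * (L (b i) \<bullet> e)) + 4 * (L e \<bullet> e) * ((b i \<bullet> e) * (b i \<bullet> e))" for i
    unfolding reflect0_def
    by (simp add: linear_diff[OF L] linear_scale[OF L] inner_diff_left inner_diff_right algebra_simps)
  then have "(\<Sum>i\<in>UNIV. L (reflect0 e (b i)) \<bullet> reflect0 e (b i)) = (\<Sum>i\<in>UNIV. L (b i) \<bullet> b i)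
      - 2 * (\<Sum>i\<in>UNIV. (b i \<bullet> e) * (L e \<bullet> b i)) - 2 * (\<Sum>i\<in>UNIV. (b i \<bullet> e) * (L (b i) \<bullet> e))
      + 4 * (L e \<bullet> e) * (\<Sum>i\<in>UNIV. (b i \<bullet> e) * (b i \<bullet> e))"
    by (simp only: sum.distrib sum_subtractf sum_distrib_left)
  also have "\<dots> = (\<Sum>i\<in>UNIV. L (b i) \<bullet> b i)" unfolding s1 s2 s3 by simp
  finally show ?thesis by (simp add: trace_hess_def reflect0_inner b_def L_def)
qed

lemma has_grad_hess_diff:
  assumes "has_grad_hess u g H" "has_grad_hess u' g' H'"
  shows "has_grad_hess (\<lambda>x. u x - u' x) (\<lambda>x. g x - g' x) (\<lambda>x v. H x v - H' x v)"
  unfolding has_grad_hess_def inner_diff_left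
proof (intro conjI allI)
  fix x
  show "((\<lambda>x. u x - u' x) has_derivative (\<lambda>v. g x \<bullet> v - g' x \<bullet> v)) (at x)"
    by (rule has_derivative_diff[OF grad[OF assms(1)] grad[OF assms(2)]])
  show "((\<lambda>x. g x - g' x) has_derivative (\<lambda>v. H x v - H' x v)) (at x)"
    by (rule has_derivative_diff[OF hess[OF assms(1)] hess[OF assms(2)]])
next
  fix v
  show "continuous_on UNIV (\<lambda>x. H x v - H' x v)"
    by (rule continuous_on_diff[OF hess_continuous[OF assms(1)] hess_continuous[OF assms(2)]])
qed

lemma trace_hess_diff: "trace_hess (\<lambda>x v. H x v - H' x v) x = trace_hess H x - trace_hess H' x"
  by (simp add: trace_hess_def inner_diff_left sum_subtractf)

lemma second_deriv_nonneg_at_min: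
  fixes f :: "real \<Rightarrow> real"
  assumes f: "\<And>t. (f has_real_derivative f' t) (at t)" and f': "(f' has_real_derivative c) (at 0)"
    and min: "\<forall>\<^sub>F t in nhds 0. f 0 \<le> f t"
  shows "c \<ge> 0"
proof (rule ccontr)
  assume "\<not> c \<ge> 0" then have c: "c < 0" by simp
  obtain d where d: "d > 0" "\<And>t. \<bar>t\<bar> < d \<Longrightarrow> f 0 \<le> f t"
    using min unfolding eventually_nhds_metric by (auto simp: dist_real_def)
  have f0: "f' 0 = 0" by (rule DERIV_local_min[OF f d(1)]) (use d(2) in auto)
  obtain d' where d': "d' > 0" "\<And>h. 0 < h \<Longrightarrow> h < d' \<Longrightarrow> f' (0 + h) < f' 0"
    using DERIV_neg_dec_right[OF f' c] by blast
  define h where "h = min d d' / 2"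
  have h: "0 < h" "h < d" "h < d'" using d d' by (auto simp: h_def)
  obtain z where z: "z > 0" "z < h" "f h - f 0 = (h - 0) * f' z"
    using MVT2[OF h(1), of f f'] f by blast
  have "f' z < 0" using d'(2)[of z] z h f0 by simp
  then have "h * f' z < 0" using h by (simp add: mult_pos_neg)
  then show False using z d(2)[of h] h by simp
qed

text \<open>The weak maximum principle at one point. \<open>\<Phi>\<close> is differentiated only
  along the coordinate lines through \<open>x0\<close>, so a barrier may be exchanged near the
  minimum for a smooth function touching it from above.\<close>

lemma laplacian_test:
  assumes gh: "has_grad_hess w gw Hw"
    and \<Phi>: "\<And>i t. ((\<lambda>t. \<Phi> (x0 + t *\<^sub>R axis i 1)) has_real_derivative \<Phi>' i t) (at t)"
    and \<Phi>': "\<And>i. (\<Phi>' i has_real_derivative c i) (at 0)"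
    and min: "\<forall>\<^sub>F x in nhds x0. w x0 + s * \<Phi> x0 \<le> w x + s * \<Phi> x"
  shows "0 \<le> trace_hess Hw x0 + s * (\<Sum>i\<in>UNIV. c i)"
proof -
  have "0 \<le> Hw x0 (axis i 1) \<bullet> axis i 1 + s * c i" for i
  proof (rule second_deriv_nonneg_at_min[where f="\<lambda>t. w (x0 + t *\<^sub>R axis i 1) + s * \<Phi> (x0 + t *\<^sub>R axis i 1)"])
    show "((\<lambda>t. w (x0 + t *\<^sub>R axis i 1) + s * \<Phi> (x0 + t *\<^sub>R axis i 1)) has_real_derivative
        gw (x0 + t *\<^sub>R axis i 1) \<bullet> axis i 1 + s * \<Phi>' i t) (at t)" for t
      by (intro DERIV_add DERIV_cmult deriv_along_line[OF gh] \<Phi>)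
    show "((\<lambda>t. gw (x0 + t *\<^sub>R axis i 1) \<bullet> axis i 1 + s * \<Phi>' i t) has_real_derivative
        Hw x0 (axis i 1) \<bullet> axis i 1 + s * c i) (at 0)"
      using DERIV_add[OF deriv2_along_line[OF gh, of x0 "axis i 1" "axis i 1" 0] DERIV_cmult[OF \<Phi>', of s i]] by simp
    have "((\<lambda>t::real. x0 + t *\<^sub>R axis i 1) \<longlongrightarrow> x0 + 0 *\<^sub>R axis i 1) (nhds 0)"
      by (intro tendsto_intros filterlim_ident)
    then have "filterlim (\<lambda>t::real. x0 + t *\<^sub>R axis i 1) (nhds x0) (nhds 0)" by simp
    from eventually_compose_filterlim[OF min this]
    show "\<forall>\<^sub>F t in nhds 0. w (x0 + 0 *\<^sub>R axis i 1) + s * \<Phi> (x0 + 0 *\<^sub>R axis i 1) \<le> w (x0 + t *\<^sub>R axis i 1) + s * \<Phi> (x0 + t *\<^sub>R axis i 1)"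
      by simp
  qed
  then have "0 \<le> (\<Sum>i\<in>UNIV. Hw x0 (axis i 1) \<bullet> axis i 1 + s * c i)" by (intro sum_nonneg) auto
  then show ?thesis by (simp add: trace_hess_def sum.distrib sum_distrib_left)
qed

text \<open>The radial barrier, evaluated at \<open>norm x ^ 2 + 3\<close>; the summand 3 exceeds
  \<open>exp 1\<close> and keeps the logarithm at least 1.\<close>

definition "Psi s = sqrt (ln (s::real))"
definition "Psi' s = 1 / (2 * s * Psi s)"
definition "Psi'' s = - (1 / (2 * s\<^sup>2 * Psi s) + 1 / (4 * s\<^sup>2 * ln s * Psi s))"

lemma ln_ge_1: "s \<ge> 3 \<Longrightarrow> ln (s::real) \<ge> 1"
  by (metis exp_le exp_gt_zero ln_exp ln_le_cancel_iff order_less_le_trans order_trans zero_less_numeral)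

lemma Psi_ge_1: "s \<ge> 3 \<Longrightarrow> Psi s \<ge> 1"
  using ln_ge_1[of s] by (simp add: Psi_def)

lemma Psi_sq: "s \<ge> 3 \<Longrightarrow> (Psi s)\<^sup>2 = ln s"
  using ln_ge_1[of s] by (simp add: Psi_def)

lemma DERIV_Psi: assumes s: "s \<ge> 3" shows "(Psi has_real_derivative Psi' s) (at s)"
proof -
  have "((\<lambda>s. sqrt (ln s)) has_real_derivative inverse (sqrt (ln s)) / 2 * (1 / s)) (at s)"
    using ln_ge_1[OF s] s by (intro DERIV_chain2[OF DERIV_real_sqrt] DERIV_ln_divide) auto
  moreover have "inverse (sqrt (ln s)) / 2 * (1 / s) = Psi' s"
    unfolding Psi'_def Psi_def by (simp only: inverse_eq_divide times_divide_times_eq divide_divide_eq_left mult_1 mult_ac)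
  ultimately show ?thesis by (simp only: Psi_def[abs_def])
qed

lemma DERIV_Psi': assumes s: "s \<ge> 3" shows "(Psi' has_real_derivative Psi'' s) (at s)"
proof -
  have p: "Psi s > 0" using Psi_ge_1[OF s] by linarith
  have "((\<lambda>s. 1 / (2 * s * Psi s)) has_real_derivative - (1 * (2 * Psi s + Psi' s * (2 * s))) / (2 * s * Psi s)\<^sup>2) (at s)"
    using p s by (auto intro!: derivative_eq_intros DERIV_Psi simp: power2_eq_square algebra_simps)
  moreover have "- (1 * (2 * Psi s + Psi' s * (2 * s))) / (2 * s * Psi s)\<^sup>2 = Psi'' s"
  proof -
    have l: "ln s = (Psi s)\<^sup>2" using Psi_sq[OF s] by simp
    show ?thesis unfolding Psi''_def Psi'_def l using p s by (simp add: field_simps power2_eq_square)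
  qed
  ultimately show ?thesis by (simp add: Psi'_def[abs_def])
qed

text \<open>With \<open>t = norm x ^ 2 + 3\<close> the left side is the planar Laplacian of
  \<open>Psi (norm x ^ 2 + 3)\<close>. The terms of order \<open>1 / (t * Psi t)\<close> cancel
  because \<open>ln (norm x)\<close> is harmonic; concavity of the square root leaves the negative
  main term.\<close>

lemma Psi_laplacian:
  assumes t: "t \<ge> 3"
  shows "4 * ((t - 3) * Psi'' t + Psi' t) = (6 * ln t + 3 - t) / (t\<^sup>2 * ln t * Psi t)"
proof -
  have p: "Psi t > 0" using Psi_ge_1[OF t] by linarith
  have l: "ln t = (Psi t)\<^sup>2" using Psi_sq[OF t] by simp
  show ?thesis unfolding Psi''_def Psi'_def l using p t by (simp add: field_simps power2_eq_square)
qed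

text \<open>A bound valid everywhere, to be beaten by the second derivative of the parabola in the
  strip.\<close>

lemma Psi_laplacian_le_1:
  assumes t: "t \<ge> 3" shows "(6 * ln t + 3 - t) / (t\<^sup>2 * ln t * Psi t) \<le> 1"
proof -
  have p: "Psi t \<ge> 1" "ln t \<ge> 1" using Psi_ge_1[OF t] ln_ge_1[OF t] by auto
  have "6 * ln t + 3 - t \<le> 9 * ln t" using p t by linarith
  also have "\<dots> \<le> t\<^sup>2 * ln t" using t p power_mono[of 3 t 2] by (intro mult_right_mono) auto
  also have "\<dots> = t\<^sup>2 * ln t * 1" by simp
  also have "\<dots> \<le> t\<^sup>2 * ln t * Psi t" using p by (intro mult_left_mono) auto
  finally show ?thesis using p t by (subst divide_le_eq_1_pos) auto
qed

lemma Psi_laplacian_far: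
  assumes t: "t \<ge> 3" "12 * ln t + 6 \<le> t" shows "(6 * ln t + 3 - t) / (t\<^sup>2 * ln t * Psi t) \<le> - (1 / (2 * t * ln t * Psi t))"
proof -
  have p: "Psi t > 0" "ln t > 0" using Psi_ge_1[OF t(1)] ln_ge_1[OF t(1)] by auto
  have "(6 * ln t + 3 - t) / (t\<^sup>2 * ln t * Psi t) \<le> (- t / 2) / (t\<^sup>2 * ln t * Psi t)"
    using t p by (intro divide_right_mono) auto
  also have "\<dots> = - (1 / (2 * t * ln t * Psi t))" using t p by (simp add: power2_eq_square)
  finally show ?thesis .
qed

lemma Psi_norm_deriv:
  fixes x v :: "real^2"
  defines "S \<equiv> \<lambda>t::real. (x + t *\<^sub>R v) \<bullet> (x + t *\<^sub>R v) + 3"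
  shows "((\<lambda>t. Psi (S t)) has_real_derivative Psi' (S t) * (2 * ((x + t *\<^sub>R v) \<bullet> v))) (at t)"
    and "((\<lambda>t. Psi' (S t) * (2 * ((x + t *\<^sub>R v) \<bullet> v))) has_real_derivative
       Psi'' (x \<bullet> x + 3) * (2 * (x \<bullet> v)) * (2 * (x \<bullet> v)) + Psi' (x \<bullet> x + 3) * (2 * (v \<bullet> v))) (at 0)"
proof -
  have S3: "S t \<ge> 3" for t by (simp add: S_def)
  have S: "(S has_real_derivative 2 * ((x + t *\<^sub>R v) \<bullet> v)) (at t)" for t
    unfolding S_def by (auto intro!: derivative_eq_intros simp: inner_simps inner_commute algebra_simps)
  have l: "((\<lambda>t. 2 * ((x + t *\<^sub>R v) \<bullet> v)) has_real_derivative 2 * (v \<bullet> v)) (at t)" for t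
    by (auto intro!: derivative_eq_intros simp: inner_simps)
  show "((\<lambda>t. Psi (S t)) has_real_derivative Psi' (S t) * (2 * ((x + t *\<^sub>R v) \<bullet> v))) (at t)"
    by (rule DERIV_chain2[OF DERIV_Psi[OF S3] S])
  have "((\<lambda>t. Psi' (S t) * (2 * ((x + t *\<^sub>R v) \<bullet> v))) has_real_derivative
     (Psi'' (S 0) * (2 * ((x + 0 *\<^sub>R v) \<bullet> v))) * (2 * ((x + 0 *\<^sub>R v) \<bullet> v)) + 2 * (v \<bullet> v) * Psi' (S 0)) (at 0)"
    by (rule DERIV_mult[OF DERIV_chain2[OF DERIV_Psi'[OF S3] S] l])
  then show "((\<lambda>t. Psi' (S t) * (2 * ((x + t *\<^sub>R v) \<bullet> v))) has_real_derivative
       Psi'' (x \<bullet> x + 3) * (2 * (x \<bullet> v)) * (2 * (x \<bullet> v)) + Psi' (x \<bullet> x + 3) * (2 * (v \<bullet> v))) (at 0)"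
    by (simp add: S_def mult.commute[of "Psi' _"])
qed

section \<open>The barrier\<close>

locale moving_planes =
  fixes K u :: "real^2 \<Rightarrow> real" and g H a B
  assumes K_cont: "continuous_on UNIV K"
    and K_mono: "\<And>x y. norm y \<le> norm x \<Longrightarrow> K x \<le> K y"
    and K_nonconst: "\<exists>y. K y \<noteq> K 0"
    and gh: "has_grad_hess u g H"
    and eq: "\<And>x. trace_hess H x = - (K x * exp (2 * u x))"
    and a: "a > 0" and asym: "\<And>x. \<bar>u x + a * ln (1 + norm x)\<bar> \<le> B"
    and decay: "\<And>\<eta>. \<eta> > 0 \<Longrightarrow> \<exists>R. \<forall>x. norm x \<ge> R \<longrightarrow>
       K x * (1 + norm x) powr (- 2 * a) * (norm x)\<^sup>2 * (ln (norm x))\<^sup>2 \<le> \<eta>"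
begin

lemma u_cont: "continuous_on S u" by (rule has_grad_hess_continuous[OF gh])

lemma exp_2u_le: "exp (2 * u y) \<le> exp (2 * B) * (1 + norm y) powr (- 2 * a)"
proof -
  have "exp (2 * B) * (1 + norm y) powr (- 2 * a) = exp (2 * (B - a * ln (1 + norm y)))"
    using add_pos_nonneg[OF zero_less_one norm_ge_zero[of y]] by (auto simp: powr_def exp_add[symmetric] algebra_simps)
  then show ?thesis using asym[of y] by simp
qed

lemma u_le: "u y \<le> B"
proof -
  have "a * ln (1 + norm y) \<ge> 0" using a by simp
  then show ?thesis using asym[of y] by linarith
qed

end

section \<open>Comparison with the mirror image\<close>

locale mirrored_planes = moving_planes +
  fixes e :: "real^2" assumes e: "e \<bullet> e = 1"
begin

definition "w \<tau> x = u x - u (reflect e \<tau> x)"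
definition "Hw \<tau> x v = H x v - reflect0 e (H (reflect e \<tau> x) (reflect0 e v))"

lemma norm_e: "norm e = 1" using e by (simp add: norm_eq_1)

lemma w_has_grad_hess: "has_grad_hess (w \<tau>) (\<lambda>x. g x - reflect0 e (g (reflect e \<tau> x))) (Hw \<tau>)"
  unfolding w_def[abs_def] Hw_def[abs_def] by (rule has_grad_hess_diff[OF gh has_grad_hess_reflect[OF gh]])

lemma w_cont: "continuous_on S (w \<tau>)"
  by (rule has_grad_hess_continuous[OF w_has_grad_hess])

lemma trace_Hw: "trace_hess (Hw \<tau>) x = K (reflect e \<tau> x) * exp (2 * u (reflect e \<tau> x)) - K x * exp (2 * u x)"
  unfolding Hw_def[abs_def] by (simp add: trace_hess_diff trace_reflect[OF e gh] eq)

lemma trace_Hw_le: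
  assumes "\<tau> > 0" "x \<bullet> e \<le> \<tau>"
  shows "trace_hess (Hw \<tau>) x \<le> K x * (exp (2 * u (reflect e \<tau> x)) - exp (2 * u x))"
proof -
  have "K (reflect e \<tau> x) \<le> K x" by (rule K_mono[OF norm_le_reflect[OF e assms]])
  then have "K (reflect e \<tau> x) * exp (2 * u (reflect e \<tau> x)) \<le> K x * exp (2 * u (reflect e \<tau> x))" by (rule mult_right_mono) simp
  then show ?thesis by (simp add: trace_Hw right_diff_distrib)
qed

lemma exp_diff_le: "exp (2 * s) - exp (2 * t) \<le> 2 * exp (2 * s) * (s - t)" for s t :: real
proof -
  have "1 + 2 * (t - s) \<le> exp (2 * (t - s))" by (rule exp_ge_add_one_self)
  then have "exp (2 * s) * (1 + 2 * (t - s)) \<le> exp (2 * s) * exp (2 * (t - s))" by (intro mult_left_mono) auto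
  also have "\<dots> = exp (2 * t)" by (simp add: exp_add[symmetric] algebra_simps)
  finally show ?thesis by (simp add: algebra_simps)
qed

text \<open>Where \<open>w < 0\<close> a negative \<open>K\<close> has the favourable sign, so only
  its positive part remains. Linearizing at the larger value puts the exponential at the reflected
  point, which is farther out and hence covered by the decay at \<open>x\<close>.\<close>

lemma trace_Hw_le_neg:
  assumes "\<tau> > 0" "x \<bullet> e \<le> \<tau>" "w \<tau> x < 0"
  shows "trace_hess (Hw \<tau>) x \<le> 2 * max 0 (K x) * exp (2 * u (reflect e \<tau> x)) * (- w \<tau> x)"
proof -
  define s where "s = u (reflect e \<tau> x)"
  have st: "u x < s" using assms(3) by (simp add: w_def s_def)
  have d: "0 \<le> exp (2 * s) - exp (2 * u x)" using st by simp
  have "trace_hess (Hw \<tau>) x \<le> K x * (exp (2 * s) - exp (2 * u x))" unfolding s_def by (rule trace_Hw_le[OF assms(1,2)])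
  also have "\<dots> \<le> max 0 (K x) * (exp (2 * s) - exp (2 * u x))" by (rule mult_right_mono[OF _ d]) simp
  also have "\<dots> \<le> max 0 (K x) * (2 * exp (2 * s) * (s - u x))" by (rule mult_left_mono[OF exp_diff_le]) simp
  finally show ?thesis by (simp add: w_def s_def mult_ac)
qed

lemma w_boundary: "x \<bullet> e = \<tau> \<Longrightarrow> w \<tau> x = 0"
  by (simp add: w_def reflect_boundary)

text \<open>The logarithmic main terms have the right order because reflection increases the norm.
  The bound is uniform in \<open>\<tau>\<close> and makes \<open>w\<close> negligible against a
  barrier tending to infinity.\<close>

lemma w_ge:
  assumes "\<tau> > 0" "x \<bullet> e \<le> \<tau>" shows "w \<tau> x \<ge> - 2 * B"
proof -
  have "1 + norm x > 0" by (intro add_pos_nonneg) auto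
  then have "ln (1 + norm x) \<le> ln (1 + norm (reflect e \<tau> x))"
    using norm_le_reflect[OF e assms] by (subst ln_le_cancel_iff) (auto intro: order_less_le_trans)
  then have "a * ln (1 + norm x) \<le> a * ln (1 + norm (reflect e \<tau> x))" using a by simp
  then show ?thesis using asym[of x] asym[of "reflect e \<tau> x"] unfolding w_def by linarith
qed

text \<open>The function \<open>\<phi> = Psi (norm x\<^sup>2 + 3) + f (x \<bullet> e)\<close>, where \<open>f\<close> is constant up to distance \<open>\<delta>\<close> from
  the mirror line and a steep downward parabola next to it, is a supersolution both far out, by
  the logarithmic decay of \<open>K exp (2 u)\<close>, and in the strip. Hence \<open>w / \<phi>\<close> has no negative minimum in these two regions.\<close>
lemma barrier:
  "\<exists>R \<delta>. \<delta> > 0 \<and> (\<forall>\<tau>>0. (\<forall>x. norm x \<le> R \<longrightarrow> x \<bullet> e \<le> \<tau> - \<delta> \<longrightarrow> w \<tau> x \<ge> 0) \<longrightarrow>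
     (\<forall>x. x \<bullet> e \<le> \<tau> \<longrightarrow> w \<tau> x \<ge> 0))"
proof -
  \<comment> \<open>Makes the final chain of the far case end in
    \<open>216 * exp (2 * B) * \<eta> = 1 / 2\<close>, contradicting the lower bound 1.\<close>
  define \<eta> where "\<eta> = 1 / (432 * exp (2 * B))"
  have "\<eta> > 0" by (simp add: \<eta>_def)
  then obtain R1 where R1: "\<And>x. norm x \<ge> R1 \<Longrightarrow> K x * (1 + norm x) powr (- 2 * a) * (norm x)\<^sup>2 * (ln (norm x))\<^sup>2 \<le> \<eta>"
    using decay by blast
  \<comment> \<open>The value 1/24 gives \<open>12 * ln S \<le> S / 2\<close>, the input of
    \<open>Psi_laplacian_far\<close>.\<close>
  have "\<forall>\<^sub>F t in at_top. (ln t / t) < (1/24::real)"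
    by (rule order_tendstoD[OF ln_x_over_x_tendsto_0]) simp
  then obtain T where T: "\<And>t. t \<ge> T \<Longrightarrow> ln t / t < (1/24::real)" unfolding eventually_at_top_linorder by blast
  define R where "R = Max {R1, 4, T}"
  have R: "R \<ge> R1" "R \<ge> 4" "R \<ge> T" by (auto simp: R_def)
  define s where "s x = x \<bullet> x + 3" for x :: "real^2"
  have s3: "s x \<ge> 3" for x by (simp add: s_def)
  define M where "M = Psi (R\<^sup>2 + 3)"
  define C0 where "C0 = 2 * max 0 (K 0) * exp (2 * B)"
  \<comment> \<open>In the strip within radius \<open>R\<close> one needs
    \<open>2 * k - 1 > C0 * (M + 2)\<close>, as \<open>C0 * (M + 2)\<close> bounds the zeroth order
    term and 1 the Laplacian of \<open>Psi\<close>.\<close>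
  define k where "k = C0 * (M + 2) + 1"
  have M1: "M \<ge> 1" unfolding M_def by (rule Psi_ge_1) simp
  have C00: "C0 \<ge> 0" by (simp add: C0_def)
  have k1: "k \<ge> 1" using M1 C00 by (simp add: k_def)
  \<comment> \<open>With this width the parabola drops by at most \<open>k * \<delta>^2 = 1\<close>,
    so \<open>f\<close> stays between 1 and 2 on the half plane.\<close>
  define \<delta> where "\<delta> = 1 / sqrt k"
  have \<delta>: "\<delta> > 0" "k * \<delta>\<^sup>2 = 1" using k1 by (simp_all add: \<delta>_def power_divide)
  have "w \<tau> x \<ge> 0" if \<tau>: "\<tau> > 0" and pos: "\<And>x. norm x \<le> R \<Longrightarrow> x \<bullet> e \<le> \<tau> - \<delta> \<Longrightarrow> w \<tau> x \<ge> 0" and xx: "x \<bullet> e \<le> \<tau>" for \<tau> x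
  proof (rule ccontr)
    assume "\<not> w \<tau> x \<ge> 0" then have wx: "w \<tau> x < 0" by simp
    define f where "f x = 2 - k * (max 0 (x \<bullet> e - \<tau> + \<delta>))\<^sup>2" for x
    define \<phi> where "\<phi> x = Psi (s x) + f x" for x
    have f12: "1 \<le> f x" "f x \<le> 2" if "x \<bullet> e \<le> \<tau>" for x
    proof -
      have "(max 0 (x \<bullet> e - \<tau> + \<delta>))\<^sup>2 \<le> \<delta>\<^sup>2" using that \<delta>(1) by (intro power_mono) auto
      then have "k * (max 0 (x \<bullet> e - \<tau> + \<delta>))\<^sup>2 \<le> k * \<delta>\<^sup>2" using k1 by (intro mult_left_mono) auto
      then show "1 \<le> f x" using \<delta>(2) by (simp add: f_def)
      show "f x \<le> 2" using k1 by (simp add: f_def)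
    qed
    have \<phi>_ge: "Psi (s x) \<le> \<phi> x" "2 \<le> \<phi> x" if "x \<bullet> e \<le> \<tau>" for x
      using f12[OF that] Psi_ge_1[OF s3, of x] by (auto simp: \<phi>_def)
    define r where "r x = w \<tau> x / \<phi> x" for x
    have rx: "r x < 0" unfolding r_def using wx \<phi>_ge(2)[OF xx] by (simp add: divide_neg_pos)
    \<comment> \<open>Outside this radius \<open>Psi (s y) \<ge> 2 * B / - r x\<close>, whence
      \<open>r y \<ge> r x\<close> by \<open>w_ge\<close>: the infimum of \<open>r\<close> over the
      half plane is attained on the compact set \<open>D\<close>.\<close>
    define \<rho> where "\<rho> = max (norm x) (exp ((2 * B / - r x)\<^sup>2))"
    define D where "D = {x. x \<bullet> e \<le> \<tau>} \<inter> cball 0 \<rho>"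
    have "compact D" unfolding D_def
      by (intro closed_Int_compact closed_Collect_le compact_cball continuous_intros)
    have nz: "\<phi> x \<noteq> 0" if "x \<in> D" for x using \<phi>_ge(2)[of x] that by (auto simp: D_def)
    have "s x \<noteq> 0" for x using s3[of x] by linarith
    moreover have "continuous_on D s" unfolding s_def by (intro continuous_intros)
    ultimately have "continuous_on D (\<lambda>x. Psi (s x))" unfolding Psi_def by (intro continuous_intros) auto
    then have "continuous_on D \<phi>" unfolding \<phi>_def f_def by (intro continuous_intros)
    then have cr: "continuous_on D r" unfolding r_def using nz by (intro continuous_on_divide w_cont) auto
    have xD: "x \<in> D" using xx by (simp add: D_def \<rho>_def)
    obtain x0 where x0: "x0 \<in> D" and min: "\<And>y. y \<in> D \<Longrightarrow> r x0 \<le> r y"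
      using continuous_attains_inf[OF \<open>compact D\<close> _ cr] xD by blast
    define c where "c = - r x0"
    have c: "c > 0" using min[OF xD] rx by (simp add: c_def)
    have min': "w \<tau> y + c * \<phi> y \<ge> 0" if y: "y \<bullet> e \<le> \<tau>" for y
    proof -
      have "- c \<le> r y"
      proof (cases "norm y \<le> \<rho>")
        case True then show ?thesis using min[of y] y by (simp add: D_def c_def)
      next
        case False
        have n1: "norm y \<ge> exp ((2 * B / - r x)\<^sup>2)" using False by (simp add: \<rho>_def)
        then have "norm y \<ge> 1" using one_le_exp_iff[of "(2 * B / - r x)\<^sup>2"] zero_le_power2 order_trans by blast
        then have "norm y \<le> s y" using mult_mono[of 1 "norm y" "norm y" "norm y"] by (simp add: s_def dot_square_norm power2_eq_square)
        then have "exp ((2 * B / - r x)\<^sup>2) \<le> s y" using n1 by linarith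
        then have "(2 * B / - r x)\<^sup>2 \<le> ln (s y)" using s3[of y] by (subst ln_ge_iff) auto
        then have "2 * B / - r x \<le> Psi (s y)" unfolding Psi_def by (rule real_le_rsqrt)
        also have "\<dots> \<le> \<phi> y" by (rule \<phi>_ge[OF y])
        finally have q: "2 * B / - r x \<le> \<phi> y" .
        have "2 * B \<le> \<phi> y * - r x" by (rule pos_divide_le_eq[THEN iffD1, OF _ q]) (use rx in simp)
        then have "- w \<tau> y \<le> \<phi> y * - r x" using w_ge[OF \<tau> y] by linarith
        then have "r x \<le> r y" using \<phi>_ge(2)[OF y] by (simp add: r_def[of y] le_divide_eq mult.commute)
        then show ?thesis using min[OF xD] by (simp add: c_def)
      qed
      then show ?thesis using \<phi>_ge(2)[OF y] by (simp add: r_def le_divide_eq)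
    qed
    have x0e: "x0 \<bullet> e \<le> \<tau>" using x0 by (simp add: D_def)
    have w0: "w \<tau> x0 = - c * \<phi> x0" using \<phi>_ge(2)[OF x0e] by (simp add: c_def r_def)
    then have w0neg: "w \<tau> x0 < 0" using c \<phi>_ge(2)[OF x0e] by (simp add: mult_pos_pos)
    then have x0lt: "x0 \<bullet> e < \<tau>" using x0e w_boundary[of x0 \<tau>] by linarith
    \<comment> \<open>The second derivative of \<open>f\<close> jumps at
      \<open>x \<bullet> e = \<tau> - \<delta>\<close>. At or beyond the jump the smooth replacement
      \<open>\<Phi>\<close> uses the constant 2, which lies above \<open>f\<close>; inside the strip
      it uses the parabola itself.\<close>
    define k' where "k' = (if x0 \<bullet> e \<le> \<tau> - \<delta> then 0 else k)"
    have k'0: "k' \<ge> 0" using k1 by (simp add: k'_def)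
    define \<Phi> where "\<Phi> x = Psi (s x) + (2 - k' * (x \<bullet> e - \<tau> + \<delta>)\<^sup>2)" for x
    have \<Phi>0: "\<Phi> x0 = \<phi> x0" by (simp add: \<Phi>_def \<phi>_def f_def k'_def)
    have \<Phi>ev: "\<forall>\<^sub>F y in nhds x0. \<phi> y \<le> \<Phi> y"
    proof (cases "x0 \<bullet> e \<le> \<tau> - \<delta>")
      case True
      then show ?thesis using k1 by (simp add: \<Phi>_def \<phi>_def f_def k'_def)
    next
      case False
      have "open {y::real^2. \<tau> - \<delta> < y \<bullet> e}" by (intro open_Collect_less continuous_intros)
      then have "\<forall>\<^sub>F y in nhds x0. \<tau> - \<delta> < y \<bullet> e" using False eventually_nhds_in_open[of "{y. \<tau> - \<delta> < y \<bullet> e}" x0] by simp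
      then show ?thesis by eventually_elim (use False in \<open>simp add: \<Phi>_def \<phi>_def f_def k'_def\<close>)
    qed
    have "open {y::real^2. y \<bullet> e < \<tau>}" by (intro open_Collect_less continuous_intros)
    then have "\<forall>\<^sub>F y in nhds x0. y \<bullet> e < \<tau>" using x0lt eventually_nhds_in_open[of "{y. y \<bullet> e < \<tau>}" x0] by simp
    with \<Phi>ev have "\<forall>\<^sub>F y in nhds x0. w \<tau> x0 + c * \<Phi> x0 \<le> w \<tau> y + c * \<Phi> y"
    proof eventually_elim
      case (elim y)
      have "c * \<phi> y \<le> c * \<Phi> y" using c elim by simp
      then show ?case using min'[of y] elim w0 \<Phi>0 by simp
    qed
    moreover have "((\<lambda>t. \<Phi> (x0 + t *\<^sub>R axis i 1)) has_real_derivative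
       Psi' (s (x0 + t *\<^sub>R axis i 1)) * (2 * ((x0 + t *\<^sub>R axis i 1) \<bullet> axis i 1)) -
        k' * (2 * (axis i 1 \<bullet> e)) * ((x0 + t *\<^sub>R axis i 1) \<bullet> e - \<tau> + \<delta>)) (at t)" for i t
    proof -
      have "((\<lambda>t. 2 - k' * ((x0 + t *\<^sub>R axis i 1) \<bullet> e - \<tau> + \<delta>)\<^sup>2) has_real_derivative
         - (k' * (2 * (axis i 1 \<bullet> e)) * ((x0 + t *\<^sub>R axis i 1) \<bullet> e - \<tau> + \<delta>))) (at t)"
        by (auto intro!: derivative_eq_intros simp: inner_simps algebra_simps)
      from DERIV_add[OF Psi_norm_deriv(1)[of x0 "axis i 1" t] this]
      show ?thesis unfolding \<Phi>_def s_def by simp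
    qed
    moreover have "((\<lambda>t. Psi' (s (x0 + t *\<^sub>R axis i 1)) * (2 * ((x0 + t *\<^sub>R axis i 1) \<bullet> axis i 1)) -
        k' * (2 * (axis i 1 \<bullet> e)) * ((x0 + t *\<^sub>R axis i 1) \<bullet> e - \<tau> + \<delta>)) has_real_derivative
       Psi'' (s x0) * (2 * (x0 \<bullet> axis i 1)) * (2 * (x0 \<bullet> axis i 1)) + Psi' (s x0) * (2 * (axis i 1 \<bullet> (axis i 1 :: real^2))) -
        k' * (2 * (axis i 1 \<bullet> e)) * (axis i 1 \<bullet> e)) (at 0)" for i
    proof -
      have "((\<lambda>t. k' * (2 * (axis i 1 \<bullet> e)) * ((x0 + t *\<^sub>R axis i 1) \<bullet> e - \<tau> + \<delta>)) has_real_derivative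
         k' * (2 * (axis i 1 \<bullet> e)) * (axis i 1 \<bullet> e)) (at 0)"
        by (rule DERIV_cmult) (auto intro!: derivative_eq_intros simp: inner_simps)
      from DERIV_diff[OF Psi_norm_deriv(2)[of x0 "axis i 1"] this]
      show ?thesis unfolding s_def .
    qed
    ultimately have "0 \<le> trace_hess (Hw \<tau>) x0 + c * (\<Sum>i\<in>UNIV. Psi'' (s x0) * (2 * (x0 \<bullet> axis i 1)) * (2 * (x0 \<bullet> axis i 1)) +
       Psi' (s x0) * (2 * (axis i 1 \<bullet> (axis i 1 :: real^2))) - k' * (2 * (axis i 1 \<bullet> e)) * (axis i 1 \<bullet> e))"
      by (intro laplacian_test[OF w_has_grad_hess])
    moreover have "(\<Sum>i\<in>UNIV. Psi'' (s x0) * (2 * (x0 \<bullet> axis i 1)) * (2 * (x0 \<bullet> axis i 1)) +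
       Psi' (s x0) * (2 * (axis i 1 \<bullet> (axis i 1 :: real^2))) - k' * (2 * (axis i 1 \<bullet> e)) * (axis i 1 \<bullet> e)) =
       (6 * ln (s x0) + 3 - s x0) / ((s x0)\<^sup>2 * ln (s x0) * Psi (s x0)) - 2 * k'"
    proof -
      have sq: "(\<Sum>i\<in>UNIV. (v \<bullet> axis i 1) * (v \<bullet> axis i 1)) = v \<bullet> v" for v :: "real^2"
        by (subst inner_vec_def) (simp add: inner_axis)
      have "(\<Sum>i\<in>UNIV. Psi'' (s x0) * (2 * (x0 \<bullet> axis i 1)) * (2 * (x0 \<bullet> axis i 1)) +
       Psi' (s x0) * (2 * (axis i 1 \<bullet> (axis i 1 :: real^2))) - k' * (2 * (axis i 1 \<bullet> e)) * (axis i 1 \<bullet> e)) =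
       (\<Sum>i\<in>UNIV. 4 * Psi'' (s x0) * ((x0 \<bullet> axis i 1) * (x0 \<bullet> axis i 1)) + 2 * Psi' (s x0) - 2 * k' * ((e \<bullet> axis i 1) * (e \<bullet> axis i 1)))"
        by (intro sum.cong refl) (simp add: inner_commute[of e] inner_axis_axis)
      also have "\<dots> = 4 * Psi'' (s x0) * (\<Sum>i\<in>UNIV. (x0 \<bullet> axis i 1) * (x0 \<bullet> axis i 1)) + 4 * Psi' (s x0)
          - 2 * k' * (\<Sum>i\<in>UNIV. (e \<bullet> axis i 1) * (e \<bullet> axis i 1))"
        by (simp only: sum.distrib sum_subtractf sum_distrib_left) simp
      also have "\<dots> = 4 * ((s x0 - 3) * Psi'' (s x0) + Psi' (s x0)) - 2 * k'"
        unfolding sq e by (simp add: s_def)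
      finally show ?thesis unfolding Psi_laplacian[OF s3] .
    qed
    moreover define L where "L = (6 * ln (s x0) + 3 - s x0) / ((s x0)\<^sup>2 * ln (s x0) * Psi (s x0))"
    moreover define V where "V = 2 * max 0 (K x0) * exp (2 * u (reflect e \<tau> x0))"
    moreover have "trace_hess (Hw \<tau>) x0 \<le> V * (c * \<phi> x0)"
      using trace_Hw_le_neg[OF \<tau> x0e w0neg] by (simp add: V_def w0)
    ultimately have "0 \<le> trace_hess (Hw \<tau>) x0 + c * (L - 2 * k')" "trace_hess (Hw \<tau>) x0 \<le> V * (c * \<phi> x0)"
      by (simp_all only:)
    then have "0 \<le> V * (c * \<phi> x0) + c * (L - 2 * k')" by linarith
    then have "0 \<le> c * (V * \<phi> x0 + L - 2 * k')" by (simp add: algebra_simps)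
    then have key: "2 * k' - L \<le> V * \<phi> x0" using c by (simp add: zero_le_mult_iff)
    have V0: "V \<ge> 0" by (simp add: V_def)
    show False
    proof (cases "norm x0 \<le> R")
      case True
      have "\<not> x0 \<bullet> e \<le> \<tau> - \<delta>" using pos[OF True] w0neg by linarith
      then have "k' = k" by (simp add: k'_def)
      have "L \<le> 1" unfolding L_def by (rule Psi_laplacian_le_1[OF s3])
      have "V \<le> C0" unfolding V_def C0_def using K_mono[of 0 x0] u_le[of "reflect e \<tau> x0"] by (intro mult_mono) auto
      have "Psi (s x0) \<le> M"
      proof -
        have "s x0 \<le> R\<^sup>2 + 3" using True power_mono[of "norm x0" R 2] by (simp add: s_def dot_square_norm)
        then show ?thesis unfolding M_def Psi_def using s3[of x0] by simp
      qed
      then have "\<phi> x0 \<le> M + 2" using f12[OF x0e] by (simp add: \<phi>_def)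
      then have "V * \<phi> x0 \<le> C0 * (M + 2)" using \<open>V \<le> C0\<close> V0 C00 \<phi>_ge(2)[OF x0e] by (intro mult_mono) auto
      then show False using key \<open>k' = k\<close> \<open>L \<le> 1\<close> k1 by (simp add: k_def)
    next
      case False
      define n where "n = norm x0"
      have n: "n \<ge> 4" "n \<ge> R1" "n \<ge> T" using False R by (auto simp: n_def)
      define S where "S = s x0"
      have S: "S = n\<^sup>2 + 3" by (simp add: S_def s_def n_def dot_square_norm)
      have n2: "n * n \<ge> 4 * n" "n * n * n \<ge> 4 * (n * n)" using n by (auto intro!: mult_right_mono)
      \<comment> \<open>Passing from \<open>S = n^2 + 3\<close> to \<open>n\<close> costs
        \<open>S \<le> 2 * n^2\<close> and \<open>ln S \<le> 3 * ln n\<close>, the origin of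
        \<open>108 = 6 * 2 * 9\<close> below.\<close>
      have Sn: "S \<ge> n" "S \<le> 2 * n\<^sup>2" "S \<le> n ^ 3" unfolding S power2_eq_square power3_eq_cube using n n2 by linarith+
      have lnS: "ln S \<le> 3 * ln n"
      proof -
        have "ln S \<le> ln (n ^ 3)" using Sn n by (subst ln_le_cancel_iff) auto
        then show ?thesis using n by (simp add: ln_realpow)
      qed
      have lnS1: "ln S \<ge> 1" "Psi S \<ge> 1" unfolding S_def by (rule ln_ge_1[OF s3], rule Psi_ge_1[OF s3])
      have "ln S / S < 1/24" using T[of S] n Sn by simp
      then have "12 * ln S \<le> S / 2" using Sn n by (simp add: field_simps)
      moreover have "S \<ge> 12" using n2(1) n(1) unfolding S power2_eq_square by linarith
      ultimately have "12 * ln S + 6 \<le> S" by linarith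
      then have L: "L \<le> - (1 / (2 * S * ln S * Psi S))" unfolding L_def S_def by (intro Psi_laplacian_far s3)
      have "\<phi> x0 \<le> 3 * Psi S" using f12[OF x0e] lnS1 by (simp add: \<phi>_def S_def)
      then have "V * \<phi> x0 \<le> V * (3 * Psi S)" using V0 by (rule mult_left_mono)
      then have "1 / (2 * S * ln S * Psi S) \<le> V * (3 * Psi S)" using key L k'0 by linarith
      then have "1 \<le> V * (3 * Psi S) * (2 * S * ln S * Psi S)" using lnS1 Sn n by (simp add: divide_le_eq)
      also have "\<dots> = 6 * V * S * ln S * (Psi S)\<^sup>2" by (simp add: power2_eq_square)
      also have "(Psi S)\<^sup>2 = ln S" unfolding S_def by (rule Psi_sq[OF s3])
      finally have "1 \<le> V * (6 * (S * (ln S * ln S)))" by (simp add: mult_ac)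
      also have "\<dots> \<le> V * (6 * (2 * n\<^sup>2 * ((3 * ln n) * (3 * ln n))))"
        using V0 lnS lnS1 Sn n by (intro mult_left_mono mult_mono) auto
      also have "\<dots> = V * (108 * (n\<^sup>2 * (ln n)\<^sup>2))" by (simp add: power2_eq_square)
      also have "\<dots> \<le> 2 * max 0 (K x0) * (exp (2 * B) * (1 + n) powr (- 2 * a)) * (108 * (n\<^sup>2 * (ln n)\<^sup>2))"
      proof (intro mult_right_mono)
        have "exp (2 * u (reflect e \<tau> x0)) \<le> exp (2 * B) * (1 + norm (reflect e \<tau> x0)) powr (- 2 * a)" by (rule exp_2u_le)
        also have "\<dots> \<le> exp (2 * B) * (1 + n) powr (- 2 * a)"
          using norm_le_reflect[OF e \<tau> x0e] a n by (intro mult_left_mono powr_mono2') (auto simp: n_def)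
        finally show "V \<le> 2 * max 0 (K x0) * (exp (2 * B) * (1 + n) powr (- 2 * a))"
          unfolding V_def by (intro mult_left_mono) auto
      qed auto
      also have "\<dots> = 216 * exp (2 * B) * (max 0 (K x0) * (1 + n) powr (- 2 * a) * n\<^sup>2 * (ln n)\<^sup>2)" by simp
      also have "\<dots> \<le> 216 * exp (2 * B) * \<eta>"
      proof (rule mult_left_mono)
        show "max 0 (K x0) * (1 + n) powr (- 2 * a) * n\<^sup>2 * (ln n)\<^sup>2 \<le> \<eta>"
          using R1[of x0] n \<open>\<eta> > 0\<close> by (cases "K x0 \<ge> 0") (auto simp: n_def)
      qed simp
      also have "\<dots> = 1 / 2" by (simp add: \<eta>_def)
      finally show False by simp
    qed
  qed
  then show ?thesis using \<delta>(1) by blast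
qed

end

section \<open>Moving planes\<close>

context mirrored_planes
begin

section \<open>Strict positivity on the open half plane\<close>

lemma open_halfplane: "open {x::real^2. x \<bullet> e < \<tau>}"
  by (intro open_Collect_less continuous_intros)

text \<open>A strong maximum principle from solid means. Near \<open>x0\<close> the Laplacian of
  \<open>w\<close> is at most \<open>L * w\<close>, so the disc integral \<open>F\<close> satisfies
  \<open>F' \<le> r * L * F\<close> with \<open>F 0 = 0\<close>; Gronwall gives
  \<open>F r \<le> 0\<close>, and \<open>w \<ge> 0\<close> forces \<open>w = 0\<close> on the
  disc.\<close>

lemma w_vanishes_near_zero:
  assumes \<tau>: "\<tau> > 0" and nn: "\<And>x. x \<bullet> e \<le> \<tau> \<Longrightarrow> w \<tau> x \<ge> 0" and x0: "x0 \<bullet> e < \<tau>" "w \<tau> x0 = 0"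
  shows "\<exists>r>0. \<forall>x\<in>ball x0 r. w \<tau> x = 0"
proof -
  obtain r where r: "r > 0" "cball x0 r \<subseteq> {x. x \<bullet> e < \<tau>}"
    using open_contains_cball[of "{x. x \<bullet> e < \<tau>}"] open_halfplane x0 by blast
  have cK: "continuous_on UNIV (\<lambda>x. 2 * \<bar>K x\<bar> * exp (2 * u x))" by (intro continuous_intros K_cont u_cont)
  obtain L where L: "L > 0" "\<And>y. y \<in> cball x0 r \<Longrightarrow> norm (2 * \<bar>K y\<bar> * exp (2 * u y)) \<le> L"
    using bounded_on_cball[OF cK] by blast
  \<comment> \<open>Here \<open>w \<ge> 0\<close>, so linearization takes place at the larger value
    \<open>u y\<close>, and either sign of \<open>K\<close> costs at most
    \<open>\<bar>K\<bar>\<close>.\<close>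
  have tr: "trace_hess (Hw \<tau>) y \<le> L * w \<tau> y" if y: "y \<in> cball x0 r" for y
  proof -
    have ye: "y \<bullet> e \<le> \<tau>" using r(2) y by (auto intro: less_imp_le)
    define s where "s = u (reflect e \<tau> y)"
    have ws: "w \<tau> y = u y - s" by (simp add: w_def s_def)
    have w0: "w \<tau> y \<ge> 0" by (rule nn[OF ye])
    have "trace_hess (Hw \<tau>) y \<le> K y * (exp (2 * s) - exp (2 * u y))" unfolding s_def by (rule trace_Hw_le[OF \<tau> ye])
    also have "\<dots> \<le> \<bar>K y\<bar> * (exp (2 * u y) - exp (2 * s))"
    proof -
      have "exp (2 * u y) - exp (2 * s) \<ge> 0" using w0 ws by simp
      then have "(- K y) * (exp (2 * u y) - exp (2 * s)) \<le> \<bar>K y\<bar> * (exp (2 * u y) - exp (2 * s))" by (intro mult_right_mono) auto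
      then show ?thesis by (simp add: algebra_simps)
    qed
    also have "\<dots> \<le> \<bar>K y\<bar> * (2 * exp (2 * u y) * (u y - s))" by (rule mult_left_mono[OF exp_diff_le]) simp
    also have "\<dots> = 2 * \<bar>K y\<bar> * exp (2 * u y) * w \<tau> y" by (simp add: ws)
    also have "\<dots> \<le> L * w \<tau> y" using L(2)[OF y] w0 by (intro mult_right_mono) auto
    finally show ?thesis .
  qed
  define F where "F t = (\<integral>y. indicator (ball 0 1) y * w \<tau> (x0 + t *\<^sub>R y) \<partial>lborel)" for t
  define F' where "F' t = t * (\<integral>y. indicator (ball 0 1) y * ((1 - (norm y)\<^sup>2) / 2 * trace_hess (Hw \<tau>) (x0 + t *\<^sub>R y)) \<partial>lborel)" for t
  have F: "(F has_real_derivative F' t) (at t)" for t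
    unfolding F_def[abs_def] F'_def by (rule solid_mean_deriv[OF w_has_grad_hess])
  have iw: "integrable lborel (\<lambda>y. indicator (ball 0 1) y * w \<tau> (x0 + t *\<^sub>R y))" for t
    by (intro integrable_indicator_ball continuous_on_compose2[OF w_cont[of UNIV]] continuous_intros) auto
  have it: "integrable lborel (\<lambda>y. indicator (ball 0 1) y * ((1 - (norm y)\<^sup>2) / 2 * trace_hess (Hw \<tau>) (x0 + t *\<^sub>R y)))" for t
    by (intro integrable_indicator_ball continuous_intros continuous_on_compose2[OF trace_continuous[OF w_has_grad_hess, of UNIV]]) auto
  have in_cball: "x0 + t *\<^sub>R y \<in> cball x0 r" if "0 \<le> t" "t \<le> r" "norm y < 1" for t y
    using mult_mono[of t r "norm y" 1] that r(1) by (simp add: dist_norm)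
  have w_in: "w \<tau> x \<ge> 0" if "x \<in> cball x0 r" for x using r(2) that by (intro nn) (auto intro: less_imp_le)
  have Fnn: "F t \<ge> 0" if "0 \<le> t" "t \<le> r" for t
    unfolding F_def using in_cball[OF that] w_in by (intro Bochner_Integration.integral_nonneg) (auto simp: indicator_def)
  have F'le: "F' t \<le> (r * L) * F t" if t: "0 \<le> t" "t \<le> r" for t
  proof -
    have "(\<integral>y. indicator (ball 0 1) y * ((1 - (norm y)\<^sup>2) / 2 * trace_hess (Hw \<tau>) (x0 + t *\<^sub>R y)) \<partial>lborel)
       \<le> (\<integral>y. L * (indicator (ball 0 1) y * w \<tau> (x0 + t *\<^sub>R y)) \<partial>lborel)"
    proof (rule integral_mono[OF it integrable_mult_right[OF iw]])
      fix y :: "real^2"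
      show "indicator (ball 0 1) y * ((1 - (norm y)\<^sup>2) / 2 * trace_hess (Hw \<tau>) (x0 + t *\<^sub>R y)) \<le> L * (indicator (ball 0 1) y * w \<tau> (x0 + t *\<^sub>R y))"
      proof (cases "norm y < 1")
        case True
        define z where "z = x0 + t *\<^sub>R y"
        have z: "z \<in> cball x0 r" unfolding z_def by (rule in_cball[OF t True])
        define p where "p = (1 - (norm y)\<^sup>2) / 2"
        have p: "0 \<le> p" "p \<le> 1"
          using power_le_one[of "norm y" 2] True zero_le_power2[of "norm y"] by (auto simp: p_def intro: order_trans[OF _ zero_le_power2])
        have "p * trace_hess (Hw \<tau>) z \<le> p * (L * w \<tau> z)" using p tr[OF z] by (intro mult_left_mono) auto
        also have "\<dots> \<le> 1 * (L * w \<tau> z)" using p L(1) w_in[OF z] by (intro mult_right_mono) auto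
        finally show ?thesis using True by (simp add: p_def z_def)
      qed simp
    qed
    then have "F' t \<le> t * (L * F t)" unfolding F'_def F_def using t by (intro mult_left_mono) auto
    also have "\<dots> \<le> r * (L * F t)" using t L(1) Fnn[OF t] by (intro mult_right_mono) auto
    finally show ?thesis by simp
  qed
  \<comment> \<open>The integrating factor of Gronwall's inequality.\<close>
  define G where "G t = F t * exp (- (r * L) * t)" for t
  have "G r \<le> G 0"
  proof (rule DERIV_nonpos_imp_nonincreasing[of 0 r G])
    show "\<exists>y. (G has_real_derivative y) (at t) \<and> y \<le> 0" if "0 \<le> t" "t \<le> r" for t
    proof (intro exI conjI)
      show "(G has_real_derivative (F' t - r * L * F t) * exp (- (r * L) * t)) (at t)"
        unfolding G_def[abs_def] by (auto intro!: derivative_eq_intros F simp: algebra_simps)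
      show "(F' t - r * L * F t) * exp (- (r * L) * t) \<le> 0"
        using F'le[OF that] by (intro mult_nonpos_nonneg) auto
    qed
  qed (use r in simp)
  moreover have "G 0 = 0" by (simp add: G_def F_def x0)
  ultimately have "F r \<le> 0" by (simp add: G_def mult_le_0_iff)
  have "w \<tau> x = 0" if x: "x \<in> ball x0 r" for x
  proof (rule ccontr)
    assume "w \<tau> x \<noteq> 0"
    then have wx: "w \<tau> x > 0" using w_in[of x] x by (simp add: order_le_less)
    define y where "y = (x - x0) /\<^sub>R r"
    have xy: "x = x0 + r *\<^sub>R y" using r(1) by (simp add: y_def)
    have "norm y = norm (x - x0) / r"
      using r(1) norm_scaleR[of "inverse r" "x - x0"] by (simp only: y_def abs_inverse abs_of_pos divide_inverse_commute)
    then have y1: "norm y < 1" using x r(1) by (simp add: dist_norm norm_minus_commute)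
    have "continuous_on UNIV (\<lambda>y. w \<tau> (x0 + r *\<^sub>R y))"
      by (intro continuous_on_compose2[OF w_cont[of UNIV]] continuous_intros) auto
    then have "open {y. w \<tau> x / 2 < w \<tau> (x0 + r *\<^sub>R y)}" by (intro open_Collect_less continuous_intros)
    then have "open (ball 0 1 \<inter> {y. w \<tau> x / 2 < w \<tau> (x0 + r *\<^sub>R y)})" by auto
    moreover have "y \<in> ball 0 1 \<inter> {y. w \<tau> x / 2 < w \<tau> (x0 + r *\<^sub>R y)}" using y1 wx xy by simp
    ultimately obtain d where d: "d > 0" "ball y d \<subseteq> ball 0 1 \<inter> {y. w \<tau> x / 2 < w \<tau> (x0 + r *\<^sub>R y)}"
      using open_contains_ball by blast
    have "w \<tau> x / 2 * (pi * d\<^sup>2) \<le> (\<integral>z. indicator (ball y d) z * (indicator (ball 0 1) z * w \<tau> (x0 + r *\<^sub>R z)) \<partial>lborel)"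
    proof (rule integral_ball_ge[OF iw])
      show "0 \<le> indicator (ball 0 1) z * w \<tau> (x0 + r *\<^sub>R z)" for z
        using in_cball[of r z] w_in r(1) by (auto simp: indicator_def)
      show "w \<tau> x / 2 \<le> indicator (ball 0 1) z * w \<tau> (x0 + r *\<^sub>R z)" if "z \<in> ball y d" for z
      proof -
        have "z \<in> ball 0 1" "w \<tau> x / 2 < w \<tau> (x0 + r *\<^sub>R z)" using d(2) that by blast+
        then show ?thesis by simp
      qed
    qed (use d in simp)
    also have "\<dots> \<le> F r" unfolding F_def
      by (rule integral_indicator_le[OF iw]) (use in_cball[of r] w_in r(1) in \<open>auto simp: indicator_def\<close>)
    finally have "w \<tau> x / 2 * (pi * d\<^sup>2) \<le> 0" using \<open>F r \<le> 0\<close> by linarith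
    moreover have "w \<tau> x / 2 * (pi * d\<^sup>2) > 0" using wx d(1) by simp
    ultimately show False by linarith
  qed
  then show ?thesis using r(1) by blast
qed

text \<open>If \<open>w\<close> vanished, the equation would compare \<open>K\<close> with its
  reflection. Reflecting \<open>- s *\<^sub>R e\<close>, then using that \<open>K\<close> is radial,
  gives a value at distance \<open>s + 2 * \<tau>\<close> that is not smaller; iterating from 0,
  monotonicity makes \<open>K\<close> constant.\<close>

lemma w_not_identically_zero:
  assumes \<tau>: "\<tau> > 0" shows "\<exists>x. x \<bullet> e < \<tau> \<and> w \<tau> x \<noteq> 0"
proof (rule ccontr)
  assume "\<not> (\<exists>x. x \<bullet> e < \<tau> \<and> w \<tau> x \<noteq> 0)"
  then have w0: "w \<tau> x = 0" if "x \<bullet> e < \<tau>" for x using that by blast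
  have Keq: "K x \<le> K (reflect e \<tau> x)" if x: "x \<bullet> e < \<tau>" for x
  proof -
    have "\<forall>\<^sub>F y in nhds x. y \<bullet> e < \<tau>" using x eventually_nhds_in_open[OF open_halfplane] by simp
    then have "\<forall>\<^sub>F y in nhds x. w \<tau> x + 0 * 0 \<le> w \<tau> y + 0 * 0"
      by eventually_elim (simp add: w0 x)
    then have "0 \<le> trace_hess (Hw \<tau>) x + 0 * (\<Sum>i\<in>(UNIV::2 set). 0)"
      by (intro laplacian_test[OF w_has_grad_hess, where \<Phi>="\<lambda>_. 0" and \<Phi>'="\<lambda>_ _. 0"]) auto
    then have "0 \<le> (K (reflect e \<tau> x) - K x) * exp (2 * u x)"
      using w0[OF x] by (simp add: trace_Hw w_def left_diff_distrib)
    then show ?thesis by (simp add: zero_le_mult_iff)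
  qed
  have step: "K ((- s) *\<^sub>R e) \<le> K ((- (s + 2 * \<tau>)) *\<^sub>R e)" if "s \<ge> 0" for s
  proof -
    have "K ((- s) *\<^sub>R e) \<le> K (reflect e \<tau> ((- s) *\<^sub>R e))" using that \<tau> e by (intro Keq) simp
    also have "reflect e \<tau> ((- s) *\<^sub>R e) = (s + 2 * \<tau>) *\<^sub>R e"
      using e by (simp add: reflect_def scaleR_left_diff_distrib[symmetric] scaleR_left_distrib[symmetric] scaleR_minus_left[symmetric] del: scaleR_minus_left)
    also have "K ((s + 2 * \<tau>) *\<^sub>R e) \<le> K ((- (s + 2 * \<tau>)) *\<^sub>R e)" by (rule K_mono) (simp only: norm_scaleR abs_minus_cancel order_refl)
    finally show ?thesis .
  qed
  have mult: "K 0 \<le> K ((- (2 * \<tau> * real n)) *\<^sub>R e)" for n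
  proof (induction n)
    case (Suc n)
    have "K ((- (2 * \<tau> * real n)) *\<^sub>R e) \<le> K ((- (2 * \<tau> * real n + 2 * \<tau>)) *\<^sub>R e)" using \<tau> by (intro step) simp
    also have "2 * \<tau> * real n + 2 * \<tau> = 2 * \<tau> * real (Suc n)" by (simp add: algebra_simps)
    finally show ?case using Suc by linarith
  qed simp
  have "K y = K 0" for y
  proof -
    obtain n where n: "norm y / (2 * \<tau>) \<le> real n" using real_arch_simple by blast
    then have "norm y \<le> 2 * \<tau> * real n" using \<tau> by (simp add: divide_le_eq mult.commute)
    then have "K ((- (2 * \<tau> * real n)) *\<^sub>R e) \<le> K y" using \<tau> by (intro K_mono) (simp add: norm_e)
    then show ?thesis using mult[of n] K_mono[of 0 y] by simp
  qed
  then show False using K_nonconst by blast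
qed

text \<open>The zero set of \<open>w\<close> is open and closed in the connected open half plane,
  but not all of it.\<close>

lemma w_positive:
  assumes \<tau>: "\<tau> > 0" and nn: "\<And>x. x \<bullet> e \<le> \<tau> \<Longrightarrow> w \<tau> x \<ge> 0" and x: "x \<bullet> e < \<tau>"
  shows "w \<tau> x > 0"
proof (rule ccontr)
  assume "\<not> w \<tau> x > 0"
  then have wx: "w \<tau> x = 0" using nn[of x] x by simp
  define S where "S = {x. x \<bullet> e < \<tau>}"
  define Z where "Z = {x \<in> S. w \<tau> x = 0}"
  have "connected S" unfolding S_def
    by (rule convex_connected) (use convex_halfspace_lt[of e \<tau>] in \<open>simp add: inner_commute\<close>)
  moreover have "openin (top_of_set S) Z"
  proof -
    have "open Z" unfolding open_contains_ball
    proof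
      fix x0 assume "x0 \<in> Z"
      then have x0: "x0 \<bullet> e < \<tau>" "w \<tau> x0 = 0" by (auto simp: Z_def S_def)
      obtain r where r: "r > 0" "\<And>x. x \<in> ball x0 r \<Longrightarrow> w \<tau> x = 0"
        using w_vanishes_near_zero[OF \<tau> nn x0] by blast
      obtain r' where r': "r' > 0" "ball x0 r' \<subseteq> S"
        using open_contains_ball open_halfplane x0 unfolding S_def by blast
      have "ball x0 (min r r') \<subseteq> Z" using r r' by (auto simp: Z_def)
      then show "\<exists>r>0. ball x0 r \<subseteq> Z" using r(1) r'(1) by (intro exI[of _ "min r r'"]) simp
    qed
    then show ?thesis by (rule open_subset[rotated]) (auto simp: Z_def)
  qed
  moreover have "closedin (top_of_set S) Z"
  proof -
    have "Z = S \<inter> {x. w \<tau> x = 0}" by (auto simp: Z_def)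
    moreover have "closed {x. w \<tau> x = 0}" by (intro closed_Collect_eq w_cont continuous_intros)
    ultimately show ?thesis by (simp add: closedin_closed_Int)
  qed
  moreover have "x \<in> Z" using wx x by (simp add: Z_def S_def)
  ultimately have "Z = S" unfolding connected_clopen by blast
  then show False using w_not_identically_zero[OF \<tau>] unfolding Z_def S_def by blast
qed

section \<open>Continuity argument in the position of the mirror line\<close>

definition "good = {\<tau>. \<tau> > 0 \<and> (\<forall>x. x \<bullet> e \<le> \<tau> \<longrightarrow> w \<tau> x \<ge> 0)}"

lemma good_nonempty: "good \<noteq> {}"
proof -
  obtain R \<delta> where bar: "\<And>\<tau>. \<tau> > 0 \<Longrightarrow> (\<And>x. norm x \<le> R \<Longrightarrow> x \<bullet> e \<le> \<tau> - \<delta> \<Longrightarrow> w \<tau> x \<ge> 0) \<Longrightarrow> (\<forall>x. x \<bullet> e \<le> \<tau> \<longrightarrow> w \<tau> x \<ge> 0)"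
    using barrier by blast
  \<comment> \<open>Chosen so that \<open>a * ln E = 2 * B + a * ln (1 + \<bar>R\<bar>)\<close>: a
    reflected point this far out has a logarithmic drop exceeding the two errors \<open>B\<close> of
    the asymptotics.\<close>
  define E where "E = exp (2 * B / a) * (1 + \<bar>R\<bar>)"
  define \<tau> where "\<tau> = \<bar>R\<bar> + E"
  have "1 + \<bar>R\<bar> > 0" by linarith
  then have E: "E > 0" unfolding E_def by (rule mult_pos_pos[OF exp_gt_zero])
  then have \<tau>: "\<tau> > 0" unfolding \<tau>_def by (rule add_nonneg_pos[OF abs_ge_zero])
  have "w \<tau> x \<ge> 0" if x: "norm x \<le> R" for x
  proof -
    have xe: "\<bar>x \<bullet> e\<bar> \<le> \<bar>R\<bar>" using Cauchy_Schwarz_ineq2[of x e] x norm_e by simp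
    have "2 * \<tau> - x \<bullet> e \<le> norm (reflect e \<tau> x)"
      using Cauchy_Schwarz_ineq2[of "reflect e \<tau> x" e] norm_e by (simp add: reflect_inner[OF e])
    then have "E \<le> 1 + norm (reflect e \<tau> x)"
      using xe E \<tau>_def by linarith
    moreover have "exp (2 * B / a) * (1 + norm x) \<le> E" unfolding E_def using x by (intro mult_left_mono) auto
    ultimately have "exp (2 * B / a) * (1 + norm x) \<le> 1 + norm (reflect e \<tau> x)" by linarith
    moreover have n1: "1 + norm x > 0" by (intro add_pos_nonneg) auto
    ultimately have "ln (exp (2 * B / a) * (1 + norm x)) \<le> ln (1 + norm (reflect e \<tau> x))"
      by (subst ln_le_cancel_iff) (auto intro: add_pos_nonneg)
    then have "2 * B / a + ln (1 + norm x) \<le> ln (1 + norm (reflect e \<tau> x))" using n1 by (simp add: ln_mult_pos)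
    then have "a * (2 * B / a + ln (1 + norm x)) \<le> a * ln (1 + norm (reflect e \<tau> x))" using a by (intro mult_left_mono) auto
    then have "2 * B + a * ln (1 + norm x) \<le> a * ln (1 + norm (reflect e \<tau> x))" using a by (simp add: distrib_left)
    then show ?thesis using asym[of x] asym[of "reflect e \<tau> x"] unfolding w_def by linarith
  qed
  then have "\<tau> \<in> good" using bar[OF \<tau>] \<tau> by (simp add: good_def)
  then show ?thesis by blast
qed

lemma w_cont_param: "continuous_on S (\<lambda>\<tau>. w \<tau> x)"
proof -
  have "continuous_on S (\<lambda>\<tau>. reflect e \<tau> x)" unfolding reflect_def by (intro continuous_intros)
  then show ?thesis unfolding w_def by (intro continuous_intros continuous_on_compose2[OF u_cont[of UNIV]]) auto
qed

text \<open>A point with \<open>w < 0\<close> is not on the mirror line, where \<open>w = 0\<close>.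
  It therefore stays in the half plane, with \<open>w < 0\<close>, for all nearby positions.\<close>

lemma good_closed: "\<exists>\<epsilon>>0. \<forall>\<tau>. \<bar>\<tau> - \<tau>0\<bar> < \<epsilon> \<longrightarrow> \<tau> \<notin> good" if \<tau>0: "\<tau>0 > 0" "\<tau>0 \<notin> good"
proof -
  obtain x where x: "x \<bullet> e \<le> \<tau>0" "w \<tau>0 x < 0" using \<tau>0 by (auto simp: good_def not_le)
  have "x \<bullet> e \<noteq> \<tau>0" using w_boundary[of x \<tau>0] x(2) by auto
  then have xl: "x \<bullet> e < \<tau>0" using x(1) by simp
  have "open ({\<tau>. w \<tau> x < 0} \<inter> {\<tau>. x \<bullet> e < \<tau>})"
    by (intro open_Int open_Collect_less w_cont_param continuous_intros)
  then obtain \<epsilon> where \<epsilon>: "\<epsilon> > 0" "ball \<tau>0 \<epsilon> \<subseteq> {\<tau>. w \<tau> x < 0} \<inter> {\<tau>. x \<bullet> e < \<tau>}"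
    using open_contains_ball x xl by (metis (mono_tags, lifting) IntI mem_Collect_eq)
  have "\<tau> \<notin> good" if "\<bar>\<tau> - \<tau>0\<bar> < \<epsilon>" for \<tau>
  proof -
    have "\<tau> \<in> ball \<tau>0 \<epsilon>" using that by (simp add: dist_real_def abs_minus_commute)
    then have "w \<tau> x < 0" "x \<bullet> e < \<tau>" using \<epsilon>(2) by blast+
    then show ?thesis by (auto simp: good_def not_le intro!: exI[of _ x])
  qed
  then show ?thesis using \<epsilon>(1) by blast
qed

text \<open>\<open>barrier\<close> reduces the claim to a compact set away from the mirror line.
  There \<open>w\<close> has a positive minimum by \<open>w_positive\<close>, which survives small
  shifts because \<open>u\<close> is uniformly continuous.\<close>

lemma good_open: "\<exists>\<epsilon>>0. \<forall>\<tau>. \<bar>\<tau> - \<tau>0\<bar> < \<epsilon> \<longrightarrow> \<tau> \<in> good" if g0: "\<tau>0 \<in> good"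
proof -
  have \<tau>0: "\<tau>0 > 0" and nn: "\<And>x. x \<bullet> e \<le> \<tau>0 \<Longrightarrow> w \<tau>0 x \<ge> 0" using g0 by (auto simp: good_def)
  obtain R \<delta> where \<delta>: "\<delta> > 0" and bar: "\<And>\<tau>. \<tau> > 0 \<Longrightarrow> (\<And>x. norm x \<le> R \<Longrightarrow> x \<bullet> e \<le> \<tau> - \<delta> \<Longrightarrow> w \<tau> x \<ge> 0) \<Longrightarrow> (\<forall>x. x \<bullet> e \<le> \<tau> \<longrightarrow> w \<tau> x \<ge> 0)"
    using barrier by blast
  define D where "D = {x. x \<bullet> e \<le> \<tau>0 - \<delta> / 2} \<inter> cball 0 R"
  have cD: "compact D" unfolding D_def by (intro closed_Int_compact closed_Collect_le compact_cball continuous_intros)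
  have "\<exists>m>0. \<forall>x\<in>D. m \<le> w \<tau>0 x"
  proof (cases "D = {}")
    case True then show ?thesis by (intro exI[of _ 1]) auto
  next
    case False
    obtain x1 where x1: "x1 \<in> D" "\<And>x. x \<in> D \<Longrightarrow> w \<tau>0 x1 \<le> w \<tau>0 x"
      using continuous_attains_inf[OF cD False w_cont[of D \<tau>0]] by blast
    have "w \<tau>0 x1 > 0" using x1(1) \<delta> by (intro w_positive[OF \<tau>0 nn]) (auto simp: D_def)
    then show ?thesis using x1(2) by blast
  qed
  then obtain \<mu> where \<mu>: "\<mu> > 0" "\<And>x. x \<in> D \<Longrightarrow> \<mu> \<le> w \<tau>0 x" by blast
  \<comment> \<open>A disc containing the reflections of all points of norm at most \<open>R\<close>
    for every position in \<open>(0, \<tau>0 + 1]\<close>.\<close>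
  define R' where "R' = 3 * \<bar>R\<bar> + 2 * \<tau>0 + 2"
  have "uniformly_continuous_on (cball 0 R') u" by (intro compact_uniformly_continuous u_cont compact_cball)
  then obtain d where d: "d > 0" "\<And>x y. x \<in> cball 0 R' \<Longrightarrow> y \<in> cball 0 R' \<Longrightarrow> dist y x < d \<Longrightarrow> dist (u y) (u x) < \<mu>"
    using \<mu>(1) unfolding uniformly_continuous_on_def by metis
  \<comment> \<open>A shift of the line moves a reflected point twice as far, hence
    \<open>d / 2\<close>. The bound \<open>\<delta> / 2\<close> keeps
    \<open>x \<bullet> e \<le> \<tau> - \<delta>\<close> inside \<open>D\<close>, and
    \<open>\<tau>0\<close> keeps the position positive.\<close>
  define \<epsilon> where "\<epsilon> = Min {d / 2, \<delta> / 2, \<tau>0, 1}"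
  have \<epsilon>: "\<epsilon> > 0" "\<epsilon> \<le> d / 2" "\<epsilon> \<le> \<delta> / 2" "\<epsilon> \<le> \<tau>0" "\<epsilon> \<le> 1" using d(1) \<delta> \<tau>0 by (auto simp: \<epsilon>_def)
  have "\<tau> \<in> good" if t: "\<bar>\<tau> - \<tau>0\<bar> < \<epsilon>" for \<tau>
  proof -
    have \<tau>: "\<tau> > 0" "\<tau> < \<tau>0 + \<delta> / 2" "\<tau> \<le> \<tau>0 + 1" using t \<epsilon> by linarith+
    have "\<forall>x. x \<bullet> e \<le> \<tau> \<longrightarrow> w \<tau> x \<ge> 0"
    proof (rule bar[OF \<tau>(1)])
      fix x assume x: "norm x \<le> R" "x \<bullet> e \<le> \<tau> - \<delta>"
      have xD: "x \<in> D" using x \<tau> by (simp add: D_def)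
      have xe: "\<bar>x \<bullet> e\<bar> \<le> \<bar>R\<bar>" using Cauchy_Schwarz_ineq2[of x e] x norm_e by simp
      have bd: "reflect e \<sigma> x \<in> cball 0 R'" if "0 < \<sigma>" "\<sigma> \<le> \<tau>0 + 1" for \<sigma>
      proof -
        have "norm (reflect e \<sigma> x) \<le> norm x + \<bar>2 * (x \<bullet> e - \<sigma>)\<bar>"
          unfolding reflect_def using norm_triangle_ineq4[of x "(2 * (x \<bullet> e - \<sigma>)) *\<^sub>R e"] norm_e by simp
        then show ?thesis using x xe that by (simp add: R'_def)
      qed
      have "dist (reflect e \<tau> x) (reflect e \<tau>0 x) < d"
      proof -
        have "reflect e \<tau> x - reflect e \<tau>0 x = (2 * (\<tau> - \<tau>0)) *\<^sub>R e"
        proof -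
          have "2 * (\<tau> - \<tau>0) = 2 * (x \<bullet> e - \<tau>0) - 2 * (x \<bullet> e - \<tau>)" by simp
          then show ?thesis unfolding reflect_def by (simp only: scaleR_left_diff_distrib) simp
        qed
        then show ?thesis using t \<epsilon> norm_e by (simp add: dist_norm abs_mult)
      qed
      then have "dist (u (reflect e \<tau> x)) (u (reflect e \<tau>0 x)) < \<mu>" using \<tau> \<tau>0 by (intro d(2) bd) auto
      then show "w \<tau> x \<ge> 0" using \<mu>(2)[OF xD] by (simp add: w_def dist_real_def)
    qed
    then show ?thesis using \<tau>(1) by (simp add: good_def)
  qed
  then show ?thesis using \<epsilon>(1) by blast
qed

lemma w_nonneg:
  assumes "\<tau> > 0" "x \<bullet> e \<le> \<tau>" shows "w \<tau> x \<ge> 0"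
proof -
  have sub: "good \<subseteq> {0<..}" by (auto simp: good_def)
  have "openin (top_of_set {0<..}) good"
  proof -
    have "open good" unfolding open_dist using good_open by (simp add: dist_real_def)
    then show ?thesis using sub by (rule open_subset[rotated])
  qed
  moreover have "closedin (top_of_set {0<..}) good"
  proof -
    have "open ({0<..} - good)" unfolding open_dist
    proof
      fix \<tau> :: real assume "\<tau> \<in> {0<..} - good"
      then obtain \<epsilon> where \<epsilon>: "\<epsilon> > 0" "\<And>\<sigma>. \<bar>\<sigma> - \<tau>\<bar> < \<epsilon> \<Longrightarrow> \<sigma> \<notin> good" "\<tau> > 0" using good_closed[of \<tau>] by auto
      have "\<sigma> \<in> {0<..} - good" if "dist \<sigma> \<tau> < min \<epsilon> \<tau>" for \<sigma>
      proof -
        have "\<bar>\<sigma> - \<tau>\<bar> < \<epsilon>" "\<bar>\<sigma> - \<tau>\<bar> < \<tau>" using that by (auto simp: dist_real_def)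
        then show ?thesis using \<epsilon>(2) by auto
      qed
      then show "\<exists>\<epsilon>>0. \<forall>\<sigma>. dist \<sigma> \<tau> < \<epsilon> \<longrightarrow> \<sigma> \<in> {0<..} - good" using \<epsilon> by (intro exI[of _ "min \<epsilon> \<tau>"]) simp
    qed
    then have "openin (top_of_set {0<..}) ({0<..} - good)" by (rule open_subset[rotated]) auto
    then show ?thesis using sub by (simp add: closedin_def)
  qed
  ultimately have "good = {0<..}"
    using good_nonempty connected_clopen[THEN iffD1, OF connected_Ioi] by blast
  then show ?thesis using assms by (auto simp: good_def)
qed

end

section \<open>From reflections to radial monotonicity\<close>

context moving_planes
begin

lemma radially_decreasing:
  assumes "norm x \<le> norm y" shows "u y \<le> u x"
proof -
  have strict: "u y \<le> u x" if lt: "norm x < norm y" for x y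
  proof -
    define d where "d = norm (y - x)"
    have d: "d > 0" using lt by (auto simp: d_def)
    define e where "e = (y - x) /\<^sub>R d"
    have ee: "e \<bullet> e = 1" using d by (simp add: e_def d_def dot_square_norm power2_eq_square)
    interpret mirrored_planes K u g H a B e by unfold_locales (rule ee)
    \<comment> \<open>The mirror line is the perpendicular bisector of \<open>x\<close> and
      \<open>y\<close>; \<open>norm x < norm y\<close> places the origin on the side of
      \<open>x\<close>, that is \<open>\<tau> > 0\<close>.\<close>
    define \<tau> where "\<tau> = (y \<bullet> y - x \<bullet> x) / (2 * d)"
    have "x \<bullet> x < y \<bullet> y" using lt by (simp add: dot_square_norm power_strict_mono)
    then have \<tau>: "\<tau> > 0" using d by (simp add: \<tau>_def)
    have "d * d = (y - x) \<bullet> (y - x)" by (simp add: d_def dot_square_norm power2_eq_square)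
    then have dd: "d * d = y \<bullet> y - 2 * (x \<bullet> y) + x \<bullet> x" by (simp add: inner_diff_left inner_diff_right inner_commute)
    have "x \<bullet> e = (x \<bullet> y - x \<bullet> x) / d" by (simp add: e_def inner_diff_right divide_inverse mult.commute)
    then have "\<tau> - x \<bullet> e = (y \<bullet> y - 2 * (x \<bullet> y) + x \<bullet> x) / (2 * d)" using d by (simp add: \<tau>_def field_simps)
    also have "\<dots> = d / 2" unfolding dd[symmetric] using d by simp
    finally have xe: "x \<bullet> e - \<tau> = - d / 2" by simp
    have "reflect e \<tau> x = x + d *\<^sub>R e" unfolding reflect_def xe by simp
    also have "\<dots> = y" using d by (simp add: e_def)
    finally have "reflect e \<tau> x = y" .
    moreover have "w \<tau> x \<ge> 0" using \<tau> xe d by (intro w_nonneg) auto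
    ultimately show ?thesis by (simp add: w_def)
  qed
  show ?thesis
  proof (cases "y = 0")
    case True then show ?thesis using assms by simp
  next
    case False
    \<comment> \<open>Equal norms are reached by continuity, pushing \<open>y\<close> slightly
      outward.\<close>
    have c: "((\<lambda>n. u ((1 + inverse (real (Suc n))) *\<^sub>R y)) \<longlonglongrightarrow> u ((1 + 0) *\<^sub>R y))"
      by (intro isCont_tendsto_compose[of _ u] tendsto_intros LIMSEQ_inverse_real_of_nat)
         (use u_cont[of UNIV] in \<open>simp add: continuous_on_eq_continuous_at\<close>)
    have "u ((1 + inverse (real (Suc n))) *\<^sub>R y) \<le> u x" for n
    proof (rule strict)
      have "0 < inverse (real (Suc n)) * norm y" using False by simp
      then have "norm x < norm y + inverse (real (Suc n)) * norm y" using assms by linarith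
      then have "norm x < (1 + inverse (real (Suc n))) * norm y" by (simp only: distrib_right mult_1)
      then show "norm x < norm ((1 + inverse (real (Suc n))) *\<^sub>R y)" by simp
    qed
    then show ?thesis using LIMSEQ_le_const2[OF c] by auto
  qed
qed

end

lemma holder_loc_continuous:
  assumes "0 < \<alpha>" "holder_loc \<alpha> K" shows "continuous_on UNIV K"
proof -
  have "isCont K x" for x
  proof -
    obtain M where M: "\<And>y z. y \<in> cball x 1 \<Longrightarrow> z \<in> cball x 1 \<Longrightarrow> \<bar>K y - K z\<bar> \<le> M * dist y z powr \<alpha>"
      using assms(2) unfolding holder_loc_def by (metis compact_cball)
    have "((\<lambda>y. dist y x powr \<alpha>) \<longlongrightarrow> dist x x powr \<alpha>) (at x)"
      using assms(1) by (intro tendsto_powr' tendsto_dist tendsto_ident_at tendsto_const) (auto intro: always_eventually)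
    then have "((\<lambda>y. M * dist y x powr \<alpha>) \<longlongrightarrow> 0) (at x)" using tendsto_mult_right_zero by fastforce
    moreover have "\<forall>\<^sub>F y in at x. norm (K y - K x) \<le> M * dist y x powr \<alpha>"
      unfolding eventually_at using M[of _ x] by (intro exI[of _ 1]) (auto simp: dist_commute)
    ultimately have "((\<lambda>y. K y - K x) \<longlongrightarrow> 0) (at x)" by (rule Lim_null_comparison[rotated])
    then show ?thesis unfolding isCont_def by (simp add: LIM_zero_iff)
  qed
  then show ?thesis by (simp add: continuous_on_eq_continuous_at)
qed

theorem theorem3p7:
  fixes K u :: "real^2 \<Rightarrow> real"
  assumes hoelder: "\<exists>\<alpha>. 0 < \<alpha> \<and> \<alpha> \<le> 1 \<and> holder_loc \<alpha> K"
    and K_mono: "\<forall>x y. norm x \<ge> norm y \<longrightarrow> K x \<le> K y"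
    and K_unbdd: "\<not> (\<exists>B. \<forall>x. B \<le> K x) \<longrightarrow>
        ((\<exists>C>0. \<exists>R. \<forall>x. norm x \<ge> R \<longrightarrow> \<bar>K x\<bar> \<le> C * (INF y\<in>ball x 1. \<bar>K y\<bar>)) \<or>
         (\<exists>P\<ge>1. \<exists>C>0. \<exists>R. \<forall>x. norm x \<ge> R \<longrightarrow> \<bar>K x\<bar> \<le> C * \<bar>ln (norm x)\<bar> powr P))"
    and u_C2: "C2 u"
    and eq: "\<forall>x. laplacian u x + K x * exp (2 * u x) = 0"
    and fin: "integrable lborel (\<lambda>x. \<bar>K x\<bar> * exp (2 * u x))"
    and uplus: "\<forall>R>0. \<exists>C. \<forall>y. (LINT x : ball y R | lborel. max (u x) 0) \<le> C"
    and total: "ereal (LINT x | lborel. K x * exp (2 * u x)) = kappa_star K"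
    and logmom: "integrable lborel (\<lambda>x. \<bar>ln (norm x)\<bar>^2 * \<bar>K x\<bar> * exp (2 * u x))"
  shows "\<exists>xs :: real^2. (\<forall>x y. dist x xs \<ge> dist y xs \<longrightarrow> u x \<le> u y) \<and>
           ((\<exists>x. K x \<noteq> 0) \<longrightarrow> xs = 0)"
proof -
  obtain g H where gh: "has_grad_hess u g H" using C2_imp_has_grad_hess[OF u_C2] by blast
  obtain C where C: "\<And>y. (LINT x : ball y 1 | lborel. max (u x) 0) \<le> C" using uplus zero_less_one by metis
  interpret curvature_solution K u g H C
  proof
    show "continuous_on UNIV K" using hoelder holder_loc_continuous by blast
    show "trace_hess H x = - (K x * exp (2 * u x))" for x
      using eq[rule_format, of x] unfolding laplacian_eq_trace[OF gh] by (simp add: eq_neg_iff_add_eq_0)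
    show "(\<integral>z. indicator (ball y 1) z * max (u z) 0 \<partial>lborel) \<le> C" for y
      using C[of y] by (simp add: set_lebesgue_integral_def)
  qed (use K_mono gh fin total logmom in auto)
  have "u x \<le> u y" if "norm y \<le> norm x" for x y
  proof (cases "\<exists>z. K z \<noteq> 0")
    case False
    then show ?thesis using zero_curvature[of x y] by simp
  next
    case True
    then obtain z where z: "K z \<noteq> 0" by blast
    obtain B where B: "\<And>x. \<bar>u x + a * ln (1 + norm x)\<bar> \<le> B" using asymptotics(2)[OF z] by blast
    interpret moving_planes K u g H a B
      by unfold_locales (use K_cont K_nonconstant[OF z] asymptotics(1)[OF z] B decay[OF z] gh eq K_mono in auto)
    show ?thesis using radially_decreasing[OF that] .
  qed
  \<comment> \<open>The origin serves in both cases: for vanishing \<open>K\<close> the solution is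
    constant, so any centre would do.\<close>
  then show ?thesis by (intro exI[of _ 0]) simp
qed

end
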